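(* Let $n\ge 1$ be an integer and let $d\ge 2$ be an even integer. Then $\Sigma^{SPQ}_{n,d} = N^{SPQ}_{n,d}$ if and only if $n=1$, or $d=2$, or $(n,d)=(2,4)$.
   Context: All polynomials have real coefficients. A polynomial $p:\mathbb{R}^n\to\mathbb{R}$ is separable plus quadratic (SPQ) if $p(x)=s(x)+q(x)$, where $s(x)=\sum_{i=1}^n s_i(x_i)$ for some univariate polynomials $s_i:\mathbb{R}\to\mathbb{R}$ and $q(x)$ is a quadratic polynomial (degree at most $2$, not necessarily homogeneous). A polynomial is nonnegative if $p(x)\ge 0$ for all $x\in\mathbb{R}^n$, and a sum of squares (sos) if $p=\sum_{i=1}^m q_i^2$ for some polynomials $q_1,\dots,q_m$. $N^{SPQ}_{n,d}$ denotes the set of nonnegative SPQ polynomials in $n$ variables and of degree $d$, and $\Sigma^{SPQ}_{n,d}$ denotes the set of sos SPQ polynomials in $n$ variables and of degree $d$. *)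

theory Defs
  imports "HOL-Analysis.Analysis" "HOL-Library.Poly_Mapping"
    "HOL-Computational_Algebra.Polynomial"
begin

text \<open>
  A real multivariate polynomial is an element of the monoid algebra of the exponent
  vectors \<^typ>\<open>nat \<Rightarrow>\<^sub>0 nat\<close> over the reals; the ring operations (convolution product, powers)
  are those of \<^theory>\<open>HOL-Library.Poly_Mapping\<close>. The variables are indexed from 0, so the
  polynomials in n variables are those involving only the variables 0, ..., n - 1.
\<close>

type_synonym rmpoly = "(nat \<Rightarrow>\<^sub>0 nat) \<Rightarrow>\<^sub>0 real"

definition polys_in :: "nat \<Rightarrow> rmpoly set" where
  "polys_in n = {p. \<forall>m \<in> Poly_Mapping.keys p. Poly_Mapping.keys m \<subseteq> {..<n}}"

definition monom_degree :: "(nat \<Rightarrow>\<^sub>0 nat) \<Rightarrow> nat" where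
  "monom_degree m = (\<Sum>i \<in> Poly_Mapping.keys m. Poly_Mapping.lookup m i)"

text \<open>The zero polynomial gets degree 0.\<close>

definition total_degree :: "rmpoly \<Rightarrow> nat" where
  "total_degree p = Max (insert 0 (monom_degree ` Poly_Mapping.keys p))"

definition eval_mpoly :: "rmpoly \<Rightarrow> (nat \<Rightarrow> real) \<Rightarrow> real" where
  "eval_mpoly p x =
    (\<Sum>m \<in> Poly_Mapping.keys p.
       Poly_Mapping.lookup p m * (\<Prod>i \<in> Poly_Mapping.keys m. x i ^ Poly_Mapping.lookup m i))"

text \<open>
  In the next two definitions points are functions \<^typ>\<open>nat \<Rightarrow> real\<close> rather than n-tuples. For a
  polynomial in n variables the coordinates from n on do not influence the value, so
  quantifying over all such functions is the same as quantifying over n-tuples.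
\<close>

definition spq :: "nat \<Rightarrow> rmpoly \<Rightarrow> bool" where
  "spq n p \<longleftrightarrow> p \<in> polys_in n \<and>
    (\<exists>(s :: nat \<Rightarrow> real poly) q. q \<in> polys_in n \<and> total_degree q \<le> 2 \<and>
       (\<forall>x. eval_mpoly p x = (\<Sum>i<n. poly (s i) (x i)) + eval_mpoly q x))"

definition nonneg_mpoly :: "rmpoly \<Rightarrow> bool" where
  "nonneg_mpoly p \<longleftrightarrow> (\<forall>x. eval_mpoly p x \<ge> 0)"

definition sos :: "nat \<Rightarrow> rmpoly \<Rightarrow> bool" where
  "sos n p \<longleftrightarrow>
    (\<exists>(m :: nat) (q :: nat \<Rightarrow> rmpoly). (\<forall>j<m. q j \<in> polys_in n) \<and> p = (\<Sum>j<m. q j ^ 2))"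

text \<open>In both sets, ``of degree d'' means total degree exactly d.\<close>

definition N_SPQ :: "nat \<Rightarrow> nat \<Rightarrow> rmpoly set" where
  "N_SPQ n d = {p. spq n p \<and> total_degree p = d \<and> nonneg_mpoly p}"

definition Sigma_SPQ :: "nat \<Rightarrow> nat \<Rightarrow> rmpoly set" where
  "Sigma_SPQ n d = {p. spq n p \<and> total_degree p = d \<and> sos n p}"

end

theory Submission
  imports Defs
begin

text \<open>
  A nonnegative univariate polynomial is a sum of squares by splitting off the minimum, which
  leaves a double root; a nonnegative quadratic polynomial by completing squares. For \<open>(n, d) = (2, 4)\<close>
  Hilbert's theorem on ternary quartics applies. It is proved following Choi and Lam: a nonzero
  positive semidefinite ternary quartic dominates the square of a nonzero quadratic form, so the
  extreme points of a compact base of the cone of such quartics are squares, and Krein-Milman finishes.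

  For \<open>n \<ge> 3\<close>, \<open>d = 4\<close> the polynomial \<open>\<Sum> x\<^sub>i\<^sup>4 - 2 \<Sum> x\<^sub>i\<^sup>2 + 24 \<Sum> x\<^sub>i x\<^sub>k + 113\<close> in three variables vanishes at
  the permutations of \<open>(2, 2, -3)\<close> and their negatives. The squares in a decomposition would vanish there too, which
  contradicts the shape of the leading form \<open>\<Sum> x\<^sub>i\<^sup>4\<close>.

  For \<open>n \<ge> 2\<close>, \<open>d \<ge> 6\<close> consider \<open>y\<^sup>4 + 2 y\<^sup>2 - 4 x y + s(x)\<close> with \<open>s\<close> of degree 6. A decomposition into squares
  \<open>(\<alpha>\<^sub>j y\<^sup>2 + A\<^sub>j y + B\<^sub>j)\<^sup>2\<close> produces the polynomial \<open>a = \<Sum> A\<^sub>j\<^sup>2\<close>, whose value at \<open>x\<^sub>0\<close> is forced to be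
  \<open>2 + 2 y\<^sub>0\<^sup>2\<close> at every zero \<open>(x\<^sub>0, y\<^sub>0)\<close>, and which has degree at most 2, hence is convex. Choosing \<open>s\<close> such that the zeros
  are \<open>(0, 0)\<close>, \<open>(2, 1)\<close>, \<open>(10, 2)\<close> makes this impossible. A compactness argument shows that adding
  \<open>\<delta> x\<^sup>d\<close> with small \<open>\<delta> > 0\<close> preserves the obstruction.
\<close>

section \<open>Evaluation and weighted degrees\<close>

text \<open>Both SPQ sets fix the total degree exactly, so one bad sextic does not settle larger d:
  a term \<open>\<delta> * x^d\<close> has to be added, and it destroys the zeros of the sextic at x
  = 2 and x = 10. Hence the obstruction in two variables is not stated at zeros but as the
  inequality (2 y^2 + 2 - a(x))^2 <= 4 p(x, y) for all x and y. It survives a limit, and at \<delta>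
  = 0 it becomes an equation at each zero. The quartic in three variables already has the right
  degree, so its zeros can be used directly.

  The part y^4 + 2 y^2 - 4 x y is chosen because its minimum over y is explicit once x = u^3 + u.
  The value 2 + 2 u^2 that a must take grows only like |x|^(2/3). Between the contact points 0, 2,
  10 its slope drops from 1 to 3/4, which no convex function allows.\<close>

definition pp_eval :: "(nat \<Rightarrow> real) \<Rightarrow> (nat \<Rightarrow>\<^sub>0 nat) \<Rightarrow> real" where
  "pp_eval x m = (\<Prod>i \<in> Poly_Mapping.keys m. x i ^ Poly_Mapping.lookup m i)"

lemma pp_eval_superset:
  assumes "finite S" "Poly_Mapping.keys m \<subseteq> S"
  shows "pp_eval x m = (\<Prod>i \<in> S. x i ^ Poly_Mapping.lookup m i)"
  unfolding pp_eval_def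
  by (rule prod.mono_neutral_left) (use assms in \<open>auto simp: in_keys_iff\<close>)

lemma keys_add_nat:
  "Poly_Mapping.keys (m + m') = Poly_Mapping.keys m \<union> Poly_Mapping.keys (m' :: nat \<Rightarrow>\<^sub>0 nat)"
  by (auto simp: in_keys_iff lookup_add)

lemma pp_eval_0 [simp]: "pp_eval x 0 = 1"
  by (simp add: pp_eval_def)

lemma pp_eval_add: "pp_eval x (m + m') = pp_eval x m * pp_eval x m'"
proof -
  let ?S = "Poly_Mapping.keys m \<union> Poly_Mapping.keys m'"
  have "pp_eval x (m + m') = (\<Prod>i \<in> ?S. x i ^ Poly_Mapping.lookup (m + m') i)"
    by (rule pp_eval_superset) (auto simp: keys_add_nat)
  also have "\<dots> = (\<Prod>i \<in> ?S. x i ^ Poly_Mapping.lookup m i) * (\<Prod>i \<in> ?S. x i ^ Poly_Mapping.lookup m' i)"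
    by (simp add: lookup_add power_add prod.distrib)
  also have "\<dots> = pp_eval x m * pp_eval x m'"
    by (simp add: pp_eval_superset[of ?S])
  finally show ?thesis .
qed

lemma pp_eval_single [simp]: "pp_eval x (Poly_Mapping.single i k) = x i ^ k"
  by (cases "k = 0") (auto simp: pp_eval_def)

lemma eval_mpoly_superset:
  assumes "finite S" "Poly_Mapping.keys p \<subseteq> S"
  shows "eval_mpoly p x = (\<Sum>m \<in> S. Poly_Mapping.lookup p m * pp_eval x m)"
  unfolding eval_mpoly_def pp_eval_def[symmetric]
  by (rule sum.mono_neutral_left) (use assms in \<open>auto simp: in_keys_iff\<close>)

lemma eval_mpoly_0 [simp]: "eval_mpoly 0 x = 0"
  by (simp add: eval_mpoly_def)

lemma eval_mpoly_single [simp]: "eval_mpoly (Poly_Mapping.single m c) x = c * pp_eval x m"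
  by (cases "c = 0") (auto simp: eval_mpoly_def pp_eval_def)

lemma eval_mpoly_1 [simp]: "eval_mpoly 1 x = 1"
  by (simp flip: single_one)

lemma eval_mpoly_add [simp]: "eval_mpoly (p + q) x = eval_mpoly p x + eval_mpoly q x"
proof -
  let ?S = "Poly_Mapping.keys p \<union> Poly_Mapping.keys q"
  have "eval_mpoly (p + q) x = (\<Sum>m \<in> ?S. Poly_Mapping.lookup (p + q) m * pp_eval x m)"
    by (rule eval_mpoly_superset) (use keys_add[of p q] in auto)
  also have "\<dots> = eval_mpoly p x + eval_mpoly q x"
    by (simp add: eval_mpoly_superset[of ?S] lookup_add algebra_simps sum.distrib)
  finally show ?thesis .
qed

lemma eval_mpoly_sum [simp]: "eval_mpoly (\<Sum>i\<in>I. f i) x = (\<Sum>i\<in>I. eval_mpoly (f i) x)"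
  by (induction I rule: infinite_finite_induct) auto

lemma sum_single_keys:
  fixes p :: "'a \<Rightarrow>\<^sub>0 'b::comm_monoid_add"
  shows "(\<Sum>m\<in>Poly_Mapping.keys p. Poly_Mapping.single m (Poly_Mapping.lookup p m)) = p"
  by (rule poly_mapping_eqI)
    (auto simp: lookup_sum lookup_single when_def in_keys_iff)

lemma eval_mpoly_mult [simp]: "eval_mpoly (p * q) x = eval_mpoly p x * eval_mpoly q x"
proof -
  have "p * q = (\<Sum>m\<in>Poly_Mapping.keys p. Poly_Mapping.single m (Poly_Mapping.lookup p m)) *
      (\<Sum>m\<in>Poly_Mapping.keys q. Poly_Mapping.single m (Poly_Mapping.lookup q m))"
    by (simp add: sum_single_keys)
  also have "\<dots> = (\<Sum>m\<in>Poly_Mapping.keys p. \<Sum>m'\<in>Poly_Mapping.keys q.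
      Poly_Mapping.single (m + m') (Poly_Mapping.lookup p m * Poly_Mapping.lookup q m'))"
    by (simp add: sum_product mult_single)
  also have "eval_mpoly \<dots> x = eval_mpoly p x * eval_mpoly q x"
    by (simp add: eval_mpoly_superset[of "Poly_Mapping.keys p" p] eval_mpoly_superset[of "Poly_Mapping.keys q" q]
        sum_product pp_eval_add mult_ac)
  finally show ?thesis .
qed

lemma eval_mpoly_power [simp]: "eval_mpoly (p ^ k) x = eval_mpoly p x ^ k"
  by (induction k) auto

lemma polys_in_0 [simp]: "0 \<in> polys_in n"
  by (simp add: polys_in_def)

lemma polys_in_add [intro]: "p \<in> polys_in n \<Longrightarrow> q \<in> polys_in n \<Longrightarrow> p + q \<in> polys_in n"
  using keys_add[of p q] unfolding polys_in_def by blast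

lemma polys_in_sum [intro]: "(\<And>i. i \<in> I \<Longrightarrow> f i \<in> polys_in n) \<Longrightarrow> (\<Sum>i\<in>I. f i) \<in> polys_in n"
  by (induction I rule: infinite_finite_induct) auto

lemma polys_in_single [intro]:
  "Poly_Mapping.keys m \<subseteq> {..<n} \<Longrightarrow> Poly_Mapping.single m c \<in> polys_in n"
  by (auto simp: polys_in_def)

lemma polys_in_mult [intro]:
  assumes "p \<in> polys_in n" "q \<in> polys_in n" shows "p * q \<in> polys_in n"
  unfolding polys_in_def
proof safe
  fix m i assume m: "m \<in> Poly_Mapping.keys (p * q)" "i \<in> Poly_Mapping.keys m"
  then obtain a b where "a \<in> Poly_Mapping.keys p" "b \<in> Poly_Mapping.keys q" "m = a + b"
    using keys_mult[of p q] by auto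
  with m(2) assms show "i < n"
    unfolding polys_in_def by (auto simp: keys_add_nat)
qed

lemma polys_in_power [intro]: "p \<in> polys_in n \<Longrightarrow> p ^ k \<in> polys_in n"
  by (induction k) (auto simp flip: single_one)

lemma polys_in_mono: "n \<le> n' \<Longrightarrow> polys_in n \<subseteq> polys_in n'"
  unfolding polys_in_def by force

lemma polys_in_eval_cong:
  assumes "p \<in> polys_in n" "\<And>i. i < n \<Longrightarrow> x i = y i"
  shows "eval_mpoly p x = eval_mpoly p y"
  unfolding eval_mpoly_def
  by (intro sum.cong prod.cong arg_cong2[where f = "(*)"] refl arg_cong2[where f = "(^)"])
    (use assms in \<open>auto simp: polys_in_def\<close>)

text \<open>Three weights are used: constant 1 gives the total degree, the indicator of variable 1
  the degree in y, and powers of a base the Kronecker substitution.\<close>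

definition wt :: "(nat \<Rightarrow> nat) \<Rightarrow> (nat \<Rightarrow>\<^sub>0 nat) \<Rightarrow> nat" where
  "wt w m = (\<Sum>i \<in> Poly_Mapping.keys m. w i * Poly_Mapping.lookup m i)"

lemma wt_superset:
  assumes "finite S" "Poly_Mapping.keys m \<subseteq> S"
  shows "wt w m = (\<Sum>i \<in> S. w i * Poly_Mapping.lookup m i)"
  unfolding wt_def
  by (rule sum.mono_neutral_left) (use assms in \<open>auto simp: in_keys_iff\<close>)

lemma wt_const_1: "wt (\<lambda>_. 1) m = monom_degree m"
  by (simp add: wt_def monom_degree_def)

lemma total_degree_le_iff:
  "total_degree p \<le> k \<longleftrightarrow> (\<forall>m \<in> Poly_Mapping.keys p. monom_degree m \<le> k)"
  by (auto simp: total_degree_def)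

text \<open>This is p restricted to the curve t -> (t^(w i) x_i), as a polynomial in t. Its
  coefficient at t^d is the part of p of weight d, evaluated at x, so questions about weighted
  degree become univariate.\<close>

definition scale_poly :: "(nat \<Rightarrow> nat) \<Rightarrow> rmpoly \<Rightarrow> (nat \<Rightarrow> real) \<Rightarrow> real poly" where
  "scale_poly w p x =
    (\<Sum>m \<in> Poly_Mapping.keys p. monom (Poly_Mapping.lookup p m * pp_eval x m) (wt w m))"

lemma poly_scale_poly: "poly (scale_poly w p x) t = eval_mpoly p (\<lambda>i. t ^ w i * x i)"
proof -
  have "pp_eval (\<lambda>i. t ^ w i * x i) m = t ^ wt w m * pp_eval x m" for m
    by (simp add: pp_eval_def wt_def power_mult_distrib prod.distrib power_sum power_mult)
  then show ?thesis
    by (simp add: scale_poly_def poly_sum poly_monom eval_mpoly_superset[of "Poly_Mapping.keys p" p] mult_ac)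
qed

lemma coeff_scale_poly:
  "coeff (scale_poly w p x) d =
    (\<Sum>m \<in> {m \<in> Poly_Mapping.keys p. wt w m = d}. Poly_Mapping.lookup p m * pp_eval x m)"
  by (simp add: scale_poly_def coeff_sum sum.inter_filter)

lemma digits_unique:
  fixes f g :: "nat \<Rightarrow> nat"
  assumes "(\<Sum>i<n. N ^ i * f i) = (\<Sum>i<n. N ^ i * g i)"
    and "\<And>i. i < n \<Longrightarrow> f i < N" "\<And>i. i < n \<Longrightarrow> g i < N" "i < n"
  shows "f i = g i"
  using assms
proof (induction n arbitrary: f g i)
  case (Suc n)
  have split: "(\<Sum>i<Suc n. N ^ i * h i) = h 0 + N * (\<Sum>i<n. N ^ i * h (Suc i))" for h
    by (subst sum.lessThan_Suc_shift) (simp add: sum_distrib_left mult_ac)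
  have eq: "f 0 + N * (\<Sum>i<n. N ^ i * f (Suc i)) = g 0 + N * (\<Sum>i<n. N ^ i * g (Suc i))"
    using Suc.prems(1) unfolding split .
  have lt: "f 0 < N" "g 0 < N"
    using Suc.prems by auto
  have 0: "f 0 = g 0"
    using arg_cong[OF eq, of "\<lambda>k. k mod N"] lt by simp
  with eq lt have "(\<Sum>i<n. N ^ i * f (Suc i)) = (\<Sum>i<n. N ^ i * g (Suc i))"
    by simp
  from Suc.IH[OF this] have "f (Suc i) = g (Suc i)" if "i < n" for i
    using Suc.prems(2,3) that by simp
  with 0 Suc.prems(4) show ?case
    by (cases i) auto
qed simp

text \<open>Kronecker substitution: \<open>x i = t ^ (N ^ i)\<close> separates the monomials once N exceeds all exponents.\<close>

lemma eval_mpoly_eq_0_imp: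
  assumes "\<And>x. eval_mpoly p x = 0"
  shows "p = 0"
proof (rule ccontr)
  assume "p \<noteq> 0"
  then obtain m where m: "m \<in> Poly_Mapping.keys p"
    by (metis keys_eq_empty all_not_in_conv poly_mapping_eqI lookup_zero in_keys_iff)
  define V where "V = (\<Union>m \<in> Poly_Mapping.keys p. Poly_Mapping.keys m)"
  define E where "E = (\<Union>m \<in> Poly_Mapping.keys p. Poly_Mapping.range m)"
  obtain n where n: "\<And>i. i \<in> V \<Longrightarrow> i < n"
    using finite_nat_set_iff_bounded[of V] by (auto simp: V_def)
  obtain N0 where N0: "\<And>k. k \<in> E \<Longrightarrow> k < N0"
    using finite_nat_set_iff_bounded[of E] by (auto simp: E_def)
  \<comment> \<open>\<open>Poly_Mapping.range\<close> omits the value 0, so E says nothing about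
    missing exponents; the successor keeps N positive and thus 0 a valid digit.\<close>
  define N where "N = Suc N0"
  define w where "w i = N ^ i" for i :: nat
  have dig: "Poly_Mapping.lookup a i < N" if "a \<in> Poly_Mapping.keys p" for a i
  proof (cases "i \<in> Poly_Mapping.keys a")
    case True
    then have "Poly_Mapping.lookup a i \<in> E"
      using that by (auto simp: E_def intro!: bexI[of _ a] in_keys_lookup_in_range)
    then show ?thesis using N0 by (force simp: N_def)
  qed (simp add: in_keys_iff N_def)
  have inj: "a = b" if ab: "a \<in> Poly_Mapping.keys p" "b \<in> Poly_Mapping.keys p" "wt w a = wt w b" for a b
  proof (rule poly_mapping_eqI)
    fix i
    have sub: "Poly_Mapping.keys a \<subseteq> {..<n}" "Poly_Mapping.keys b \<subseteq> {..<n}"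
      using ab n by (auto simp: V_def)
    show "Poly_Mapping.lookup a i = Poly_Mapping.lookup b i"
    proof (cases "i < n")
      case True
      show ?thesis
      proof (rule digits_unique[OF _ _ _ True])
        show "(\<Sum>i<n. N ^ i * Poly_Mapping.lookup a i) = (\<Sum>i<n. N ^ i * Poly_Mapping.lookup b i)"
          using ab(3) sub by (simp add: wt_superset[of "{..<n}"] w_def)
      qed (use dig ab in auto)
    next
      case False
      then show ?thesis using sub
        by (metis in_keys_iff lessThan_iff subsetD)
    qed
  qed
  have "scale_poly w p (\<lambda>_. 1) = 0"
    using assms by (intro poly_eqI_degree_lead_coeff poly_ext)
      (simp add: poly_scale_poly flip: poly_eq_poly_eq_iff)
  then have "0 = coeff (scale_poly w p (\<lambda>_. 1)) (wt w m)"
    by simp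
  also have "\<dots> = (\<Sum>a \<in> {m}. Poly_Mapping.lookup p a)"
    unfolding coeff_scale_poly
    by (rule sum.cong) (use inj m in \<open>auto simp: pp_eval_def\<close>)
  finally show False
    using m by (simp add: in_keys_iff)
qed

lemma eval_mpoly_minus [simp]: "eval_mpoly (p - q) x = eval_mpoly p x - eval_mpoly q x"
  using eval_mpoly_add[of "p - q" q x] by simp

text \<open>\<open>sos\<close> is an identity of formal polynomials, while \<open>spq\<close> and
  \<open>nonneg_mpoly\<close> speak of values. This bridge lets every later identity be checked
  pointwise.\<close>

lemma eval_mpoly_inject:
  assumes "\<And>x. eval_mpoly p x = eval_mpoly q x"
  shows "p = q"
  using eval_mpoly_eq_0_imp[of "p - q"] assms by simp

lemma sosI:
  assumes "\<And>j. j < (m::nat) \<Longrightarrow> q j \<in> polys_in n"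
    and "\<And>x. eval_mpoly p x = (\<Sum>j<m. eval_mpoly (q j) x ^ 2)"
  shows "sos n p"
proof -
  have "p = (\<Sum>j<m. q j ^ 2)"
    by (rule eval_mpoly_inject) (simp add: assms(2))
  then show ?thesis
    using assms(1) unfolding sos_def by metis
qed

lemma sosE:
  assumes "sos n p"
  obtains m :: nat and q where "\<And>j. j < m \<Longrightarrow> q j \<in> polys_in n" "p = (\<Sum>j<m. q j ^ 2)"
    "\<And>x. eval_mpoly p x = (\<Sum>j<m. eval_mpoly (q j) x ^ 2)"
proof -
  obtain m :: nat and q where q: "\<forall>j<m. q j \<in> polys_in n" "p = (\<Sum>j<m. q j ^ 2)"
    using assms unfolding sos_def by metis
  from q(2) have "eval_mpoly p x = (\<Sum>j<m. eval_mpoly (q j) x ^ 2)" for x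
    by simp
  with q that show ?thesis by metis
qed

lemma sos_imp_nonneg: "sos n p \<Longrightarrow> nonneg_mpoly p"
  by (erule sosE) (simp add: nonneg_mpoly_def sum_nonneg)

lemma restrict_vars:
  obtains q' where "q' \<in> polys_in k" "\<And>x. eval_mpoly q' x = eval_mpoly q (\<lambda>i. if i < k then x i else 0)"
proof -
  let ?K = "{m \<in> Poly_Mapping.keys q. Poly_Mapping.keys m \<subseteq> {..<k}}"
  define q' where "q' = (\<Sum>m\<in>?K. Poly_Mapping.single m (Poly_Mapping.lookup q m))"
  have pp: "pp_eval (\<lambda>i. if i < k then x i else 0) m =
      (if Poly_Mapping.keys m \<subseteq> {..<k} then pp_eval x m else 0)" for x m
  proof (cases "Poly_Mapping.keys m \<subseteq> {..<k}")
    case True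
    then show ?thesis
      by (auto simp: pp_eval_def intro!: prod.cong)
  next
    case False
    then obtain i where "i \<in> Poly_Mapping.keys m" "\<not> i < k" by blast
    then show ?thesis
      using False by (auto simp: pp_eval_def in_keys_iff intro!: prod_zero bexI[of _ i])
  qed
  have "eval_mpoly q' x = eval_mpoly q (\<lambda>i. if i < k then x i else 0)" for x
    unfolding q'_def eval_mpoly_sum eval_mpoly_single
    by (simp add: eval_mpoly_superset[of "Poly_Mapping.keys q" q] pp sum.inter_filter[symmetric] if_distrib cong: if_cong)
  moreover have "q' \<in> polys_in k"
    unfolding q'_def by (intro polys_in_sum polys_in_single) auto
  ultimately show ?thesis
    using that by blast
qed

text \<open>Setting the surplus variables to 0 leaves p unchanged and keeps every square a square.
  Thus examples in two or three variables remain counterexamples for all larger n.\<close>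

lemma sos_fewer_vars:
  assumes "sos n p" "p \<in> polys_in k"
  shows "sos k p"
proof -
  obtain m :: nat and q where q: "\<And>x. eval_mpoly p x = (\<Sum>j<m. eval_mpoly (q j) x ^ 2)"
    using assms(1) by (metis sosE)
  have "\<exists>q'. q' \<in> polys_in k \<and> (\<forall>x. eval_mpoly q' x = eval_mpoly (q j) (\<lambda>i. if i < k then x i else 0))" for j
    by (rule restrict_vars[of k "q j"]) blast
  then obtain q' where q': "\<And>j. q' j \<in> polys_in k"
    "\<And>j x. eval_mpoly (q' j) x = eval_mpoly (q j) (\<lambda>i. if i < k then x i else 0)"
    by metis
  have "eval_mpoly p x = (\<Sum>j<m. eval_mpoly (q' j) x ^ 2)" for x
    using q[of "\<lambda>i. if i < k then x i else 0"] assms(2)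
      polys_in_eval_cong[of p k "\<lambda>i. if i < k then x i else 0" x]
    by (simp add: q')
  then show ?thesis
    using q'(1) by (intro sosI)
qed

text \<open>If d is the largest degree of the \<open>f j\<close>, the coefficient of the sum at 2 d
  is a sum of squares of real numbers, not all 0, so leading terms cannot cancel. The odd bound 2 k
  + 1 makes degree 3 force linear summands.\<close>

lemma degree_le_of_sum_squares:
  fixes f :: "'a \<Rightarrow> real poly"
  assumes "finite J" "degree (\<Sum>j\<in>J. f j ^ 2) \<le> 2 * k + 1" "j \<in> J"
  shows "degree (f j) \<le> k"
proof (rule ccontr)
  assume "\<not> degree (f j) \<le> k"
  define d where "d = Max ((\<lambda>j. degree (f j)) ` J)"
  have le: "degree (f i) \<le> d" if "i \<in> J" for i
    using assms(1) that by (simp add: d_def)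
  have "k < d"
    using le[OF assms(3)] \<open>\<not> degree (f j) \<le> k\<close> by simp
  have sq: "coeff (f i ^ 2) (2 * d) = coeff (f i) d ^ 2" if "i \<in> J" for i
    using coeff_mult_degree_sum[of "f i" "f i"] le[OF that]
    by (cases "degree (f i) = d")
      (auto simp: power2_eq_square mult_2 coeff_eq_0 intro!: coeff_eq_0 le_less_trans[OF degree_mult_le])
  have "d \<in> (\<lambda>j. degree (f j)) ` J"
    unfolding d_def using assms(1,3) by (intro Max_in) auto
  then obtain i where i: "i \<in> J" "degree (f i) = d"
    by blast
  then have "coeff (f i) d \<noteq> 0"
    using \<open>k < d\<close> by auto
  then have "0 < (\<Sum>i\<in>J. coeff (f i) d ^ 2)"
    using assms(1) i(1) by (intro sum_pos2[of _ i]) auto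
  also have "\<dots> = coeff (\<Sum>j\<in>J. f j ^ 2) (2 * d)"
    by (simp add: coeff_sum sq)
  also have "\<dots> = 0"
    using assms(2) \<open>k < d\<close> by (intro coeff_eq_0) auto
  finally show False by simp
qed

text \<open>The univariate lemma is applied along the curve of \<open>scale_poly\<close>. The base
  point x is chosen off the zeros of \<open>h\<close>, the part of \<open>q j\<close> having the
  weight of m, so that this weight is really visible as a degree in t.\<close>

lemma wt_le_of_sum_squares:
  fixes n :: nat and q :: "nat \<Rightarrow> rmpoly"
  assumes p: "p = (\<Sum>j<n. q j ^ 2)" "\<forall>m \<in> Poly_Mapping.keys p. wt w m \<le> 2 * k"
    and j: "j < n" and m: "m \<in> Poly_Mapping.keys (q j)"
  shows "wt w m \<le> k"
proof (rule ccontr)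
  assume *: "\<not> wt w m \<le> k"
  define h where "h = (\<Sum>a \<in> {a \<in> Poly_Mapping.keys (q j). wt w a = wt w m}.
      Poly_Mapping.single a (Poly_Mapping.lookup (q j) a))"
  have "Poly_Mapping.lookup h m \<noteq> 0"
    using m by (simp add: h_def lookup_sum lookup_single when_def in_keys_iff)
  then obtain x where "eval_mpoly h x \<noteq> 0"
    using eval_mpoly_eq_0_imp[of h] by force
  then have "coeff (scale_poly w (q j) x) (wt w m) \<noteq> 0"
    by (simp add: h_def coeff_scale_poly)
  then have "wt w m \<le> degree (scale_poly w (q j) x)"
    by (rule le_degree)
  moreover have "degree (scale_poly w (q j) x) \<le> k"
  proof (rule degree_le_of_sum_squares[where J = "{..<n}"])
    have "poly (scale_poly w p x) = poly (\<Sum>j<n. scale_poly w (q j) x ^ 2)"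
      by (simp add: fun_eq_iff poly_scale_poly poly_sum p(1))
    then have "(\<Sum>j<n. scale_poly w (q j) x ^ 2) = scale_poly w p x"
      by (simp add: poly_eq_poly_eq_iff)
    moreover have "degree (scale_poly w p x) \<le> 2 * k"
      unfolding scale_poly_def using p(2)
      by (intro degree_sum_le) (auto intro: order.trans[OF degree_monom_le])
    ultimately show "degree (\<Sum>j<n. scale_poly w (q j) x ^ 2) \<le> 2 * k + 1"
      by simp
  qed (use j in auto)
  ultimately show False using * by simp
qed

section \<open>Ternary quartic forms\<close>

text \<open>The coefficient vector places quartic forms in a Euclidean space, as compactness and
  Krein-Milman require. The arguments about a single form treat it as a function of x, y, z.\<close>

type_synonym real15 = "real \<times> real \<times> real \<times> real \<times> real \<times> real \<times> real \<times> real \<times>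
  real \<times> real \<times> real \<times> real \<times> real \<times> real \<times> real"

definition quartic_form :: "real15 \<Rightarrow> real \<Rightarrow> real \<Rightarrow> real \<Rightarrow> real" where
  "quartic_form = (\<lambda>(a1, a2, a3, a4, a5, a6, a7, a8, a9, a10, a11, a12, a13, a14, a15) x y z.
     a1 * x^4 + a2 * x^3 * y + a3 * x^3 * z + a4 * x^2 * y^2 + a5 * x^2 * y * z + a6 * x^2 * z^2
     + a7 * x * y^3 + a8 * x * y^2 * z + a9 * x * y * z^2 + a10 * x * z^3
     + a11 * y^4 + a12 * y^3 * z + a13 * y^2 * z^2 + a14 * y * z^3 + a15 * z^4)"

definition is_quartic :: "(real \<Rightarrow> real \<Rightarrow> real \<Rightarrow> real) \<Rightarrow> bool" where
  "is_quartic F \<longleftrightarrow> (\<exists>c. F = quartic_form c)"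

definition is_quad :: "(real \<Rightarrow> real \<Rightarrow> real \<Rightarrow> real) \<Rightarrow> bool" where
  "is_quad q \<longleftrightarrow> (\<exists>a b c d e f. q = (\<lambda>x y z. a * x^2 + b * y^2 + c * z^2 + d * x * y + e * x * z + f * y * z))"

lemma is_quadI:
  assumes "\<And>x y z. q x y z = a * x^2 + b * y^2 + c * z^2 + d * x * y + e * x * z + f * y * z"
  shows "is_quad q"
  unfolding is_quad_def
  by (rule exI[of _ a], rule exI[of _ b], rule exI[of _ c], rule exI[of _ d], rule exI[of _ e], rule exI[of _ f])
    (simp add: fun_eq_iff assms)

lemma is_quadE:
  assumes "is_quad q"
  obtains a b c d e f where
    "\<And>x y z. q x y z = a * x^2 + b * y^2 + c * z^2 + d * x * y + e * x * z + f * y * z"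
proof -
  obtain a b c d e f where "q = (\<lambda>x y z. a * x^2 + b * y^2 + c * z^2 + d * x * y + e * x * z + f * y * z)"
    using assms unfolding is_quad_def by (elim exE)
  then show ?thesis using that by simp
qed

lemma is_quarticI:
  assumes "\<And>x y z. F x y z = a1 * x^4 + a2 * x^3 * y + a3 * x^3 * z + a4 * x^2 * y^2 + a5 * x^2 * y * z + a6 * x^2 * z^2
     + a7 * x * y^3 + a8 * x * y^2 * z + a9 * x * y * z^2 + a10 * x * z^3
     + a11 * y^4 + a12 * y^3 * z + a13 * y^2 * z^2 + a14 * y * z^3 + a15 * z^4"
  shows "is_quartic F"
  unfolding is_quartic_def
  by (intro exI[of _ "(a1, a2, a3, a4, a5, a6, a7, a8, a9, a10, a11, a12, a13, a14, a15)"])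
    (simp add: fun_eq_iff quartic_form_def assms)

lemma is_quarticE:
  assumes "is_quartic F"
  obtains a1 a2 a3 a4 a5 a6 a7 a8 a9 a10 a11 a12 a13 a14 a15 where
    "\<And>x y z. F x y z = a1 * x^4 + a2 * x^3 * y + a3 * x^3 * z + a4 * x^2 * y^2 + a5 * x^2 * y * z + a6 * x^2 * z^2
     + a7 * x * y^3 + a8 * x * y^2 * z + a9 * x * y * z^2 + a10 * x * z^3
     + a11 * y^4 + a12 * y^3 * z + a13 * y^2 * z^2 + a14 * y * z^3 + a15 * z^4"
proof -
  obtain c where "F = quartic_form c"
    using assms unfolding is_quartic_def by (elim exE)
  then show ?thesis
    using that by (simp add: quartic_form_def case_prod_unfold)
qed

lemma is_quad_mult:
  assumes "is_quad p" "is_quad q"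
  shows "is_quartic (\<lambda>x y z. p x y z * q x y z)"
proof -
  obtain a b c d e f where p: "\<And>x y z. p x y z = a * x^2 + b * y^2 + c * z^2 + d * x * y + e * x * z + f * y * z"
    using assms(1) by (rule is_quadE) blast
  obtain a' b' c' d' e' f' where q: "\<And>x y z. q x y z = a' * x^2 + b' * y^2 + c' * z^2 + d' * x * y + e' * x * z + f' * y * z"
    using assms(2) by (rule is_quadE) blast
  show ?thesis
    by (rule is_quarticI[of _ "a*a'" "a*d'+d*a'" "a*e'+e*a'" "a*b'+b*a'+d*d'" "a*f'+f*a'+d*e'+e*d'" "a*c'+c*a'+e*e'"
        "b*d'+d*b'" "b*e'+e*b'+d*f'+f*d'" "c*d'+d*c'+e*f'+f*e'" "c*e'+e*c'" "b*b'" "b*f'+f*b'" "b*c'+c*b'+f*f'"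
        "c*f'+f*c'" "c*c'"])
      (unfold p q, algebra)
qed

lemma is_quartic_add:
  assumes "is_quartic F" "is_quartic G"
  shows "is_quartic (\<lambda>x y z. F x y z + G x y z)"
proof -
  obtain c d where "F = quartic_form c" "G = quartic_form d"
    using assms unfolding is_quartic_def by (elim exE)
  then have "(\<lambda>x y z. F x y z + G x y z) = quartic_form (c + d)"
    by (auto simp: fun_eq_iff quartic_form_def case_prod_unfold algebra_simps)
  then show ?thesis
    unfolding is_quartic_def by (rule exI)
qed

lemma is_quad_subst:
  assumes "is_quad q"
  shows "is_quad (\<lambda>x y z. q (l1 * x + l2 * y + l3 * z) (m1 * x + m2 * y + m3 * z) (n1 * x + n2 * y + n3 * z))"
proof -
  obtain a b c d e f where q: "\<And>x y z. q x y z = a * x^2 + b * y^2 + c * z^2 + d * x * y + e * x * z + f * y * z"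
    using assms by (rule is_quadE) blast
  show ?thesis
    by (rule is_quadI[of _ "a*l1^2+b*m1^2+c*n1^2+d*l1*m1+e*l1*n1+f*m1*n1" "a*l2^2+b*m2^2+c*n2^2+d*l2*m2+e*l2*n2+f*m2*n2"
         "a*l3^2+b*m3^2+c*n3^2+d*l3*m3+e*l3*n3+f*m3*n3"
         "2*a*l1*l2+2*b*m1*m2+2*c*n1*n2+d*(l1*m2+l2*m1)+e*(l1*n2+l2*n1)+f*(m1*n2+m2*n1)"
         "2*a*l1*l3+2*b*m1*m3+2*c*n1*n3+d*(l1*m3+l3*m1)+e*(l1*n3+l3*n1)+f*(m1*n3+m3*n1)"
         "2*a*l2*l3+2*b*m2*m3+2*c*n2*n3+d*(l2*m3+l3*m2)+e*(l2*n3+l3*n2)+f*(m2*n3+m3*n2)"])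
      (unfold q, algebra)
qed

text \<open>A monomial of degree 4 in three variables is divisible by the square of a variable, so F
  = x^2 q1 + y^2 q2 + z^2 q3 with quadratic forms q1, q2, q3. Substitution then only concerns
  quadratic forms, and no expansion of fifteen coefficients is needed.\<close>

lemma is_quartic_subst:
  assumes "is_quartic F"
  shows "is_quartic (\<lambda>x y z. F (l1 * x + l2 * y + l3 * z) (m1 * x + m2 * y + m3 * z) (n1 * x + n2 * y + n3 * z))"
proof -
  obtain a1 a2 a3 a4 a5 a6 a7 a8 a9 a10 a11 a12 a13 a14 a15 where F:
    "\<And>x y z. F x y z = a1 * x^4 + a2 * x^3 * y + a3 * x^3 * z + a4 * x^2 * y^2 + a5 * x^2 * y * z + a6 * x^2 * z^2
     + a7 * x * y^3 + a8 * x * y^2 * z + a9 * x * y * z^2 + a10 * x * z^3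
     + a11 * y^4 + a12 * y^3 * z + a13 * y^2 * z^2 + a14 * y * z^3 + a15 * z^4"
    using assms by (rule is_quarticE) blast
  let ?X = "\<lambda>x y z :: real. x^2" and ?Y = "\<lambda>x y z :: real. y^2" and ?Z = "\<lambda>x y z :: real. z^2"
  define q1 where "q1 x y z = a1 * x^2 + a4 * y^2 + a6 * z^2 + a2 * x * y + a3 * x * z + a5 * y * z" for x y z
  define q2 where "q2 x y z = 0 * x^2 + a11 * y^2 + a13 * z^2 + a7 * x * y + a8 * x * z + a12 * y * z" for x y z
  define q3 where "q3 x y z = 0 * x^2 + 0 * y^2 + a15 * z^2 + a9 * x * y + a10 * x * z + a14 * y * z" for x y z
  have q: "is_quad q1" "is_quad q2" "is_quad q3"
    by (rule is_quadI, simp only: q1_def q2_def q3_def)+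
  have sq: "is_quad ?X" "is_quad ?Y" "is_quad ?Z"
    by (rule is_quadI[of _ 1 0 0 0 0 0], simp, rule is_quadI[of _ 0 1 0 0 0 0], simp,
        rule is_quadI[of _ 0 0 1 0 0 0], simp)
  have "F x y z = (?X x y z * q1 x y z + ?Y x y z * q2 x y z) + ?Z x y z * q3 x y z" for x y z
    unfolding F q1_def q2_def q3_def by algebra
  then have "F = (\<lambda>x y z. (?X x y z * q1 x y z + ?Y x y z * q2 x y z) + ?Z x y z * q3 x y z)"
    by (simp add: fun_eq_iff)
  then show ?thesis
    by (simp only:) (intro is_quartic_add is_quad_mult is_quad_subst q
        is_quad_subst[OF sq(1)] is_quad_subst[OF sq(2)] is_quad_subst[OF sq(3)])
qed

section \<open>Psd ternary quartics dominate the square of a quadratic form\<close>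

definition dominates_square :: "(real \<Rightarrow> real \<Rightarrow> real \<Rightarrow> real) \<Rightarrow> bool" where
  "dominates_square F \<longleftrightarrow> (\<exists>q. is_quad q \<and> (\<exists>x y z. q x y z \<noteq> 0) \<and> (\<forall>x y z. q x y z ^ 2 \<le> F x y z))"

lemma dominates_squareI:
  assumes "\<And>x y z. (a * x^2 + b * y^2 + c * z^2 + d * x * y + e * x * z + f * y * z) ^ 2 \<le> F x y z"
    and "a \<noteq> 0 \<or> b \<noteq> 0 \<or> c \<noteq> 0 \<or> d \<noteq> 0 \<or> e \<noteq> 0 \<or> f \<noteq> 0"
  shows "dominates_square F"
proof -
  define q where "q x y z = a * x^2 + b * y^2 + c * z^2 + d * x * y + e * x * z + f * y * z" for x y z
  have "\<exists>x y z. q x y z \<noteq> 0"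
  proof (rule ccontr)
    assume "\<not> ?thesis"
    then have *: "q x y z = 0" for x y z by blast
    show False
      using assms(2) *[of 1 0 0] *[of 0 1 0] *[of 0 0 1] *[of 1 1 0] *[of 1 0 1] *[of 0 1 1]
      by (simp add: q_def)
  qed
  moreover have "is_quad q"
    by (rule is_quadI) (simp only: q_def)
  ultimately show ?thesis
    unfolding dominates_square_def using assms(1) q_def by (intro exI[of _ q]) auto
qed

text \<open>Used to move zeros of F to coordinate points. The inverse matrix enters through
  identities in x, y, z: \<open>inv\<close> carries the inequality back to F, and
  \<open>inv'\<close> ensures that the transported quadratic form is still nonzero.\<close>

lemma dominates_square_subst:
  assumes "dominates_square (\<lambda>x y z. F (l1 * x + l2 * y + l3 * z) (m1 * x + m2 * y + m3 * z) (n1 * x + n2 * y + n3 * z))"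
    and inv: "\<And>x y z. l1 * (l1' * x + l2' * y + l3' * z) + l2 * (m1' * x + m2' * y + m3' * z) + l3 * (n1' * x + n2' * y + n3' * z) = x"
      "\<And>x y z. m1 * (l1' * x + l2' * y + l3' * z) + m2 * (m1' * x + m2' * y + m3' * z) + m3 * (n1' * x + n2' * y + n3' * z) = y"
      "\<And>x y z. n1 * (l1' * x + l2' * y + l3' * z) + n2 * (m1' * x + m2' * y + m3' * z) + n3 * (n1' * x + n2' * y + n3' * z) = z"
    and inv': "\<And>x y z. l1' * (l1 * x + l2 * y + l3 * z) + l2' * (m1 * x + m2 * y + m3 * z) + l3' * (n1 * x + n2 * y + n3 * z) = x"
      "\<And>x y z. m1' * (l1 * x + l2 * y + l3 * z) + m2' * (m1 * x + m2 * y + m3 * z) + m3' * (n1 * x + n2 * y + n3 * z) = y"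
      "\<And>x y z. n1' * (l1 * x + l2 * y + l3 * z) + n2' * (m1 * x + m2 * y + m3 * z) + n3' * (n1 * x + n2 * y + n3 * z) = z"
  shows "dominates_square F"
proof -
  obtain q where q: "is_quad q" "\<exists>x y z. q x y z \<noteq> 0"
    "\<And>x y z. q x y z ^ 2 \<le> F (l1 * x + l2 * y + l3 * z) (m1 * x + m2 * y + m3 * z) (n1 * x + n2 * y + n3 * z)"
    using assms(1) unfolding dominates_square_def by blast
  define q' where "q' x y z = q (l1' * x + l2' * y + l3' * z) (m1' * x + m2' * y + m3' * z) (n1' * x + n2' * y + n3' * z)"
    for x y z
  have "is_quad q'"
    unfolding q'_def by (rule is_quad_subst[OF q(1)])
  moreover have "\<exists>x y z. q' x y z \<noteq> 0"
  proof -
    obtain x y z where "q x y z \<noteq> 0" using q(2) by blast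
    then have "q' (l1 * x + l2 * y + l3 * z) (m1 * x + m2 * y + m3 * z) (n1 * x + n2 * y + n3 * z) \<noteq> 0"
      unfolding q'_def inv' .
    then show ?thesis by blast
  qed
  moreover have "q' x y z ^ 2 \<le> F x y z" for x y z
    using q(3)[of "l1' * x + l2' * y + l3' * z" "m1' * x + m2' * y + m3' * z" "n1' * x + n2' * y + n3' * z"]
    unfolding inv q'_def .
  ultimately show ?thesis
    unfolding dominates_square_def by blast
qed

text \<open>The constant is the minimum of D over the unit sphere, which compactness makes positive;
  homogeneity extends the bound to all vectors.\<close>

lemma homogeneous_lower_bound:
  fixes D :: "'a::euclidean_space \<Rightarrow> real"
  assumes "continuous_on UNIV D" and hom: "\<And>t v. D (t *\<^sub>R v) = t ^ (2 * k) * D v"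
    and pos: "\<And>v. v \<noteq> 0 \<Longrightarrow> D v > 0" and k: "k > 0"
  obtains \<mu> where "\<mu> > 0" "\<And>v. \<mu> * (norm v ^ 2) ^ k \<le> D v"
proof -
  have "compact (sphere (0::'a) 1)" "sphere (0::'a) 1 \<noteq> {}"
    by auto
  then obtain u where u: "u \<in> sphere 0 1" "\<And>v. v \<in> sphere 0 1 \<Longrightarrow> D u \<le> D v"
    using continuous_attains_inf[of "sphere (0::'a) 1" D] continuous_on_subset[OF assms(1) subset_UNIV]
    by metis
  have "D u * (norm v ^ 2) ^ k \<le> D v" for v
  proof (cases "v = 0")
    case True
    then show ?thesis using hom[of 0 0] k by (simp add: power_0_left)
  next
    case False
    have "D v = D (norm v *\<^sub>R (v /\<^sub>R norm v))"
      using False by simp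
    also have "\<dots> = (norm v ^ 2) ^ k * D (v /\<^sub>R norm v)"
      unfolding hom by (simp add: power_mult)
    finally have "D v = (norm v ^ 2) ^ k * D (v /\<^sub>R norm v)" .
    moreover have "D u \<le> D (v /\<^sub>R norm v)"
      using False by (intro u(2)) simp
    then have "(norm v ^ 2) ^ k * D u \<le> (norm v ^ 2) ^ k * D (v /\<^sub>R norm v)"
      by (rule mult_left_mono) simp
    ultimately show ?thesis
      by (simp add: mult.commute)
  qed
  moreover have "D u > 0"
    using u(1) by (intro pos) auto
  ultimately show ?thesis using that by blast
qed

lemma homogeneous_lower_bound2:
  fixes D :: "real \<Rightarrow> real \<Rightarrow> real"
  assumes "continuous_on UNIV (\<lambda>v. D (fst v) (snd v))" "\<And>t y z. D (t * y) (t * z) = t ^ (2 * k) * D y z"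
    and "\<And>y z. y \<noteq> 0 \<or> z \<noteq> 0 \<Longrightarrow> D y z > 0" "k > 0"
  obtains \<mu> where "\<mu> > 0" "\<And>y z. \<mu> * (y^2 + z^2) ^ k \<le> D y z"
proof -
  obtain \<mu> where \<mu>: "\<mu> > 0" "\<And>v. \<mu> * (norm v ^ 2) ^ k \<le> D (fst v) (snd v)"
    using homogeneous_lower_bound[of "\<lambda>v. D (fst v) (snd v)" k] assms
    by (auto simp: prod_eq_iff)
  have "\<mu> * (y^2 + z^2) ^ k \<le> D y z" for y z
    using \<mu>(2)[of "(y, z)"] by (simp add: norm_Pair)
  with \<mu>(1) show ?thesis using that by blast
qed

lemma nonneg_quadratic_discrim:
  fixes a b c :: real
  assumes "\<And>x. a * x^2 + b * x + c \<ge> 0"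
  shows "a \<ge> 0" "c \<ge> 0" "b^2 \<le> 4 * a * c"
proof -
  show c: "c \<ge> 0"
    using assms[of 0] by simp
  show a: "a \<ge> 0"
  proof (rule ccontr)
    assume n: "\<not> a \<ge> 0"
    \<comment> \<open>Chosen such that a x = a - |b| - c. As x >= 1, the terms b x and c are at most
      |b| x and c x, which leaves a value of at most a x < 0.\<close>
    define x where "x = 1 + (\<bar>b\<bar> + c) / (- a)"
    have x1: "x \<ge> 1"
    proof -
      have "(\<bar>b\<bar> + c) / (- a) \<ge> 0"
        using n c by (intro divide_nonneg_nonneg) auto
      then show ?thesis unfolding x_def by linarith
    qed
    have "a * x = a - \<bar>b\<bar> - c"
      using n by (simp add: x_def field_simps)
    then have "a * x^2 = (a - \<bar>b\<bar> - c) * x"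
      by (metis power2_eq_square mult.assoc)
    moreover have "b * x \<le> \<bar>b\<bar> * x" "c \<le> c * x" "a * x < 0"
      using x1 c n by (auto intro: mult_right_mono simp: mult_le_cancel_left1 mult_neg_pos)
    ultimately have "a * x^2 + b * x + c < 0"
      by (simp add: algebra_simps)
    with assms[of x] show False by simp
  qed
  show "b^2 \<le> 4 * a * c"
  proof (cases "a = 0")
    case True
    have "b = 0"
    proof (rule ccontr)
      assume "b \<noteq> 0"
      then show False using assms[of "- (c + 1) / b"] True by simp
    qed
    then show ?thesis using True by simp
  next
    case False
    with a have "a > 0" by simp
    have "a * (- b / (2*a))^2 + b * (- b / (2*a)) + c = (4 * a * c - b^2) / (4 * a)"
      using \<open>a > 0\<close> by (simp add: field_simps power2_eq_square)
    with assms[of "- b / (2*a)"] \<open>a > 0\<close> show ?thesis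
      by (simp add: zero_le_divide_iff)
  qed
qed

lemma nonneg_binary_quadratic_dominates:
  fixes a b c :: real
  assumes nonneg: "\<And>y z. a * y^2 + b * y * z + c * z^2 \<ge> 0" and "a \<noteq> 0 \<or> b \<noteq> 0 \<or> c \<noteq> 0"
  obtains l m where "l \<noteq> 0 \<or> m \<noteq> 0" "\<And>y z. (l * y + m * z)^2 \<le> a * y^2 + b * y * z + c * z^2"
proof -
  have d: "a \<ge> 0" "c \<ge> 0" "b^2 \<le> 4 * a * c"
    using nonneg_quadratic_discrim[of a b c] nonneg[of _ 1] by auto
  show ?thesis
  proof (cases "a = 0")
    case True
    with d have "b = 0" by simp
    with True assms(2) d have "c > 0" by simp
    then show ?thesis
      using that[of 0 "sqrt c"] True \<open>b = 0\<close> by (simp add: power_mult_distrib)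
  next
    case False
    with d have "a > 0" by simp
    have "(sqrt a * y + b / (2 * sqrt a) * z)^2 \<le> a * y^2 + b * y * z + c * z^2" for y z
    proof -
      have "(sqrt a * y + b / (2 * sqrt a) * z)^2 = a * y^2 + b * y * z + b^2 / (4 * a) * z^2"
        using \<open>a > 0\<close> by (simp add: power2_sum power_mult_distrib power_divide)
      moreover have "b^2 / (4 * a) * z^2 \<le> c * z^2"
      proof (rule mult_right_mono)
        show "b^2 / (4 * a) \<le> c"
          using d \<open>a > 0\<close> by (simp add: divide_le_eq mult_ac)
      qed simp
      ultimately show ?thesis
        by linarith
    qed
    then show ?thesis
      using that[of "sqrt a" "b / (2 * sqrt a)"] \<open>a > 0\<close> by simp
  qed
qed

text \<open>Serves to cancel a nonnegative factor from an inequality: off the zeros of the factor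
  one divides, and at the zeros continuity takes over.\<close>

lemma nonneg_at_0_of_nonneg_off_0:
  fixes \<phi> :: "real \<Rightarrow> real"
  assumes "isCont \<phi> 0" "\<And>t. t \<noteq> 0 \<Longrightarrow> \<phi> t \<ge> 0"
  shows "\<phi> 0 \<ge> 0"
proof (rule tendsto_lowerbound)
  show "\<phi> \<midarrow>0\<rightarrow> \<phi> 0"
    using assms(1) by (simp add: isCont_def)
  show "\<forall>\<^sub>F t in at 0. 0 \<le> \<phi> t"
    using assms(2) by (auto simp: eventually_at_filter)
qed simp

text \<open>A zero of a nonnegative function is a minimum, so the derivative vanishes there. The
  arguments |t| and -|t| express the two one-sided limits as continuity at 0.\<close>

lemma nonneg_quartic_zero_at_0:
  fixes b c d e :: real
  assumes "\<And>t. e + d * t + c * t^2 + b * t^3 + a * t^4 \<ge> 0" "e = 0"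
  shows "d = 0"
proof -
  define \<phi> where "\<phi> t = d + c * t + b * t^2 + a * t^3" for t
  have *: "t * \<phi> t \<ge> 0" for t
    using assms(1)[of t] assms(2) by (simp add: \<phi>_def algebra_simps power2_eq_square power3_eq_cube power4_eq_xxxx)
  have cont: "isCont (\<lambda>t. \<phi> \<bar>t\<bar>) 0" "isCont (\<lambda>t. - \<phi> (- \<bar>t\<bar>)) 0"
    unfolding \<phi>_def by (intro continuous_intros)+
  have "\<phi> \<bar>0\<bar> \<ge> 0"
  proof (rule nonneg_at_0_of_nonneg_off_0[OF cont(1)])
    fix t :: real assume "t \<noteq> 0"
    then show "\<phi> \<bar>t\<bar> \<ge> 0" using *[of "\<bar>t\<bar>"] by (simp add: zero_le_mult_iff)
  qed
  moreover have "- \<phi> (- \<bar>0\<bar>) \<ge> 0"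
  proof (rule nonneg_at_0_of_nonneg_off_0[OF cont(2)])
    fix t :: real assume "t \<noteq> 0"
    then show "- \<phi> (- \<bar>t\<bar>) \<ge> 0" using *[of "- \<bar>t\<bar>"] by (simp add: mult_le_0_iff)
  qed
  ultimately show ?thesis by (simp add: \<phi>_def)
qed

text \<open>The zero is a minimum along the directions (0, 1, 0) and (0, 0, 1), so the x^3 terms
  vanish with the x^4 term. F then has degree at most 2 in x, and discriminants in x become
  available.\<close>

lemma psd_quartic_zero_e1:
  fixes F :: "real \<Rightarrow> real \<Rightarrow> real \<Rightarrow> real"
  assumes nonneg: "\<And>x y z. F x y z \<ge> 0"
    and F: "\<And>x y z. F x y z = a1 * x^4 + a2 * x^3 * y + a3 * x^3 * z + a4 * x^2 * y^2 + a5 * x^2 * y * z + a6 * x^2 * z^2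
     + a7 * x * y^3 + a8 * x * y^2 * z + a9 * x * y * z^2 + a10 * x * z^3
     + a11 * y^4 + a12 * y^3 * z + a13 * y^2 * z^2 + a14 * y * z^3 + a15 * z^4"
    and 0: "F 1 0 0 = 0"
  shows "a1 = 0" "a2 = 0" "a3 = 0"
proof -
  show a1: "a1 = 0" using 0 by (simp add: F)
  show "a2 = 0"
    by (rule nonneg_quartic_zero_at_0[of a1 a2 a4 a7 a11]) (use nonneg[of 1 _ 0] a1 in \<open>simp_all add: F\<close>)
  show "a3 = 0"
    by (rule nonneg_quartic_zero_at_0[of a1 a3 a6 a10 a15]) (use nonneg[of 1 0 _] a1 in \<open>simp_all add: F\<close>)
qed

text \<open>The zero at y = 1, z = 0 is double, so z^2 splits off. The remaining quadratic form is
  nonnegative and dominates the square of a linear form, which is then multiplied by z.\<close>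

lemma psd_binary_quartic_dominates:
  fixes F :: "real \<Rightarrow> real \<Rightarrow> real \<Rightarrow> real"
  assumes nonneg: "\<And>x y z. F x y z \<ge> 0"
    and F: "\<And>x y z. F x y z = a * y^4 + b * y^3 * z + c * y^2 * z^2 + d * y * z^3 + e * z^4"
    and zero: "F 0 1 0 = 0" and nz: "\<exists>x y z. F x y z \<noteq> 0"
  shows "dominates_square F"
proof -
  have a: "a = 0" using zero by (simp add: F)
  have b: "b = 0"
    by (rule nonneg_quartic_zero_at_0[of a b c d e]) (use nonneg[of 0 1 _] a in \<open>simp_all add: F\<close>)
  have F': "F x y z = z^2 * (c * y^2 + d * y * z + e * z^2)" for x y z
    unfolding F a b by algebra
  have c: "c * t^2 + d * t + e \<ge> 0" for t
    using nonneg[of 0 t 1] by (simp add: F')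
  have k: "c * y^2 + d * y * z + e * z^2 \<ge> 0" for y z
  proof (cases "z = 0")
    case True
    then show ?thesis using nonneg_quadratic_discrim(1)[OF c] by simp
  next
    case False
    then show ?thesis using nonneg[of 0 y z] by (simp add: F' zero_le_mult_iff)
  qed
  have "c \<noteq> 0 \<or> d \<noteq> 0 \<or> e \<noteq> 0"
    using nz by (auto simp: F')
  from nonneg_binary_quadratic_dominates[OF k this]
  obtain l m where lm: "l \<noteq> 0 \<or> m \<noteq> 0" "\<And>y z. (l * y + m * z)^2 \<le> c * y^2 + d * y * z + e * z^2"
    by metis
  show ?thesis
  proof (rule dominates_squareI[of 0 0 m 0 0 l])
    fix x y z
    have "(0 * x^2 + 0 * y^2 + m * z^2 + 0 * x * y + 0 * x * z + l * y * z)^2 = z^2 * (l * y + m * z)^2"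
      by algebra
    also have "\<dots> \<le> F x y z"
      unfolding F' using lm(2) by (intro mult_left_mono) auto
    finally show "(0 * x^2 + 0 * y^2 + m * z^2 + 0 * x * y + 0 * x * z + l * y * z)^2 \<le> F x y z" .
  qed (use lm(1) in auto)
qed

text \<open>Without a nontrivial zero F dominates a positive multiple of (y^2 + z^2)^2; otherwise a
  zero is moved to y = 1, z = 0.\<close>

lemma psd_quartic_binary_dominates:
  fixes F :: "real \<Rightarrow> real \<Rightarrow> real \<Rightarrow> real"
  assumes nonneg: "\<And>x y z. F x y z \<ge> 0"
    and F: "\<And>x y z. F x y z = a * y^4 + b * y^3 * z + c * y^2 * z^2 + d * y * z^3 + e * z^4"
    and nz: "\<exists>x y z. F x y z \<noteq> 0"
  shows "dominates_square F"
proof (cases "\<exists>y0 z0. (y0 \<noteq> 0 \<or> z0 \<noteq> 0) \<and> F 0 y0 z0 = 0")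
  case False
  have cont: "continuous_on UNIV (\<lambda>v. F 0 (fst v) (snd v))"
    unfolding F by (intro continuous_intros)
  have hom: "F 0 (t * y) (t * z) = t ^ (2 * 2) * F 0 y z" for t y z
    unfolding F by (simp, algebra)
  have pos: "F 0 y z > 0" if "y \<noteq> 0 \<or> z \<noteq> 0" for y z
    using False nonneg[of 0 y z] that by (auto simp: less_le)
  obtain \<mu> where \<mu>: "\<mu> > 0" "\<And>y z. \<mu> * (y^2 + z^2) ^ 2 \<le> F 0 y z"
    by (rule homogeneous_lower_bound2[of "F 0" 2, OF cont hom pos]) simp_all
  show ?thesis
  proof (rule dominates_squareI[of 0 "sqrt \<mu>" "sqrt \<mu>" 0 0 0])
    fix x y z
    have "(0 * x^2 + sqrt \<mu> * y^2 + sqrt \<mu> * z^2 + 0 * x * y + 0 * x * z + 0 * y * z)^2 = (sqrt \<mu>)^2 * (y^2 + z^2)^2"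
      by algebra
    also have "\<dots> \<le> F x y z"
      using \<mu>(1) \<mu>(2)[of y z] by (simp add: F)
    finally show "(0 * x^2 + sqrt \<mu> * y^2 + sqrt \<mu> * z^2 + 0 * x * y + 0 * x * z + 0 * y * z)^2 \<le> F x y z" .
  qed (use \<mu> in auto)
next
  case True
  then obtain y0 z0 where 0: "y0 \<noteq> 0 \<or> z0 \<noteq> 0" "F 0 y0 z0 = 0" by blast
  obtain x1 y1 z1 where nz': "F x1 y1 z1 \<noteq> 0" using nz by blast
  show ?thesis
  proof (cases "y0 = 0")
    case True
    with 0 have "e = 0" by (simp add: F)
    have sub: "F (1 * x + 0 * y + 0 * z) (0 * x + 0 * y + 1 * z) (0 * x + 1 * y + 0 * z) = F x z y" for x y z
      by simp
    have "dominates_square (\<lambda>x y z. F (1 * x + 0 * y + 0 * z) (0 * x + 0 * y + 1 * z) (0 * x + 1 * y + 0 * z))"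
      unfolding sub
    proof (rule psd_binary_quartic_dominates[where a = e and b = d and c = c and d = b and e = a])
      show "\<exists>x y z. F x z y \<noteq> 0" using nz' by blast
    qed (use nonneg \<open>e = 0\<close> in \<open>simp_all add: F\<close>)
    then show ?thesis
      by (rule dominates_square_subst[where l1' = 1 and l2' = 0 and l3' = 0 and m1' = 0 and m2' = 0 and m3' = 1
          and n1' = 0 and n2' = 1 and n3' = 0]) auto
  next
    case False
    define k where "k = z0 / y0"
    have k: "F 0 1 k = 0"
    proof -
      have "y0^4 * F 0 1 k = F 0 y0 z0"
        using False by (simp add: F k_def field_simps power4_eq_xxxx power3_eq_cube power2_eq_square)
      then show ?thesis using 0 False by simp
    qed
    have sub: "F (1 * x + 0 * y + 0 * z) (0 * x + 1 * y + 0 * z) (0 * x + k * y + 1 * z) = F x y (k * y + z)" for x y z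
      by simp
    have "dominates_square (\<lambda>x y z. F (1 * x + 0 * y + 0 * z) (0 * x + 1 * y + 0 * z) (0 * x + k * y + 1 * z))"
      unfolding sub
    \<comment> \<open>These are the Taylor coefficients at k of the polynomial a + b t + c t^2 + d
      t^3 + e t^4.\<close>
    proof (rule psd_binary_quartic_dominates[where a = "a + b * k + c * k^2 + d * k^3 + e * k^4"
          and b = "b + 2 * c * k + 3 * d * k^2 + 4 * e * k^3" and c = "c + 3 * d * k + 6 * e * k^2"
          and d = "d + 4 * e * k" and e = e])
      show "F x y (k * y + z) = (a + b * k + c * k^2 + d * k^3 + e * k^4) * y ^ 4
         + (b + 2 * c * k + 3 * d * k^2 + 4 * e * k^3) * y ^ 3 * z + (c + 3 * d * k + 6 * e * k^2) * y^2 * z^2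
         + (d + 4 * e * k) * y * z ^ 3 + e * z ^ 4" for x y z
        unfolding F by algebra
      have "F x1 y1 (k * y1 + (z1 - k * y1)) \<noteq> 0" using nz' by simp
      then show "\<exists>x y z. F x y (k * y + z) \<noteq> 0" by blast
    qed (use nonneg k in auto)
    then show ?thesis
      by (rule dominates_square_subst[where l1' = 1 and l2' = 0 and l3' = 0 and m1' = 0 and m2' = 1 and m3' = 0
          and n1' = 0 and n2' = "-k" and n3' = 1]) auto
  qed
qed

text \<open>\<open>deg\<close> at x = 1 and x = -1 removes the monomials x^2 z^2 and x z^3, and
  nonnegativity of the x^2 coefficient then removes x^2 y z. So F = a4 (x y)^2 + (x y) g + h is
  quadratic in the product x y. For a4 > 0 completing the square exhibits a dominated square; for a4
  = 0 the form does not involve x.\<close>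

lemma psd_quartic_degenerate_e3_dominates:
  fixes F :: "real \<Rightarrow> real \<Rightarrow> real \<Rightarrow> real"
  assumes nonneg: "\<And>x y z. F x y z \<ge> 0" and q: "is_quartic F"
    and zero: "F 1 0 0 = 0" and nz: "\<exists>x y z. F x y z \<noteq> 0"
    and deg: "\<And>x. F x 0 1 = F 0 0 1"
  shows "dominates_square F"
proof -
  obtain a1 a2 a3 a4 a5 a6 a7 a8 a9 a10 a11 a12 a13 a14 a15 where F:
    "\<And>x y z. F x y z = a1 * x^4 + a2 * x^3 * y + a3 * x^3 * z + a4 * x^2 * y^2 + a5 * x^2 * y * z + a6 * x^2 * z^2
     + a7 * x * y^3 + a8 * x * y^2 * z + a9 * x * y * z^2 + a10 * x * z^3
     + a11 * y^4 + a12 * y^3 * z + a13 * y^2 * z^2 + a14 * y * z^3 + a15 * z^4"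
    using q by (rule is_quarticE) blast
  note a123 = psd_quartic_zero_e1[OF nonneg F zero]
  have a6: "a6 = 0" and a10: "a10 = 0"
    using deg[of 1] deg[of "-1"] by (simp_all add: F a123)
  define h where "h y z = a11 * y^4 + a12 * y^3 * z + a13 * y^2 * z^2 + a14 * y * z^3 + a15 * z^4" for y z
  define g where "g y z = a7 * y^2 + a8 * y * z + a9 * z^2" for y z
  have F': "F x y z = (a4 * y^2 + a5 * y * z) * x^2 + (y * g y z) * x + h y z" for x y z
    unfolding F a123 a6 a10 g_def h_def by algebra
  have disc: "a4 * y^2 + a5 * y * z \<ge> 0" "(y * g y z)^2 \<le> 4 * (a4 * y^2 + a5 * y * z) * h y z" for y z
    using nonneg_quadratic_discrim(1,3)[of "a4 * y^2 + a5 * y * z" "y * g y z" "h y z"] nonneg[of _ y z]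
    by (auto simp: F')
  have a5: "a5 = 0" and a4: "a4 \<ge> 0"
    using nonneg_quadratic_discrim(1,3)[of a4 a5 0] disc(1)[of _ 1] by auto
  show ?thesis
  proof (cases "a4 = 0")
    case True
    have g0: "y * g y z = 0" for y z
      using disc(2)[of y z] by (simp add: True a5)
    show ?thesis
      by (rule psd_quartic_binary_dominates[OF nonneg _ nz])
        (unfold F' g0, simp add: True a5 h_def)
  next
    case False
    with a4 have a4: "a4 > 0" by simp
    \<comment> \<open>The discriminant bound carries the factor y^2 on both sides; cancelling it at
      y = 0 needs continuity in y.\<close>
    have *: "(g y z)^2 \<le> 4 * a4 * h y z" for y z
    proof -
      have "0 \<le> (\<lambda>t. 4 * a4 * h t z - (g t z)^2) y" if "y \<noteq> 0" for y
      proof -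
        have "y^2 * (g y z)^2 \<le> y^2 * (4 * a4 * h y z)"
          using disc(2)[of y z] by (simp add: a5 power_mult_distrib mult_ac)
        then show ?thesis using that by simp
      qed
      moreover have "isCont (\<lambda>t. 4 * a4 * h t z - (g t z)^2) 0"
        unfolding h_def g_def by (intro continuous_intros)
      ultimately have "0 \<le> (\<lambda>t. 4 * a4 * h t z - (g t z)^2) 0"
        by (rule nonneg_at_0_of_nonneg_off_0[rotated])
      then show ?thesis
        using \<open>\<And>y. y \<noteq> 0 \<Longrightarrow> 0 \<le> (\<lambda>t. 4 * a4 * h t z - (g t z)^2) y\<close>[of y] by (cases "y = 0") auto
    qed
    define s where "s = sqrt a4"
    have s: "s^2 = a4" "s > 0" using a4 by (auto simp: s_def)
    show ?thesis
    proof (rule dominates_squareI[of 0 "a7 / (2 * s)" "a9 / (2 * s)" s 0 "a8 / (2 * s)"])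
      fix x y z
      have "(0 * x^2 + a7 / (2 * s) * y^2 + a9 / (2 * s) * z^2 + s * x * y + 0 * x * z + a8 / (2 * s) * y * z)
        = s * x * y + g y z / (2 * s)"
        using s by (simp add: g_def field_simps)
      also have "\<dots>^2 = s^2 * (x * y)^2 + x * y * g y z + (g y z)^2 / (4 * s^2)"
        using s(2) by (simp add: power2_eq_square field_simps)
      also have "\<dots> \<le> a4 * (x * y)^2 + x * y * g y z + h y z"
        using *[of y z] a4 by (simp add: s(1) divide_le_eq mult_ac)
      also have "\<dots> = F x y z"
        unfolding F' a5 by algebra
      finally show "(0 * x^2 + a7 / (2 * s) * y^2 + a9 / (2 * s) * z^2 + s * x * y + 0 * x * z + a8 / (2 * s) * y * z)^2 \<le> F x y z" .
    qed (use s in auto)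
  qed
qed

lemma psd_quartic_degenerate_dominates:
  fixes F :: "real \<Rightarrow> real \<Rightarrow> real \<Rightarrow> real"
  assumes nonneg: "\<And>x y z. F x y z \<ge> 0" and q: "is_quartic F"
    and zero: "F 1 0 0 = 0" and nz: "\<exists>x y z. F x y z \<noteq> 0"
    and 0: "y0 \<noteq> 0 \<or> z0 \<noteq> 0" and deg: "\<And>x. F x y0 z0 = F 0 y0 z0"
  shows "dominates_square F"
proof -
  obtain x1 y1 z1 where nz': "F x1 y1 z1 \<noteq> 0" using nz by blast
  show ?thesis
  proof (cases "z0 = 0")
    case False
    have "dominates_square (\<lambda>x y z. F (1 * x + 0 * y + 0 * z) (0 * x + 1 * y + y0 * z) (0 * x + 0 * y + z0 * z))"
    proof (rule psd_quartic_degenerate_e3_dominates[OF _ is_quartic_subst[OF q]], goal_cases)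
      case 3
      have "F (1 * x1 + 0 * (y1 - y0 * (z1 / z0)) + 0 * (z1 / z0)) (0 * x1 + 1 * (y1 - y0 * (z1 / z0)) + y0 * (z1 / z0))
         (0 * x1 + 0 * (y1 - y0 * (z1 / z0)) + z0 * (z1 / z0)) \<noteq> 0"
        using nz' False by simp
      then show ?case by blast
    qed (use nonneg zero deg in auto)
    then show ?thesis
      by (rule dominates_square_subst[where l1' = 1 and l2' = 0 and l3' = 0 and m1' = 0 and m2' = 1 and m3' = "- y0 / z0"
          and n1' = 0 and n2' = 0 and n3' = "1 / z0"]) (use False in auto)
  next
    case True
    with 0 have y0: "y0 \<noteq> 0" by simp
    have "dominates_square (\<lambda>x y z. F (1 * x + 0 * y + 0 * z) (0 * x + 0 * y + y0 * z) (0 * x + 1 * y + 0 * z))"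
    proof (rule psd_quartic_degenerate_e3_dominates[OF _ is_quartic_subst[OF q]], goal_cases)
      case 3
      have "F (1 * x1 + 0 * z1 + 0 * (y1 / y0)) (0 * x1 + 0 * z1 + y0 * (y1 / y0)) (0 * x1 + 1 * z1 + 0 * (y1 / y0)) \<noteq> 0"
        using nz' y0 by simp
      then show ?case by blast
    qed (use nonneg zero deg True in auto)
    then show ?thesis
      by (rule dominates_square_subst[where l1' = 1 and l2' = 0 and l3' = 0 and m1' = 0 and m2' = 0 and m3' = 1
          and n1' = 0 and n2' = "1 / y0" and n3' = 0]) (use y0 in auto)
  qed
qed

lemma binary_quadratic_factor:
  fixes A B C :: real
  assumes "A * y0^2 + B * y0 * z0 + C * z0^2 = 0" "y0 \<noteq> 0 \<or> z0 \<noteq> 0"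
  obtains k l where "\<And>y z. A * y^2 + B * y * z + C * z^2 = (z0 * y - y0 * z) * (k * y + l * z)"
proof (cases "y0 = 0")
  case True
  with assms have "C = 0" "z0 \<noteq> 0" by auto
  then show ?thesis
    using that[of "A / z0" "B / z0"] True by (simp add: field_simps power2_eq_square)
next
  case False
  define l where "l = - C / y0"
  define k where "k = (z0 * l - B) / y0"
  have C: "C = - l * y0" using False by (simp add: l_def)
  have B: "B = z0 * l - k * y0" using False by (simp add: k_def)
  have "y0 * (y0 * (A - z0 * k)) = 0"
    using assms(1) unfolding B C by algebra
  then have A: "A = z0 * k" using False by simp
  show ?thesis
    by (rule that[of k l]) (unfold A B C, algebra)
qed

lemma nonneg_binary_quadratic_zero:
  fixes A B C :: real
  assumes nonneg: "\<And>y z. A * y^2 + B * y * z + C * z^2 \<ge> 0"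
    and 0: "A * y0^2 + B * y0 * z0 + C * z0^2 = 0" "y0 \<noteq> 0 \<or> z0 \<noteq> 0"
  obtains c where "c \<ge> 0" "\<And>y z. A * y^2 + B * y * z + C * z^2 = c * (z0 * y - y0 * z)^2"
proof -
  have d: "A \<ge> 0" "C \<ge> 0" "B^2 \<le> 4 * A * C"
    using nonneg_quadratic_discrim[of A B C] nonneg[of _ 1] by auto
  obtain k l where kl: "\<And>y z. A * y^2 + B * y * z + C * z^2 = (z0 * y - y0 * z) * (k * y + l * z)"
    by (rule binary_quadratic_factor[OF 0]) blast
  have A: "A = z0 * k" using kl[of 1 0] by simp
  have C: "C = - (y0 * l)" using kl[of 0 1] by simp
  have B: "B = z0 * l - y0 * k" using kl[of 1 1] A C by (simp add: algebra_simps)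
  \<comment> \<open>This square is the discriminant B^2 - 4 A C, so the two linear factors are
    proportional.\<close>
  have "(z0 * l + y0 * k)^2 \<le> 0"
    using d(3) unfolding A B C by (simp add: power2_eq_square algebra_simps)
  then have e: "z0 * l = - (y0 * k)" by simp
  show ?thesis
  proof (cases "y0 = 0")
    case True
    with 0 e have z: "z0 \<noteq> 0" "l = 0" by auto
    show ?thesis
      by (rule that[of "A / z0^2"]) (use d z True in \<open>auto simp: A B C field_simps power2_eq_square zero_le_divide_iff zero_le_mult_iff\<close>)
  next
    case False
    have k: "k = - (z0 * l) / y0" using False e by (simp add: field_simps)
    show ?thesis
    proof (rule that[of "C / y0^2"])
      show "A * y^2 + B * y * z + C * z^2 = C / y0^2 * (z0 * y - y0 * z)^2" for y z
        unfolding A B C k using False by (simp add: field_simps power2_eq_square)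
    qed (use d in auto)
  qed
qed

lemma binary_quadratic_le:
  fixes a b c :: real
  obtains M where "M > 0" "\<And>y z. a * y^2 + b * y * z + c * z^2 \<le> M * (y^2 + z^2)"
proof (rule that[of "\<bar>a\<bar> + \<bar>b\<bar> + \<bar>c\<bar> + 1"])
  fix y z :: real
  have "2 * \<bar>y * z\<bar> \<le> y^2 + z^2"
    using sum_squares_bound[of "\<bar>y\<bar>" "\<bar>z\<bar>"] by (simp add: abs_mult)
  then have yz: "\<bar>y * z\<bar> \<le> y^2 + z^2" by simp
  have "a * y^2 \<le> \<bar>a\<bar> * (y^2 + z^2)" "c * z^2 \<le> \<bar>c\<bar> * (y^2 + z^2)"
    by (intro mult_mono; simp)+
  moreover have "b * (y * z) \<le> \<bar>b\<bar> * (y^2 + z^2)"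
    using mult_left_mono[OF yz, of "\<bar>b\<bar>"] abs_ge_self[of "b * (y * z)"] by (simp add: abs_mult)
  moreover have "0 \<le> y^2 + z^2" by simp
  ultimately show "a * y^2 + b * y * z + c * z^2 \<le> (\<bar>a\<bar> + \<bar>b\<bar> + \<bar>c\<bar> + 1) * (y^2 + z^2)"
    by (simp only: distrib_right mult.assoc mult_1)
qed (auto intro: add_nonneg_pos)

text \<open>The two zeros give F = f x^2 + z g x + z^2 h with f, g, h quadratic in y, z and D = 4 f
  h - g^2 nonnegative. A nontrivial zero of f is the degenerate case. If D is definite, z^2 D <= 4 f
  F together with quadratic growth of f yields F >= s^2 z^4. If D vanishes at (y0, z0), a shear in x
  makes g and h vanish there. With L = z0 y - y0 z they become L (k y + l z) and c L^2, and for c >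
  0 the square of s z L + x (k y + l z) / (2 s), where s^2 = c, lies below the sheared form.\<close>

lemma psd_quartic_two_zeros_dominates:
  fixes F :: "real \<Rightarrow> real \<Rightarrow> real \<Rightarrow> real"
  assumes nonneg: "\<And>x y z. F x y z \<ge> 0" and q: "is_quartic F"
    and zero: "F 1 0 0 = 0" and zero2: "F 0 1 0 = 0" and nz: "\<exists>x y z. F x y z \<noteq> 0"
  shows "dominates_square F"
proof -
  obtain a1 a2 a3 a4 a5 a6 a7 a8 a9 a10 a11 a12 a13 a14 a15 where F:
    "\<And>x y z. F x y z = a1 * x^4 + a2 * x^3 * y + a3 * x^3 * z + a4 * x^2 * y^2 + a5 * x^2 * y * z + a6 * x^2 * z^2
     + a7 * x * y^3 + a8 * x * y^2 * z + a9 * x * y * z^2 + a10 * x * z^3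
     + a11 * y^4 + a12 * y^3 * z + a13 * y^2 * z^2 + a14 * y * z^3 + a15 * z^4"
    using q by (rule is_quarticE) blast
  note a123 = psd_quartic_zero_e1[OF nonneg F zero]
  have a11: "a11 = 0" and a7: "a7 = 0" and a12: "a12 = 0"
  proof -
    have "F y x z = a11 * x^4 + a7 * x^3 * y + a12 * x^3 * z + a4 * x^2 * y^2 + a8 * x^2 * y * z + a13 * x^2 * z^2
     + a2 * x * y^3 + a5 * x * y^2 * z + a9 * x * y * z^2 + a14 * x * z^3
     + a1 * y^4 + a3 * y^3 * z + a6 * y^2 * z^2 + a10 * y * z^3 + a15 * z^4" for x y z
      unfolding F by algebra
    from psd_quartic_zero_e1[of "\<lambda>x y z. F y x z", OF nonneg this zero2]
    show "a11 = 0" "a7 = 0" "a12 = 0" .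
  qed
  define f where "f y z = a4 * y^2 + a5 * y * z + a6 * z^2" for y z
  define g where "g y z = a8 * y^2 + a9 * y * z + a10 * z^2" for y z
  define h where "h y z = a13 * y^2 + a14 * y * z + a15 * z^2" for y z
  define D where "D y z = 4 * f y z * h y z - (g y z)^2" for y z
  have F': "F x y z = f y z * x^2 + (z * g y z) * x + z^2 * h y z" for x y z
    unfolding F a123 a11 a7 a12 f_def g_def h_def by algebra
  have f0: "f y z \<ge> 0" and disc: "(z * g y z)^2 \<le> 4 * f y z * (z^2 * h y z)" for y z
    using nonneg_quadratic_discrim(1,3)[of "f y z" "z * g y z" "z^2 * h y z"] nonneg[of _ y z]
    by (auto simp: F')
  have cont: "isCont (\<lambda>t. D y t) 0" for y
    unfolding D_def f_def g_def h_def by (intro continuous_intros)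
  have D_off: "D y z \<ge> 0" if "z \<noteq> 0" for y z
  proof -
    have "0 \<le> z^2 * D y z"
      using disc[of z y] by (simp add: D_def power_mult_distrib algebra_simps)
    then show ?thesis using that by (simp add: zero_le_mult_iff)
  qed
  have D0: "D y z \<ge> 0" for y z
    using D_off nonneg_at_0_of_nonneg_off_0[OF cont, of y] by (cases "z = 0") auto
  have complete: "4 * f y z * F x y z = (2 * f y z * x + z * g y z)^2 + z^2 * D y z" for x y z
    unfolding F' D_def by algebra
  show ?thesis
  proof (cases "\<exists>y0 z0. (y0 \<noteq> 0 \<or> z0 \<noteq> 0) \<and> f y0 z0 = 0")
    case True
    then obtain y0 z0 where 0: "y0 \<noteq> 0 \<or> z0 \<noteq> 0" "f y0 z0 = 0" by blast
    have "(z0 * g y0 z0)^2 \<le> 0" using disc[of z0 y0] 0 by simp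
    then have "z0 * g y0 z0 = 0" by simp
    then have "F x y0 z0 = F 0 y0 z0" for x
      using 0 by (simp add: F')
    then show ?thesis
      by (rule psd_quartic_degenerate_dominates[OF nonneg q zero nz 0(1)])
  next
    case False
    then have f_pos: "f y z > 0" if "y \<noteq> 0 \<or> z \<noteq> 0" for y z
      using f0[of y z] that by (auto simp: less_le)
    show ?thesis
    proof (cases "\<exists>y0 z0. (y0 \<noteq> 0 \<or> z0 \<noteq> 0) \<and> D y0 z0 = 0")
      case False
      then have D_pos: "D y z > 0" if "y \<noteq> 0 \<or> z \<noteq> 0" for y z
        using D0[of y z] that by (auto simp: less_le)
      have contD: "continuous_on UNIV (\<lambda>v. D (fst v) (snd v))"
        unfolding D_def f_def g_def h_def by (intro continuous_intros)
      have homD: "D (t * y) (t * z) = t ^ (2 * 2) * D y z" for t y z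
        unfolding D_def f_def g_def h_def by (simp, algebra)
      obtain \<mu> where \<mu>: "\<mu> > 0" "\<And>y z. \<mu> * (y^2 + z^2) ^ 2 \<le> D y z"
        by (rule homogeneous_lower_bound2[of D 2, OF contD homD D_pos]) simp_all
      obtain M where M: "M > 0" "\<And>y z. f y z \<le> M * (y^2 + z^2)"
        by (rule binary_quadratic_le[of a4 a5 a6]) (metis f_def)
      define s where "s = sqrt (\<mu> / (4 * M))"
      have s: "s^2 = \<mu> / (4 * M)" "s > 0" using \<mu>(1) M(1) by (auto simp: s_def)
      show ?thesis
      proof (rule dominates_squareI[of 0 0 s 0 0 0])
        fix x y z
        show "(0 * x^2 + 0 * y^2 + s * z^2 + 0 * x * y + 0 * x * z + 0 * y * z)^2 \<le> F x y z"
        proof (cases "z = 0")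
          case True
          then show ?thesis using nonneg by simp
        next
          case False
          define r where "r = y^2 + z^2"
          have r: "r > 0" "z^2 \<le> r" using False by (auto simp: r_def intro: add_nonneg_pos)
          have "z^2 * (\<mu> * r^2) \<le> z^2 * D y z"
            using \<mu>(2)[of y z] by (intro mult_left_mono) (simp_all add: r_def)
          also have "\<dots> \<le> 4 * f y z * F x y z"
            unfolding complete by simp
          also have "\<dots> \<le> 4 * (M * r) * F x y z"
            using M(2)[of y z] nonneg by (intro mult_right_mono) (simp_all add: r_def)
          finally have "r * (z^2 * (\<mu> * r)) \<le> r * (4 * M * F x y z)"
            by (simp add: power2_eq_square mult_ac)
          then have "z^2 * (\<mu> * r) \<le> 4 * M * F x y z"
            using r by simp
          moreover have "z^2 * (\<mu> * z^2) \<le> z^2 * (\<mu> * r)"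
            using r \<mu> by (intro mult_left_mono) auto
          ultimately have "z^2 * (\<mu> * z^2) \<le> 4 * M * F x y z" by simp
          then have "(\<mu> / (4 * M)) * (z^2)^2 \<le> F x y z"
            using M(1) by (simp add: field_simps power2_eq_square)
          then show ?thesis by (simp add: power_mult_distrib s(1))
        qed
      qed (use s in auto)
    next
      case True
      then obtain y0 z0 where b: "y0 \<noteq> 0 \<or> z0 \<noteq> 0" "D y0 z0 = 0" by blast
      have fb: "f y0 z0 > 0" using f_pos[OF b(1)] .
      \<comment> \<open>The shear x -> x + \<alpha> z replaces g, h by \<open>g1\<close>,
        \<open>h1\<close> without changing D. This \<alpha> makes \<open>g1\<close> vanish at (y0,
        z0), and D = 0 with f > 0 then makes \<open>h1\<close> vanish as well.\<close>
      define \<alpha> where "\<alpha> = - g y0 z0 / (2 * f y0 z0)"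
      define g1 where "g1 y z = g y z + 2 * \<alpha> * f y z" for y z
      define h1 where "h1 y z = h y z + \<alpha> * g y z + \<alpha>^2 * f y z" for y z
      have D1: "D y z = 4 * f y z * h1 y z - (g1 y z)^2" for y z
        unfolding D_def g1_def h1_def by algebra
      have g1b: "g1 y0 z0 = 0" using fb by (simp add: g1_def \<alpha>_def)
      have h1b: "h1 y0 z0 = 0" using D1[of y0 z0] b g1b fb by simp
      have h10: "h1 y z \<ge> 0" for y z
      proof (cases "y = 0 \<and> z = 0")
        case True
        then show ?thesis by (simp add: h1_def f_def g_def h_def)
      next
        case False
        have "4 * f y z * h1 y z \<ge> 0"
          using D0[of y z] zero_le_power2[of "g1 y z"] unfolding D1 by linarith
        then show ?thesis using f_pos[of y z] False by (simp add: zero_le_mult_iff)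
      qed
      have h1_form: "h1 y z = (a13 + \<alpha> * a8 + \<alpha>^2 * a4) * y^2 + (a14 + \<alpha> * a9 + \<alpha>^2 * a5) * y * z
          + (a15 + \<alpha> * a10 + \<alpha>^2 * a6) * z^2" for y z
        unfolding h1_def h_def g_def f_def by algebra
      have g1_form: "g1 y z = (a8 + 2 * \<alpha> * a4) * y^2 + (a9 + 2 * \<alpha> * a5) * y * z + (a10 + 2 * \<alpha> * a6) * z^2" for y z
        unfolding g1_def g_def f_def by algebra
      obtain c where c: "c \<ge> 0" "\<And>y z. h1 y z = c * (z0 * y - y0 * z)^2"
        by (rule nonneg_binary_quadratic_zero[OF h10[unfolded h1_form] h1b[unfolded h1_form] b(1)]) (metis h1_form)
      obtain k l where kl: "\<And>y z. g1 y z = (z0 * y - y0 * z) * (k * y + l * z)"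
        by (rule binary_quadratic_factor[OF g1b[unfolded g1_form] b(1)]) (metis g1_form)
      have D_factor: "D y z = (z0 * y - y0 * z)^2 * (4 * c * f y z - (k * y + l * z)^2)" for y z
        unfolding D1 c(2) kl by algebra
      have kl_le: "(k * y + l * z)^2 \<le> 4 * c * f y z" for y z
      proof -
        \<comment> \<open>The squared factor in \<open>D_factor\<close> vanishes on the line z0 y =
          y0 z. The vector (z0, -y0) is normal to it, so continuity along that direction covers the
          line.\<close>
        define \<phi> where "\<phi> t = 4 * c * f (y + t * z0) (z - t * y0) - (k * (y + t * z0) + l * (z - t * y0))^2" for t
        have off: "\<phi> t \<ge> 0" if "z0 * (y + t * z0) - y0 * (z - t * y0) \<noteq> 0" for t
        proof -
          have "0 \<le> (z0 * (y + t * z0) - y0 * (z - t * y0))^2 * \<phi> t"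
            using D0[of "y + t * z0" "z - t * y0"] unfolding D_factor \<phi>_def .
          then show ?thesis using that by (simp add: zero_le_mult_iff)
        qed
        have "\<phi> 0 \<ge> 0"
        proof (cases "z0 * y - y0 * z = 0")
          case False
          then show ?thesis using off[of 0] by simp
        next
          case True
          show ?thesis
          proof (rule nonneg_at_0_of_nonneg_off_0)
            show "isCont \<phi> 0"
              unfolding \<phi>_def f_def by (intro continuous_intros)
            fix t :: real assume "t \<noteq> 0"
            moreover have "z0 * (y + t * z0) - y0 * (z - t * y0) = t * (z0^2 + y0^2)"
              using True by algebra
            moreover have "z0^2 + y0^2 \<noteq> 0" using b(1) by (auto simp: sum_power2_eq_zero_iff)
            ultimately show "\<phi> t \<ge> 0" by (intro off) simp
          qed
        qed
        then show ?thesis by (simp add: \<phi>_def)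
      qed
      have F1: "F (1 * x + 0 * y + \<alpha> * z) (0 * x + 1 * y + 0 * z) (0 * x + 0 * y + 1 * z)
          = f y z * x^2 + z * (z0 * y - y0 * z) * (k * y + l * z) * x + c * (z * (z0 * y - y0 * z))^2" for x y z
      proof -
        have "F (1 * x + 0 * y + \<alpha> * z) (0 * x + 1 * y + 0 * z) (0 * x + 0 * y + 1 * z)
          = f y z * x^2 + z * g1 y z * x + z^2 * h1 y z"
          unfolding F' g1_def h1_def by (simp, algebra)
        then show ?thesis unfolding c(2) kl by (simp add: power_mult_distrib mult_ac)
      qed
      have "dominates_square (\<lambda>x y z. F (1 * x + 0 * y + \<alpha> * z) (0 * x + 1 * y + 0 * z) (0 * x + 0 * y + 1 * z))"
        unfolding F1
      proof (cases "c = 0")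
        case True
        have 0: "k * y + l * z = 0" for y z
          using kl_le[of y z] True by simp
        have "a4 \<noteq> 0 \<or> a5 \<noteq> 0 \<or> a6 \<noteq> 0"
          using f_pos[of 1 1] by (auto simp: f_def)
        then obtain u v where uv: "u \<noteq> 0 \<or> v \<noteq> 0" "\<And>y z. (u * y + v * z)^2 \<le> f y z"
          using nonneg_binary_quadratic_dominates[OF f0[unfolded f_def]] unfolding f_def by metis
        show "dominates_square (\<lambda>x y z. f y z * x^2 + z * (z0 * y - y0 * z) * (k * y + l * z) * x + c * (z * (z0 * y - y0 * z))^2)"
        proof (rule dominates_squareI[of 0 0 0 u v 0])
          fix x y z
          have "(0 * x^2 + 0 * y^2 + 0 * z^2 + u * x * y + v * x * z + 0 * y * z)^2 = x^2 * (u * y + v * z)^2"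
            by algebra
          also have "\<dots> \<le> x^2 * f y z"
            using uv(2) by (intro mult_left_mono) auto
          finally show "(0 * x^2 + 0 * y^2 + 0 * z^2 + u * x * y + v * x * z + 0 * y * z)^2
            \<le> f y z * x^2 + z * (z0 * y - y0 * z) * (k * y + l * z) * x + c * (z * (z0 * y - y0 * z))^2"
            by (simp add: True 0 mult.commute)
        qed (use uv(1) in auto)
      next
        case False
        with c(1) have c0: "c > 0" by simp
        define s where "s = sqrt c"
        have s: "s^2 = c" "s > 0" using c0 by (auto simp: s_def)
        show "dominates_square (\<lambda>x y z. f y z * x^2 + z * (z0 * y - y0 * z) * (k * y + l * z) * x + c * (z * (z0 * y - y0 * z))^2)"
        proof (rule dominates_squareI[of 0 0 "- s * y0" "k / (2 * s)" "l / (2 * s)" "s * z0"])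
          fix x y z
          have "0 * x^2 + 0 * y^2 + (- s * y0) * z^2 + k / (2 * s) * x * y + l / (2 * s) * x * z + (s * z0) * y * z
              = s * (z * (z0 * y - y0 * z)) + x * (k * y + l * z) / (2 * s)"
            using s(2) by (simp add: field_simps power2_eq_square)
          also have "\<dots>^2 = c * (z * (z0 * y - y0 * z))^2 + z * (z0 * y - y0 * z) * (k * y + l * z) * x
              + x^2 * ((k * y + l * z)^2 / (4 * c))"
            unfolding s(1)[symmetric] using s(2) by (simp add: power2_eq_square field_simps)
          also have "x^2 * ((k * y + l * z)^2 / (4 * c)) \<le> x^2 * f y z"
            using kl_le[of y z] c0 by (intro mult_left_mono) (simp_all add: divide_le_eq mult_ac)
          finally show "(0 * x^2 + 0 * y^2 + (- s * y0) * z^2 + k / (2 * s) * x * y + l / (2 * s) * x * z + (s * z0) * y * z)^2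
            \<le> f y z * x^2 + z * (z0 * y - y0 * z) * (k * y + l * z) * x + c * (z * (z0 * y - y0 * z))^2"
            by (simp add: mult_ac add_ac)
        qed (use b s in auto)
      qed
      then show ?thesis
        by (rule dominates_square_subst[where l1' = 1 and l2' = 0 and l3' = "- \<alpha>" and m1' = 0 and m2' = 1 and m3' = 0
          and n1' = 0 and n2' = 0 and n3' = 1]) auto
    qed
  qed
qed

text \<open>Here F = f x^2 + g x + h, and D = 4 f h - g^2 is a nonnegative sextic. If D is definite,
  D <= 4 f F bounds F below by a multiple of (y^2 + z^2)^2, sextic growth against quadratic growth.
  If D vanishes where f > 0, the vertex of the parabola in x is a second zero of F, which is moved
  to (0, 1, 0).\<close>

lemma psd_quartic_zero_dominates:
  fixes F :: "real \<Rightarrow> real \<Rightarrow> real \<Rightarrow> real"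
  assumes nonneg: "\<And>x y z. F x y z \<ge> 0" and q: "is_quartic F"
    and zero: "F 1 0 0 = 0" and nz: "\<exists>x y z. F x y z \<noteq> 0"
  shows "dominates_square F"
proof -
  obtain a1 a2 a3 a4 a5 a6 a7 a8 a9 a10 a11 a12 a13 a14 a15 where F:
    "\<And>x y z. F x y z = a1 * x^4 + a2 * x^3 * y + a3 * x^3 * z + a4 * x^2 * y^2 + a5 * x^2 * y * z + a6 * x^2 * z^2
     + a7 * x * y^3 + a8 * x * y^2 * z + a9 * x * y * z^2 + a10 * x * z^3
     + a11 * y^4 + a12 * y^3 * z + a13 * y^2 * z^2 + a14 * y * z^3 + a15 * z^4"
    using q by (rule is_quarticE) blast
  note a123 = psd_quartic_zero_e1[OF nonneg F zero]
  obtain x1 y1 z1 where nz': "F x1 y1 z1 \<noteq> 0" using nz by blast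
  define f where "f y z = a4 * y^2 + a5 * y * z + a6 * z^2" for y z
  define g where "g y z = a7 * y^3 + a8 * y^2 * z + a9 * y * z^2 + a10 * z^3" for y z
  define h where "h y z = a11 * y^4 + a12 * y^3 * z + a13 * y^2 * z^2 + a14 * y * z^3 + a15 * z^4" for y z
  define D where "D y z = 4 * f y z * h y z - (g y z)^2" for y z
  have F': "F x y z = f y z * x^2 + g y z * x + h y z" for x y z
    unfolding F a123 f_def g_def h_def by algebra
  have f0: "f y z \<ge> 0" and disc: "(g y z)^2 \<le> 4 * f y z * h y z" for y z
    using nonneg_quadratic_discrim(1,3)[of "f y z" "g y z" "h y z"] nonneg[of _ y z]
    by (auto simp: F')
  have D0: "D y z \<ge> 0" for y z
    using disc[of y z] by (simp add: D_def)
  have complete: "4 * f y z * F x y z = (2 * f y z * x + g y z)^2 + D y z" for x y z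
    unfolding F' D_def by algebra
  show ?thesis
  proof (cases "\<exists>y0 z0. (y0 \<noteq> 0 \<or> z0 \<noteq> 0) \<and> f y0 z0 = 0")
    case True
    then obtain y0 z0 where 0: "y0 \<noteq> 0 \<or> z0 \<noteq> 0" "f y0 z0 = 0" by blast
    have "g y0 z0 = 0" using disc[of y0 z0] 0 by simp
    then have "F x y0 z0 = F 0 y0 z0" for x
      using 0 by (simp add: F')
    then show ?thesis
      by (rule psd_quartic_degenerate_dominates[OF nonneg q zero nz 0(1)])
  next
    case False
    then have f_pos: "f y z > 0" if "y \<noteq> 0 \<or> z \<noteq> 0" for y z
      using f0[of y z] that by (auto simp: less_le)
    show ?thesis
    proof (cases "\<exists>y0 z0. (y0 \<noteq> 0 \<or> z0 \<noteq> 0) \<and> D y0 z0 = 0")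
      case False
      then have D_pos: "D y z > 0" if "y \<noteq> 0 \<or> z \<noteq> 0" for y z
        using D0[of y z] that by (auto simp: less_le)
      have contD: "continuous_on UNIV (\<lambda>v. D (fst v) (snd v))"
        unfolding D_def f_def g_def h_def by (intro continuous_intros)
      have homD: "D (t * y) (t * z) = t ^ (2 * 3) * D y z" for t y z
        unfolding D_def f_def g_def h_def by (simp, algebra)
      obtain \<mu> where \<mu>: "\<mu> > 0" "\<And>y z. \<mu> * (y^2 + z^2) ^ 3 \<le> D y z"
        by (rule homogeneous_lower_bound2[of D 3, OF contD homD D_pos]) simp_all
      obtain M where M: "M > 0" "\<And>y z. f y z \<le> M * (y^2 + z^2)"
        by (rule binary_quadratic_le[of a4 a5 a6]) (metis f_def)
      define s where "s = sqrt (\<mu> / (4 * M))"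
      have s: "s^2 = \<mu> / (4 * M)" "s > 0" using \<mu>(1) M(1) by (auto simp: s_def)
      show ?thesis
      proof (rule dominates_squareI[of 0 s s 0 0 0])
        fix x y z :: real
        define r where "r = y^2 + z^2"
        have "r \<ge> 0" by (simp add: r_def)
        have "s^2 * r^2 \<le> F x y z"
        proof (cases "r = 0")
          case True
          then show ?thesis using nonneg by simp
        next
          case False
          with \<open>r \<ge> 0\<close> have r: "r > 0" by simp
          have "\<mu> * r^3 \<le> D y z"
            using \<mu>(2)[of y z] by (simp add: r_def)
          also have "\<dots> \<le> 4 * f y z * F x y z"
            unfolding complete by simp
          also have "\<dots> \<le> 4 * (M * r) * F x y z"
            using M(2)[of y z] nonneg by (intro mult_right_mono) (simp_all add: r_def)
          finally have "r * (\<mu> * r^2) \<le> r * (4 * M * F x y z)"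
            by (simp add: power2_eq_square power3_eq_cube mult_ac)
          then have "\<mu> * r^2 \<le> 4 * M * F x y z"
            using r by simp
          then show ?thesis
            using M(1) by (simp add: s(1) field_simps)
        qed
        moreover have "(0 * x^2 + s * y^2 + s * z^2 + 0 * x * y + 0 * x * z + 0 * y * z)^2 = s^2 * r^2"
          unfolding r_def by algebra
        ultimately show "(0 * x^2 + s * y^2 + s * z^2 + 0 * x * y + 0 * x * z + 0 * y * z)^2 \<le> F x y z"
          by simp
      qed (use s in auto)
    next
      case True
      then obtain y0 z0 where b: "y0 \<noteq> 0 \<or> z0 \<noteq> 0" "D y0 z0 = 0" by blast
      have fb: "f y0 z0 > 0" using f_pos[OF b(1)] .
      define x0 where "x0 = - g y0 z0 / (2 * f y0 z0)"
      have Fb: "F x0 y0 z0 = 0"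
        using complete[of y0 z0 x0] fb b by (simp add: x0_def)
      show ?thesis
      proof (cases "y0 = 0")
        case False
        have "dominates_square (\<lambda>x y z. F (1 * x + x0 * y + 0 * z) (0 * x + y0 * y + 0 * z) (0 * x + z0 * y + 1 * z))"
        proof (rule psd_quartic_two_zeros_dominates[OF _ is_quartic_subst[OF q]], goal_cases)
          case 4
          have "F (1 * (x1 - x0 * (y1 / y0)) + x0 * (y1 / y0) + 0 * (z1 - z0 * (y1 / y0)))
             (0 * (x1 - x0 * (y1 / y0)) + y0 * (y1 / y0) + 0 * (z1 - z0 * (y1 / y0)))
             (0 * (x1 - x0 * (y1 / y0)) + z0 * (y1 / y0) + 1 * (z1 - z0 * (y1 / y0))) \<noteq> 0"
            using nz' False by simp
          then show ?case by blast
        qed (use nonneg zero Fb in auto)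
        then show ?thesis
          by (rule dominates_square_subst[where l1' = 1 and l2' = "- x0 / y0" and l3' = 0 and m1' = 0 and m2' = "1 / y0" and m3' = 0
              and n1' = 0 and n2' = "- z0 / y0" and n3' = 1]) (use False in auto)
      next
        case True
        with b have z0: "z0 \<noteq> 0" by simp
        have "dominates_square (\<lambda>x y z. F (1 * x + x0 * y + 0 * z) (0 * x + 0 * y + 1 * z) (0 * x + z0 * y + 0 * z))"
        proof (rule psd_quartic_two_zeros_dominates[OF _ is_quartic_subst[OF q]], goal_cases)
          case 4
          have "F (1 * (x1 - x0 * (z1 / z0)) + x0 * (z1 / z0) + 0 * y1)
             (0 * (x1 - x0 * (z1 / z0)) + 0 * (z1 / z0) + 1 * y1)
             (0 * (x1 - x0 * (z1 / z0)) + z0 * (z1 / z0) + 0 * y1) \<noteq> 0"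
            using nz' z0 by simp
          then show ?case by blast
        qed (use nonneg zero Fb True in auto)
        then show ?thesis
          by (rule dominates_square_subst[where l1' = 1 and l2' = 0 and l3' = "- x0 / z0" and m1' = 0 and m2' = 0 and m3' = "1 / z0"
              and n1' = 0 and n2' = 1 and n3' = 0]) (use z0 in auto)
      qed
    qed
  qed
qed

lemma psd_quartic_dominates:
  fixes F :: "real \<Rightarrow> real \<Rightarrow> real \<Rightarrow> real"
  assumes nonneg: "\<And>x y z. F x y z \<ge> 0" and q: "is_quartic F" and nz: "\<exists>x y z. F x y z \<noteq> 0"
  shows "dominates_square F"
proof -
  obtain a1 a2 a3 a4 a5 a6 a7 a8 a9 a10 a11 a12 a13 a14 a15 where F:
    "\<And>x y z. F x y z = a1 * x^4 + a2 * x^3 * y + a3 * x^3 * z + a4 * x^2 * y^2 + a5 * x^2 * y * z + a6 * x^2 * z^2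
     + a7 * x * y^3 + a8 * x * y^2 * z + a9 * x * y * z^2 + a10 * x * z^3
     + a11 * y^4 + a12 * y^3 * z + a13 * y^2 * z^2 + a14 * y * z^3 + a15 * z^4"
    using q by (rule is_quarticE) blast
  obtain x1 y1 z1 where nz': "F x1 y1 z1 \<noteq> 0" using nz by blast
  have hom: "F (t * x) (t * y) (t * z) = t^4 * F x y z" for t x y z
    unfolding F by algebra
  show ?thesis
  proof (cases "\<exists>x0 y0 z0. (x0 \<noteq> 0 \<or> y0 \<noteq> 0 \<or> z0 \<noteq> 0) \<and> F x0 y0 z0 = 0")
    case False
    have "continuous_on UNIV (\<lambda>v. F (fst v) (fst (snd v)) (snd (snd v)))"
      unfolding F by (intro continuous_intros)
    moreover have "F (fst (t *\<^sub>R v)) (fst (snd (t *\<^sub>R v))) (snd (snd (t *\<^sub>R v))) =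
        t ^ (2 * 2) * F (fst v) (fst (snd v)) (snd (snd v))" for t and v :: "real \<times> real \<times> real"
      using hom by simp
    moreover have "F (fst v) (fst (snd v)) (snd (snd v)) > 0" if "v \<noteq> 0" for v
      using False nonneg that by (force simp: less_le prod_eq_iff)
    ultimately obtain \<mu> where \<mu>: "\<mu> > 0"
        "\<And>v. \<mu> * (norm v ^ 2) ^ 2 \<le> F (fst v) (fst (snd v)) (snd (snd v))"
      by (rule homogeneous_lower_bound) simp_all
    show ?thesis
    proof (rule dominates_squareI[of "sqrt \<mu>" "sqrt \<mu>" "sqrt \<mu>" 0 0 0])
      fix x y z
      have "(sqrt \<mu> * x^2 + sqrt \<mu> * y^2 + sqrt \<mu> * z^2 + 0 * x * y + 0 * x * z + 0 * y * z)^2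
          = (sqrt \<mu>)^2 * (x^2 + (y^2 + z^2))^2"
        by algebra
      also have "\<dots> \<le> F x y z"
        using \<mu>(1) \<mu>(2)[of "(x, y, z)"] by (simp add: norm_Pair)
      finally show "(sqrt \<mu> * x^2 + sqrt \<mu> * y^2 + sqrt \<mu> * z^2 + 0 * x * y + 0 * x * z + 0 * y * z)^2 \<le> F x y z" .
    qed (use \<mu> in auto)
  next
    case True
    then obtain x0 y0 z0 where 0: "x0 \<noteq> 0 \<or> y0 \<noteq> 0 \<or> z0 \<noteq> 0" "F x0 y0 z0 = 0" by blast
    consider "x0 \<noteq> 0" | "x0 = 0" "y0 \<noteq> 0" | "x0 = 0" "y0 = 0" "z0 \<noteq> 0" using 0 by blast
    then show ?thesis
    proof cases
      case 1
      have "dominates_square (\<lambda>x y z. F (x0 * x + 0 * y + 0 * z) (y0 * x + 1 * y + 0 * z) (z0 * x + 0 * y + 1 * z))"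
      proof (rule psd_quartic_zero_dominates[OF _ is_quartic_subst[OF q]], goal_cases)
        case 3
        have "F (x0 * (x1 / x0) + 0 * (y1 - y0 * (x1 / x0)) + 0 * (z1 - z0 * (x1 / x0)))
          (y0 * (x1 / x0) + 1 * (y1 - y0 * (x1 / x0)) + 0 * (z1 - z0 * (x1 / x0)))
          (z0 * (x1 / x0) + 0 * (y1 - y0 * (x1 / x0)) + 1 * (z1 - z0 * (x1 / x0))) \<noteq> 0"
          using nz' 1 by simp
        then show ?case by blast
      qed (use nonneg 0 in auto)
      then show ?thesis
        by (rule dominates_square_subst[where l1' = "1 / x0" and l2' = 0 and l3' = 0 and m1' = "- y0 / x0" and m2' = 1 and m3' = 0
            and n1' = "- z0 / x0" and n2' = 0 and n3' = 1]) (use 1 in auto)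
    next
      case 2
      have "dominates_square (\<lambda>x y z. F (0 * x + 1 * y + 0 * z) (y0 * x + 0 * y + 0 * z) (z0 * x + 0 * y + 1 * z))"
      proof (rule psd_quartic_zero_dominates[OF _ is_quartic_subst[OF q]], goal_cases)
        case 3
        have "F (0 * (y1 / y0) + 1 * x1 + 0 * (z1 - z0 * (y1 / y0)))
          (y0 * (y1 / y0) + 0 * x1 + 0 * (z1 - z0 * (y1 / y0)))
          (z0 * (y1 / y0) + 0 * x1 + 1 * (z1 - z0 * (y1 / y0))) \<noteq> 0"
          using nz' 2 by simp
        then show ?case by blast
      qed (use nonneg 0 2 in auto)
      then show ?thesis
        by (rule dominates_square_subst[where l1' = 0 and l2' = "1 / y0" and l3' = 0 and m1' = 1 and m2' = 0 and m3' = 0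
            and n1' = 0 and n2' = "- z0 / y0" and n3' = 1]) (use 2 in auto)
    next
      case 3
      have "dominates_square (\<lambda>x y z. F (0 * x + 0 * y + 1 * z) (0 * x + 1 * y + 0 * z) (z0 * x + 0 * y + 0 * z))"
      proof (rule psd_quartic_zero_dominates[OF _ is_quartic_subst[OF q]], goal_cases)
        case 3
        have "F (0 * (z1 / z0) + 0 * y1 + 1 * x1) (0 * (z1 / z0) + 1 * y1 + 0 * x1) (z0 * (z1 / z0) + 0 * y1 + 0 * x1) \<noteq> 0"
          using nz' \<open>z0 \<noteq> 0\<close> by simp
        then show ?case by blast
      qed (use nonneg 0 3 in auto)
      then show ?thesis
        by (rule dominates_square_subst[where l1' = 0 and l2' = 0 and l3' = "1 / z0" and m1' = 0 and m2' = 1 and m3' = 0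
            and n1' = 1 and n2' = 0 and n3' = 0]) (use 3 in auto)
    qed
  qed
qed

section \<open>Krein-Milman on a compact base of the cone of psd quartics\<close>

definition sum_of_quad_squares :: "(real \<Rightarrow> real \<Rightarrow> real \<Rightarrow> real) \<Rightarrow> bool" where
  "sum_of_quad_squares F \<longleftrightarrow> (\<exists>(m :: nat) q. (\<forall>j<m. is_quad (q j)) \<and> F = (\<lambda>x y z. \<Sum>j<m. q j x y z ^ 2))"

lemma sum_of_quad_squares_single:
  assumes "is_quad q" "F = (\<lambda>x y z. q x y z ^ 2)"
  shows "sum_of_quad_squares F"
  unfolding sum_of_quad_squares_def using assms
  by (intro exI[of _ "Suc 0"] exI[of _ "\<lambda>_. q"]) simp

lemma sum_of_quad_squares_add:
  assumes "sum_of_quad_squares F" "sum_of_quad_squares G"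
  shows "sum_of_quad_squares (\<lambda>x y z. F x y z + G x y z)"
proof -
  obtain m :: nat and p where p: "\<forall>j<m. is_quad (p j)" "F = (\<lambda>x y z. \<Sum>j<m. p j x y z ^ 2)"
    using assms(1) unfolding sum_of_quad_squares_def by (elim exE conjE)
  obtain n :: nat and q where q: "\<forall>j<n. is_quad (q j)" "G = (\<lambda>x y z. \<Sum>j<n. q j x y z ^ 2)"
    using assms(2) unfolding sum_of_quad_squares_def by (elim exE conjE)
  define r where "r j = (if j < m then p j else q (j - m))" for j
  have "(\<Sum>j<m + n. r j x y z ^ 2) = F x y z + G x y z" for x y z
  proof -
    have "(\<Sum>j<m + n. r j x y z ^ 2) = (\<Sum>j<m. r j x y z ^ 2) + (\<Sum>j<n. r (m + j) x y z ^ 2)"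
      by (induction n) auto
    then show ?thesis by (simp add: p q r_def)
  qed
  moreover have "\<forall>j<m + n. is_quad (r j)"
    using p q by (auto simp: r_def)
  ultimately show ?thesis
    unfolding sum_of_quad_squares_def by (intro exI[of _ "m + n"] exI[of _ r]) simp
qed

lemma sum_of_quad_squares_scale:
  assumes "sum_of_quad_squares F" "c \<ge> 0"
  shows "sum_of_quad_squares (\<lambda>x y z. c * F x y z)"
proof -
  obtain m :: nat and p where p: "\<forall>j<m. is_quad (p j)" "F = (\<lambda>x y z. \<Sum>j<m. p j x y z ^ 2)"
    using assms(1) unfolding sum_of_quad_squares_def by (elim exE conjE)
  have "is_quad (\<lambda>x y z. sqrt c * q x y z)" if "is_quad q" for q
    using that
  proof (rule is_quadE)
    fix a b d e f g assume "\<And>x y z. q x y z = a * x^2 + b * y^2 + d * z^2 + e * x * y + f * x * z + g * y * z"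
    then show ?thesis
      by (intro is_quadI[of _ "sqrt c * a" "sqrt c * b" "sqrt c * d" "sqrt c * e" "sqrt c * f" "sqrt c * g"])
        (simp add: algebra_simps)
  qed
  then show ?thesis
    unfolding sum_of_quad_squares_def using p assms(2)
    by (intro exI[of _ m] exI[of _ "\<lambda>j x y z. sqrt c * p j x y z"])
      (auto simp: power_mult_distrib sum_distrib_left)
qed

lemma is_quartic_form: "is_quartic (quartic_form c)"
  unfolding is_quartic_def by (rule exI[of _ c]) (rule refl)

lemma quartic_form_add: "quartic_form (c + d) x y z = quartic_form c x y z + quartic_form d x y z"
  by (simp add: quartic_form_def case_prod_unfold algebra_simps)

lemma quartic_form_scale: "quartic_form (t *\<^sub>R c) x y z = t * quartic_form c x y z"
  by (simp add: quartic_form_def case_prod_unfold algebra_simps)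

lemma quartic_form_diff: "quartic_form (c - d) x y z = quartic_form c x y z - quartic_form d x y z"
  using quartic_form_add[of "c - d" d x y z] by simp

lemma continuous_on_quartic_form: "continuous_on S (\<lambda>c. quartic_form c x y z)"
  unfolding quartic_form_def case_prod_unfold by (intro continuous_intros)

text \<open>The points at which it evaluates are chosen so that a quartic form vanishing at all of them is zero.\<close>

definition quartic_mass :: "real15 \<Rightarrow> real" where
  "quartic_mass c = quartic_form c 1 0 0 + quartic_form c 0 1 0 + quartic_form c 0 0 1
    + quartic_form c 1 1 0 + quartic_form c 1 (-1) 0 + quartic_form c 2 1 0
    + quartic_form c 1 0 1 + quartic_form c 1 0 (-1) + quartic_form c 2 0 1
    + quartic_form c 0 1 1 + quartic_form c 0 1 (-1) + quartic_form c 0 2 1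
    + quartic_form c 1 1 1 + quartic_form c 1 1 (-1) + quartic_form c 1 (-1) 1"

lemma quartic_mass_add: "quartic_mass (c + d) = quartic_mass c + quartic_mass d"
  by (simp add: quartic_mass_def quartic_form_add)

lemma quartic_mass_scale: "quartic_mass (t *\<^sub>R c) = t * quartic_mass c"
  by (simp add: quartic_mass_def quartic_form_scale algebra_simps)

lemma quartic_mass_diff: "quartic_mass (c - d) = quartic_mass c - quartic_mass d"
  using quartic_mass_add[of "c - d" d] by simp

definition psd_quartics :: "real15 set" where
  "psd_quartics = {c. \<forall>x y z. quartic_form c x y z \<ge> 0}"

text \<open>If the sum is 0, every sampled value is 0. The axis points then kill the fourth powers,
  the three points in each coordinate plane the remaining monomials in two variables, and the last
  three points the monomials in all three.\<close>

lemma quartic_mass_pos: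
  assumes c: "c \<in> psd_quartics" "c \<noteq> 0"
  shows "quartic_mass c > 0"
proof (rule ccontr)
  assume neg: "\<not> quartic_mass c > 0"
  have nn: "quartic_form c x y z \<ge> 0" for x y z
    using c by (simp add: psd_quartics_def)
  obtain a1 a2 a3 a4 a5 a6 a7 a8 a9 a10 a11 a12 a13 a14 a15 where
    ceq: "c = (a1, a2, a3, a4, a5, a6, a7, a8, a9, a10, a11, a12, a13, a14, a15)"
    by (metis prod.collapse)
  have *: "quartic_form c 1 0 0 = 0" "quartic_form c 0 1 0 = 0" "quartic_form c 0 0 1 = 0"
    "quartic_form c 1 1 0 = 0" "quartic_form c 1 (-1) 0 = 0" "quartic_form c 2 1 0 = 0"
    "quartic_form c 1 0 1 = 0" "quartic_form c 1 0 (-1) = 0" "quartic_form c 2 0 1 = 0"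
    "quartic_form c 0 1 1 = 0" "quartic_form c 0 1 (-1) = 0" "quartic_form c 0 2 1 = 0"
    "quartic_form c 1 1 1 = 0" "quartic_form c 1 1 (-1) = 0" "quartic_form c 1 (-1) 1 = 0"
    using neg nn[of 1 0 0] nn[of 0 1 0] nn[of 0 0 1] nn[of 1 1 0] nn[of 1 "-1" 0] nn[of 2 1 0]
      nn[of 1 0 1] nn[of 1 0 "-1"] nn[of 2 0 1] nn[of 0 1 1] nn[of 0 1 "-1"] nn[of 0 2 1]
      nn[of 1 1 1] nn[of 1 1 "-1"] nn[of 1 "-1" 1]
    unfolding quartic_mass_def by linarith+
  have 1: "a1 = 0" "a11 = 0" "a15 = 0"
    using *(1-3) by (simp_all add: ceq quartic_form_def)
  have 2: "a2 = 0" "a4 = 0" "a7 = 0"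
    using *(4-6) by (simp_all add: ceq quartic_form_def 1)
  have 3: "a3 = 0" "a6 = 0" "a10 = 0"
    using *(7-9) by (simp_all add: ceq quartic_form_def 1)
  have 4: "a12 = 0" "a13 = 0" "a14 = 0"
    using *(10-12) by (simp_all add: ceq quartic_form_def 1)
  have 5: "a5 = 0" "a8 = 0" "a9 = 0"
    using *(13-15) by (simp_all add: ceq quartic_form_def 1 2 3 4)
  show False
    using c(2) by (simp add: ceq 1 2 3 4 5 zero_prod_def)
qed

lemma psd_quartics_closed: "closed psd_quartics"
proof -
  have "psd_quartics = (\<Inter>x. \<Inter>y. \<Inter>z. {c. 0 \<le> quartic_form c x y z})"
    by (auto simp: psd_quartics_def)
  moreover have "closed (\<Inter>x. \<Inter>y. \<Inter>z. {c. 0 \<le> quartic_form c x y z})"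
    by (intro closed_INT ballI closed_Collect_le continuous_on_quartic_form continuous_intros)
  ultimately show ?thesis by simp
qed

lemma psd_quartics_cone:
  "c \<in> psd_quartics \<Longrightarrow> d \<in> psd_quartics \<Longrightarrow> c + d \<in> psd_quartics"
  "c \<in> psd_quartics \<Longrightarrow> t \<ge> 0 \<Longrightarrow> t *\<^sub>R c \<in> psd_quartics"
  by (auto simp: psd_quartics_def quartic_form_add quartic_form_scale)

definition psd_base :: "real15 set" where
  "psd_base = {c \<in> psd_quartics. quartic_mass c = 1}"

lemma continuous_on_quartic_mass: "continuous_on S quartic_mass"
  unfolding quartic_mass_def by (intro continuous_intros continuous_on_quartic_form)

text \<open>On psd vectors of norm 1 the mass has a positive minimum, so a psd vector of mass 1 has
  norm at most its reciprocal.\<close>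

lemma psd_base_compact: "compact psd_base"
proof -
  have cl: "closed psd_base"
  proof -
    have "psd_base = psd_quartics \<inter> {c. quartic_mass c = 1}"
      by (auto simp: psd_base_def)
    moreover have "closed (psd_quartics \<inter> {c. quartic_mass c = 1})"
      by (intro closed_Int psd_quartics_closed closed_Collect_eq continuous_on_quartic_mass continuous_intros)
    ultimately show ?thesis by simp
  qed
  have "compact (sphere 0 1 \<inter> psd_quartics)"
    by (intro compact_Int_closed psd_quartics_closed) simp
  have "bounded psd_base"
  proof (cases "sphere 0 1 \<inter> psd_quartics = {}")
    case True
    have "c = 0" if "c \<in> psd_base" for c
    proof (rule ccontr)
      assume "c \<noteq> 0"
      with that have "(1 / norm c) *\<^sub>R c \<in> sphere 0 1 \<inter> psd_quartics"
        by (simp add: psd_base_def psd_quartics_cone)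
      with True show False by blast
    qed
    then have "psd_base \<subseteq> {0}" by blast
    then show ?thesis by (rule bounded_subset[rotated]) simp
  next
    case False
    obtain u where u: "u \<in> sphere 0 1 \<inter> psd_quartics"
        "\<And>c. c \<in> sphere 0 1 \<inter> psd_quartics \<Longrightarrow> quartic_mass u \<le> quartic_mass c"
      using continuous_attains_inf[OF \<open>compact _\<close> False continuous_on_quartic_mass] by metis
    have pos: "quartic_mass u > 0"
      using u(1) by (intro quartic_mass_pos) auto
    have "norm c \<le> 1 / quartic_mass u" if c: "c \<in> psd_base" for c
    proof (cases "c = 0")
      case False
      then have "(1 / norm c) *\<^sub>R c \<in> sphere 0 1 \<inter> psd_quartics"
        using c by (simp add: psd_base_def psd_quartics_cone)
      from u(2)[OF this] c have "quartic_mass u \<le> 1 / norm c"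
        by (simp only: quartic_mass_scale) (simp add: psd_base_def)
      then show ?thesis using pos False by (simp add: field_simps)
    qed (use pos in simp)
    then show ?thesis by (rule boundedI)
  qed
  with cl show ?thesis by (simp add: compact_eq_bounded_closed)
qed

lemma psd_base_convex: "convex psd_base"
proof (rule convexI)
  fix c d and u v :: real
  assume "c \<in> psd_base" "d \<in> psd_base" "0 \<le> u" "0 \<le> v" "u + v = 1"
  then show "u *\<^sub>R c + v *\<^sub>R d \<in> psd_base"
    unfolding psd_base_def mem_Collect_eq quartic_mass_add quartic_mass_scale
    by (intro conjI psd_quartics_cone) auto
qed

text \<open>If q^2 is dominated, c is a convex combination of the normalised coefficient vectors of
  q^2 and of the difference, both in the base. Extremality makes them coincide, so the form is a
  positive multiple of q^2.\<close>

lemma psd_base_extreme: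
  assumes "c extreme_point_of psd_base"
  shows "sum_of_quad_squares (quartic_form c)"
proof -
  have c: "c \<in> psd_quartics" "quartic_mass c = 1"
    using assms by (auto simp: extreme_point_of_def psd_base_def)
  have "\<exists>x y z. quartic_form c x y z \<noteq> 0"
  proof (rule ccontr)
    assume "\<not> ?thesis"
    then have "quartic_form c x y z = 0" for x y z by metis
    then show False using c(2) by (simp add: quartic_mass_def)
  qed
  then have "dominates_square (quartic_form c)"
    using c(1) by (intro psd_quartic_dominates is_quartic_form) (simp_all add: psd_quartics_def)
  then obtain q where q: "is_quad q" "\<exists>x y z. q x y z \<noteq> 0" "\<And>x y z. q x y z ^ 2 \<le> quartic_form c x y z"
    unfolding dominates_square_def by metis
  obtain d where d: "quartic_form d = (\<lambda>x y z. q x y z * q x y z)"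
    using is_quad_mult[OF q(1) q(1)] unfolding is_quartic_def by metis
  have dp: "d \<in> psd_quartics" "c - d \<in> psd_quartics"
    using q(3) by (auto simp: psd_quartics_def quartic_form_diff d power2_eq_square)
  have "d \<noteq> 0"
  proof
    assume "d = 0"
    then have "quartic_form d = (\<lambda>x y z. 0)"
      using quartic_form_scale[of 0 0] by (simp add: fun_eq_iff)
    then show False using q(2) d by (auto simp: fun_eq_iff)
  qed
  define s where "s = quartic_mass d"
  have s: "s > 0"
    unfolding s_def using dp(1) \<open>d \<noteq> 0\<close> by (rule quartic_mass_pos)
  have "c = (1 / s) *\<^sub>R d"
  proof (cases "c - d = 0")
    case True
    then have "c = d" by simp
    with c(2) have "s = 1" by (simp add: s_def)
    with \<open>c = d\<close> show ?thesis by simp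
  next
    case False
    then have "quartic_mass (c - d) > 0"
      using dp(2) by (intro quartic_mass_pos)
    then have s1: "1 - s > 0" by (simp add: quartic_mass_diff c s_def)
    define u where "u = (1 / s) *\<^sub>R d"
    define v where "v = (1 / (1 - s)) *\<^sub>R (c - d)"
    have u: "u \<in> psd_base"
      using dp s by (auto simp: psd_base_def u_def quartic_mass_scale s_def intro!: psd_quartics_cone)
    have v: "v \<in> psd_base"
      using dp s1 by (auto simp: psd_base_def v_def quartic_mass_scale quartic_mass_diff s_def c intro!: psd_quartics_cone)
    have cuv: "c = (1 - (1 - s)) *\<^sub>R u + (1 - s) *\<^sub>R v"
      using s s1 by (simp add: u_def v_def)
    have "c \<notin> open_segment u v"
      using assms u v by (auto simp: extreme_point_of_def)
    moreover have "c \<in> open_segment u v" if "u \<noteq> v"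
      unfolding in_segment using that cuv s s1 by (intro conjI exI[of _ "1 - s"]) simp_all
    ultimately have "u = v" by blast
    then have "c = u" using cuv by (simp add: scaleR_add_left[symmetric])
    then show ?thesis by (simp add: u_def)
  qed
  then have "quartic_form c = (\<lambda>x y z. (1 / s) * q x y z ^ 2)"
    by (simp add: fun_eq_iff quartic_form_scale d power2_eq_square)
  moreover have "sum_of_quad_squares (\<lambda>x y z. (1 / s) * q x y z ^ 2)"
    using s by (intro sum_of_quad_squares_scale sum_of_quad_squares_single[OF q(1)]) auto
  ultimately show ?thesis by simp
qed

theorem psd_quartic_sum_of_squares:
  fixes F :: "real \<Rightarrow> real \<Rightarrow> real \<Rightarrow> real"
  assumes nonneg: "\<And>x y z. F x y z \<ge> 0" and q: "is_quartic F"
  shows "sum_of_quad_squares F"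
proof (cases "\<exists>x y z. F x y z \<noteq> 0")
  case False
  then show ?thesis
    unfolding sum_of_quad_squares_def by (intro exI[of _ 0]) (auto simp: fun_eq_iff)
next
  case True
  obtain c where c: "F = quartic_form c"
    using q unfolding is_quartic_def by (elim exE)
  have "c \<in> psd_quartics"
    using nonneg by (simp add: psd_quartics_def c)
  moreover have "c \<noteq> 0"
    using True quartic_form_scale[of 0 0] by (auto simp: c)
  ultimately have m: "quartic_mass c > 0" by (rule quartic_mass_pos)
  define b where "b = (1 / quartic_mass c) *\<^sub>R c"
  have "b \<in> psd_base"
    using m \<open>c \<in> psd_quartics\<close> by (auto simp: b_def psd_base_def quartic_mass_scale intro!: psd_quartics_cone)
  also have "psd_base = convex hull {x. x extreme_point_of psd_base}"
    by (rule Krein_Milman_Minkowski[OF psd_base_compact psd_base_convex])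
  also have "\<dots> \<subseteq> {c. sum_of_quad_squares (quartic_form c)}"
  proof (rule hull_minimal)
    show "convex {c. sum_of_quad_squares (quartic_form c)}"
    proof (rule convexI)
      fix c d and u v :: real
      assume "c \<in> {c. sum_of_quad_squares (quartic_form c)}" "d \<in> {c. sum_of_quad_squares (quartic_form c)}"
        and uv: "0 \<le> u" "0 \<le> v"
      then have *: "sum_of_quad_squares (quartic_form c)" "sum_of_quad_squares (quartic_form d)" by simp_all
      have "quartic_form (u *\<^sub>R c + v *\<^sub>R d) = (\<lambda>x y z. u * quartic_form c x y z + v * quartic_form d x y z)"
        by (simp add: fun_eq_iff quartic_form_add quartic_form_scale)
      moreover have "sum_of_quad_squares (\<lambda>x y z. u * quartic_form c x y z + v * quartic_form d x y z)"
        using * uv by (intro sum_of_quad_squares_add sum_of_quad_squares_scale)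
      ultimately show "u *\<^sub>R c + v *\<^sub>R d \<in> {c. sum_of_quad_squares (quartic_form c)}"
        by simp
    qed
  qed (auto intro: psd_base_extreme)
  finally have "sum_of_quad_squares (quartic_form b)" by simp
  moreover have "F = (\<lambda>x y z. quartic_mass c * quartic_form b x y z)"
    using m by (simp add: c b_def fun_eq_iff quartic_form_scale)
  moreover have "sum_of_quad_squares (\<lambda>x y z. quartic_mass c * quartic_form b x y z)"
    using \<open>sum_of_quad_squares (quartic_form b)\<close> m by (intro sum_of_quad_squares_scale) simp_all
  ultimately show ?thesis
    by simp
qed

section \<open>Nonnegative polynomials that are sums of squares\<close>

lemma poly_attains_inf:
  fixes p :: "real poly"
  assumes nonneg: "\<And>x. poly p x \<ge> 0" and deg: "degree p > 0"
  obtains a where "\<And>x. poly p a \<le> poly p x"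
proof -
  have "filterlim (poly p) at_infinity at_infinity"
    using deg by (intro filterlim_poly_at_infinity)
  then have "\<forall>\<^sub>F x in at_infinity. poly p 0 + 1 \<le> norm (poly p x)"
    unfolding filterlim_at_infinity[OF order.refl] using nonneg[of 0] by auto
  then obtain B where B: "\<And>x. B \<le> norm x \<Longrightarrow> poly p 0 + 1 \<le> norm (poly p x)"
    unfolding eventually_at_infinity by blast
  \<comment> \<open>Taking the maximum with 0 keeps 0 in the interval, so the minimum there is at
    most p(0), below all values outside.\<close>
  define C where "C = max 0 B"
  obtain a where a: "a \<in> {-C..C}" "\<And>x. x \<in> {-C..C} \<Longrightarrow> poly p a \<le> poly p x"
    using continuous_attains_inf[of "{-C..C}" "poly p"] by (auto simp: C_def continuous_intros)
  have "poly p a \<le> poly p x" for x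
  proof (cases "x \<in> {-C..C}")
    case False
    then have "B \<le> norm x" by (auto simp: C_def)
    with B[OF this] nonneg[of x] a(2)[of 0] show ?thesis by (simp add: C_def)
  qed (rule a)
  then show ?thesis using that by blast
qed

lemma nonneg_at_of_nonneg_off:
  fixes p :: "real poly"
  assumes "\<And>x. x \<noteq> a \<Longrightarrow> poly p x \<ge> 0"
  shows "poly p a \<ge> 0"
proof -
  have "(\<lambda>t. poly p (a + t)) 0 \<ge> 0"
    by (rule nonneg_at_0_of_nonneg_off_0) (use assms in \<open>auto intro!: continuous_intros\<close>)
  then show ?thesis by simp
qed

lemma nonneg_poly_double_root:
  fixes p :: "real poly"
  assumes nonneg: "\<And>x. poly p x \<ge> 0" and "poly p a = 0"
  obtains q where "p = [:-a, 1:] ^ 2 * q" "\<And>x. poly q x \<ge> 0"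
proof -
  obtain r where r: "p = [:-a, 1:] * r"
    using assms(2) by (auto simp: poly_eq_0_iff_dvd elim: dvdE)
  have sign: "(x - a) * poly r x \<ge> 0" for x
    using nonneg[of x] by (simp add: r algebra_simps)
  have "poly r a = 0"
  proof -
    have "(\<lambda>t. poly r (a + \<bar>t\<bar>)) 0 \<ge> 0"
    proof (rule nonneg_at_0_of_nonneg_off_0)
      fix t :: real assume "t \<noteq> 0"
      then show "poly r (a + \<bar>t\<bar>) \<ge> 0" using sign[of "a + \<bar>t\<bar>"] by (simp add: zero_le_mult_iff)
    qed (auto intro!: continuous_intros)
    moreover have "(\<lambda>t. - poly r (a - \<bar>t\<bar>)) 0 \<ge> 0"
    proof (rule nonneg_at_0_of_nonneg_off_0)
      fix t :: real assume "t \<noteq> 0"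
      then show "- poly r (a - \<bar>t\<bar>) \<ge> 0" using sign[of "a - \<bar>t\<bar>"] by (simp add: mult_le_0_iff)
    qed (auto intro!: continuous_intros)
    ultimately show ?thesis by simp
  qed
  then obtain s where s: "r = [:-a, 1:] * s"
    by (auto simp: poly_eq_0_iff_dvd elim: dvdE)
  have p: "p = [:-a, 1:] ^ 2 * s"
    by (simp only: r s power2_eq_square mult.assoc)
  have off: "poly s x \<ge> 0" if "x \<noteq> a" for x
  proof -
    have "(x - a)^2 * poly s x \<ge> 0"
      using nonneg[of x] by (simp add: p)
    with that show ?thesis by (simp add: zero_le_mult_iff)
  qed
  have "poly s x \<ge> 0" for x
    using off nonneg_at_of_nonneg_off[of a s] by (cases "x = a") auto
  with p show ?thesis using that by blast
qed

lemma nonneg_poly_sum_of_squares: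
  fixes p :: "real poly"
  assumes "\<And>x. poly p x \<ge> 0"
  shows "\<exists>(m :: nat) q. p = (\<Sum>j<m. q j ^ 2)"
  using assms
proof (induction "degree p" arbitrary: p rule: less_induct)
  case less
  show ?case
  proof (cases "degree p = 0")
    case True
    then obtain c where c: "p = [:c:]" by (rule degree_eq_zeroE)
    with less.prems[of 0] have "p = [:sqrt c:] ^ 2"
      by (simp add: power2_eq_square)
    then show ?thesis
      by (intro exI[of _ "Suc 0"] exI[of _ "\<lambda>_. [:sqrt c:]"]) simp
  next
    case False
    obtain a where a: "\<And>x. poly p a \<le> poly p x"
      using poly_attains_inf[OF less.prems] False by blast
    define \<mu> where "\<mu> = poly p a"
    obtain r where r: "p - [:\<mu>:] = [:-a, 1:] ^ 2 * r" "\<And>x. poly r x \<ge> 0"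
      by (rule nonneg_poly_double_root[of "p - [:\<mu>:]" a]) (use a in \<open>auto simp: \<mu>_def\<close>)
    have "degree (p - [:\<mu>:]) = degree p"
      using degree_add_eq_left[of "[:- \<mu>:]" p] False
      by (simp add: diff_conv_add_uminus del: add_uminus_conv_diff)
    moreover have "r \<noteq> 0"
      using r(1) \<open>degree (p - [:\<mu>:]) = degree p\<close> False by auto
    then have "degree ([:-a, 1:] ^ 2 * r) = 2 + degree r"
      by (subst degree_mult_eq) (simp_all add: degree_power_eq)
    ultimately have "degree r < degree p"
      using r(1) by simp
    from less.hyps[OF this r(2)] obtain m :: nat and q where q: "r = (\<Sum>j<m. q j ^ 2)"
      by metis
    define q' where "q' j = (if j < m then [:-a, 1:] * q j else [:sqrt \<mu>:])" for j
    have "p = [:-a, 1:] ^ 2 * r + [:\<mu>:]"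
      using r(1) by (simp add: diff_eq_eq)
    also have "[:\<mu>:] = [:sqrt \<mu>:] ^ 2"
      using less.prems[of a] by (simp add: \<mu>_def power2_eq_square)
    also have "[:-a, 1:] ^ 2 * r + [:sqrt \<mu>:] ^ 2 = (\<Sum>j<Suc m. q' j ^ 2)"
    proof -
      have "q' j ^ 2 = [:-a, 1:] ^ 2 * q j ^ 2" if "j < m" for j
        using that by (simp only: q'_def if_True power_mult_distrib)
      then have "(\<Sum>j<m. q' j ^ 2) = [:-a, 1:] ^ 2 * (\<Sum>j<m. q j ^ 2)"
        by (simp only: sum_distrib_left) (rule sum.cong; simp only: lessThan_iff)
      moreover have "q' m = [:sqrt \<mu>:]"
        by (simp add: q'_def)
      ultimately show ?thesis
        by (simp only: q sum.lessThan_Suc)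
    qed
    finally show ?thesis by blast
  qed
qed

text \<open>With functions in place of formal polynomials, the roots of the squares can be given as
  ordinary expressions, and closure rules show that they are polynomials in n variables.\<close>

definition polyfun_in :: "nat \<Rightarrow> ((nat \<Rightarrow> real) \<Rightarrow> real) \<Rightarrow> bool" where
  "polyfun_in n f \<longleftrightarrow> (\<exists>p \<in> polys_in n. \<forall>x. eval_mpoly p x = f x)"

lemma polyfun_in_add: "polyfun_in n f \<Longrightarrow> polyfun_in n g \<Longrightarrow> polyfun_in n (\<lambda>x. f x + g x)"
  unfolding polyfun_in_def by (metis polys_in_add eval_mpoly_add)

lemma polyfun_in_mult: "polyfun_in n f \<Longrightarrow> polyfun_in n g \<Longrightarrow> polyfun_in n (\<lambda>x. f x * g x)"
  unfolding polyfun_in_def by (metis polys_in_mult eval_mpoly_mult)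

lemma polyfun_in_power: "polyfun_in n f \<Longrightarrow> polyfun_in n (\<lambda>x. f x ^ k)"
  unfolding polyfun_in_def by (metis polys_in_power eval_mpoly_power)

lemma polyfun_in_const: "polyfun_in n (\<lambda>x. c)"
  unfolding polyfun_in_def by (rule bexI[OF _ polys_in_single[of 0]]) auto

lemma polyfun_in_var: "i < n \<Longrightarrow> polyfun_in n (\<lambda>x. x i)"
  unfolding polyfun_in_def
  by (rule bexI[of _ "Poly_Mapping.single (Poly_Mapping.single i 1) 1"]) (auto simp: polys_in_def)

lemma polyfun_in_sum: "(\<And>i. i \<in> I \<Longrightarrow> polyfun_in n (f i)) \<Longrightarrow> polyfun_in n (\<lambda>x. \<Sum>i\<in>I. f i x)"
  by (induction I rule: infinite_finite_induct) (auto intro: polyfun_in_const polyfun_in_add)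

lemmas polyfun_in_intros = polyfun_in_add polyfun_in_mult polyfun_in_power polyfun_in_const polyfun_in_var polyfun_in_sum

lemma polyfun_in_poly: "i < n \<Longrightarrow> polyfun_in n (\<lambda>x. poly q (x i))"
  unfolding poly_altdef by (intro polyfun_in_intros)

lemma sos_polyfunI:
  assumes "\<And>j. j < (m::nat) \<Longrightarrow> polyfun_in n (f j)"
    and "\<And>x. eval_mpoly p x = (\<Sum>j<m. f j x ^ 2)"
  shows "sos n p"
proof -
  have "\<forall>j. \<exists>q. j < m \<longrightarrow> q \<in> polys_in n \<and> (\<forall>x. eval_mpoly q x = f j x)"
    using assms(1) unfolding polyfun_in_def by blast
  then obtain q where q: "\<And>j. j < m \<Longrightarrow> q j \<in> polys_in n" "\<And>j x. j < m \<Longrightarrow> eval_mpoly (q j) x = f j x"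
    by metis
  show ?thesis
    by (rule sosI[of m q]) (use q assms(2) in auto)
qed

lemma sos_if_nonneg_univariate:
  assumes p: "p \<in> polys_in 1" and nonneg: "nonneg_mpoly p"
  shows "sos 1 p"
proof -
  \<comment> \<open>Unit weights at the all-ones point restrict p to the diagonal, which loses
    nothing because p depends on variable 0 only.\<close>
  define P where "P = scale_poly (\<lambda>_. 1) p (\<lambda>_. 1)"
  have P: "poly P t = eval_mpoly p (\<lambda>_. t)" for t
    by (simp add: P_def poly_scale_poly)
  obtain m :: nat and q where q: "P = (\<Sum>j<m. q j ^ 2)"
    using nonneg_poly_sum_of_squares[of P] nonneg by (auto simp: P nonneg_mpoly_def)
  show ?thesis
  proof (rule sos_polyfunI)
    fix x
    have "eval_mpoly p x = poly P (x 0)"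
      unfolding P by (rule polys_in_eval_cong[OF p]) simp
    then show "eval_mpoly p x = (\<Sum>j<m. poly (q j) (x 0) ^ 2)"
      by (simp add: q poly_sum)
  qed (intro polyfun_in_poly, simp)
qed

section \<open>Nonnegative quadratic polynomials\<close>

lemma monom_degree_eq_sum:
  assumes "finite S" "Poly_Mapping.keys m \<subseteq> S"
  shows "monom_degree m = (\<Sum>i\<in>S. Poly_Mapping.lookup m i)"
  unfolding wt_const_1[symmetric] wt_superset[OF assms] by simp

lemma split_off_var:
  assumes "m \<noteq> 0"
  obtains i m' where "i \<in> Poly_Mapping.keys m" "m = Poly_Mapping.single i 1 + m'"
    "Poly_Mapping.keys m' \<subseteq> Poly_Mapping.keys m" "monom_degree m = Suc (monom_degree m')"
proof -
  obtain i where i: "i \<in> Poly_Mapping.keys m"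
    using assms by (metis keys_eq_empty all_not_in_conv poly_mapping_eqI lookup_zero in_keys_iff)
  define m' where "m' = m - Poly_Mapping.single i 1"
  have m: "m = Poly_Mapping.single i 1 + m'"
    using i by (intro poly_mapping_eqI)
      (auto simp: m'_def lookup_add lookup_minus lookup_single when_def in_keys_iff)
  have keys: "Poly_Mapping.keys m' \<subseteq> Poly_Mapping.keys m"
    by (subst m) (auto simp: keys_add_nat)
  let ?S = "Poly_Mapping.keys m"
  have "monom_degree m = (\<Sum>k\<in>?S. Poly_Mapping.lookup (Poly_Mapping.single i 1 + m') k)"
    by (subst m[symmetric]) (rule monom_degree_eq_sum; simp)
  also have "\<dots> = (\<Sum>k\<in>?S. if i = k then 1 else 0) + monom_degree m'"
    using keys by (simp add: lookup_add sum.distrib lookup_single when_def monom_degree_eq_sum[of ?S m'])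
  also have "(\<Sum>k\<in>?S. if i = k then 1 else (0::nat)) = 1"
    using i by simp
  finally show ?thesis using that i m keys by simp
qed

text \<open>A need not be symmetric, so a monomial x_i x_k is entered at a single position and
  addition is entrywise.\<close>

definition quadfun :: "nat \<Rightarrow> (nat \<Rightarrow> nat \<Rightarrow> real) \<Rightarrow> (nat \<Rightarrow> real) \<Rightarrow> real \<Rightarrow> (nat \<Rightarrow> real) \<Rightarrow> real" where
  "quadfun n A b c x = (\<Sum>i<n. \<Sum>k<n. A i k * (x i * x k)) + (\<Sum>i<n. b i * x i) + c"

lemma quadfun_add:
  "quadfun n A b c x + quadfun n A' b' c' x = quadfun n (\<lambda>i k. A i k + A' i k) (\<lambda>i. b i + b' i) (c + c') x"
  by (simp add: quadfun_def sum.distrib distrib_right)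

lemma quadfun_scale:
  "t * quadfun n A b c x = quadfun n (\<lambda>i k. t * A i k) (\<lambda>i. t * b i) (t * c) x"
  by (simp add: quadfun_def sum_distrib_left distrib_left mult.assoc)

lemma quadfun_monomial:
  assumes "monom_degree m \<le> 2" "Poly_Mapping.keys m \<subseteq> {..<n}"
  shows "\<exists>A b c. \<forall>x. pp_eval x m = quadfun n A b c x"
proof (cases "m = 0")
  case True
  then show ?thesis
    by (intro exI[of _ "\<lambda>_ _. 0"] exI[of _ "\<lambda>_. 0"] exI[of _ 1]) (simp add: quadfun_def)
next
  case False
  obtain i m' where m': "i \<in> Poly_Mapping.keys m" "m = Poly_Mapping.single i 1 + m'"
    "Poly_Mapping.keys m' \<subseteq> Poly_Mapping.keys m" "monom_degree m = Suc (monom_degree m')"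
    by (rule split_off_var[OF False])
  have i: "i < n" using m'(1) assms(2) by auto
  show ?thesis
  proof (cases "m' = 0")
    case True
    have "pp_eval x m = quadfun n (\<lambda>_ _. 0) (\<lambda>j. if j = i then 1 else 0) 0 x" for x
      using i by (simp add: quadfun_def m'(2) True if_distrib[of "\<lambda>a. a * _"] cong: if_cong)
    then show ?thesis by blast
  next
    case False
    obtain k m'' where m'': "k \<in> Poly_Mapping.keys m'" "m' = Poly_Mapping.single k 1 + m''"
      "monom_degree m' = Suc (monom_degree m'')"
      by (rule split_off_var[OF False])
    have k: "k < n" using m''(1) m'(3) assms(2) by auto
    have "m'' = 0"
    proof (rule ccontr)
      assume "m'' \<noteq> 0"
      then obtain m3 where "monom_degree m'' = Suc (monom_degree m3)"
        by (rule split_off_var)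
      then show False using assms(1) m'(4) m''(3) by simp
    qed
    have "pp_eval x m = quadfun n (\<lambda>j l. if j = i then if l = k then 1 else 0 else 0) (\<lambda>_. 0) 0 x" for x
    proof -
      have "(\<Sum>l<n. (if j = i then if l = k then 1 else 0 else 0) * (x j * x l)) = (if j = i then x i * x k else 0)" for j
        using k by (simp add: if_distrib[of "\<lambda>a. a * _"] cong: if_cong)
      then show ?thesis
        using i by (simp add: quadfun_def m'(2) m''(2) \<open>m'' = 0\<close> pp_eval_add)
    qed
    then show ?thesis by blast
  qed
qed

lemma eval_mpoly_quadfun:
  assumes "p \<in> polys_in n" "total_degree p \<le> 2"
  shows "\<exists>A b c. \<forall>x. eval_mpoly p x = quadfun n A b c x"
proof -
  have "\<exists>A b c. \<forall>x. (\<Sum>m\<in>K. Poly_Mapping.lookup p m * pp_eval x m) = quadfun n A b c x"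
    if "finite K" "K \<subseteq> Poly_Mapping.keys p" for K
    using that
  proof (induction K)
    case empty
    show ?case
      by (intro exI[of _ "\<lambda>_ _. 0"] exI[of _ "\<lambda>_. 0"] exI[of _ 0]) (simp add: quadfun_def)
  next
    case (insert m K)
    obtain A b c where 1: "\<forall>x. (\<Sum>m\<in>K. Poly_Mapping.lookup p m * pp_eval x m) = quadfun n A b c x"
      using insert by auto
    have "monom_degree m \<le> 2" "Poly_Mapping.keys m \<subseteq> {..<n}"
      using insert assms by (auto simp: total_degree_le_iff polys_in_def)
    then obtain A' b' c' where 2: "\<forall>x. pp_eval x m = quadfun n A' b' c' x"
      using quadfun_monomial by metis
    show ?case
      using insert 1 2 by (simp add: quadfun_scale quadfun_add) metis
  qed
  from this[of "Poly_Mapping.keys p"] show ?thesis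
    by (simp add: eval_mpoly_superset[OF _ order.refl])
qed

lemma nonneg_quadfun_sum_of_squares:
  assumes "\<And>x. quadfun n A b c x \<ge> 0"
  shows "\<exists>(m :: nat) L d. \<forall>x. quadfun n A b c x = (\<Sum>j<m. ((\<Sum>i<n. L j i * x i) + d j) ^ 2)"
  using assms
proof (induction n arbitrary: A b c)
  case 0
  from 0[of "\<lambda>_. 0"] have "c \<ge> 0" by (simp add: quadfun_def)
  then show ?case
    by (intro exI[of _ "Suc 0"] exI[of _ "\<lambda>_ _. 0"] exI[of _ "\<lambda>_. sqrt c"]) (simp add: quadfun_def)
next
  case (Suc n)
  define \<alpha> where "\<alpha> = A n n"
  define \<beta> where "\<beta> i = A i n + A n i" for i
  define l where "l x = (\<Sum>i<n. \<beta> i * x i) + b n" for x :: "nat \<Rightarrow> real"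
  have expand: "quadfun (Suc n) A b c x = \<alpha> * (x n)^2 + l x * x n + quadfun n A b c x" for x
    by (simp add: quadfun_def l_def \<alpha>_def \<beta>_def sum.distrib sum_distrib_left sum_distrib_right algebra_simps power2_eq_square)
  have upd: "l (x(n := t)) = l x" "quadfun n A' b' c' (x(n := t)) = quadfun n A' b' c' x" for x t A' b' c'
    by (simp_all add: l_def quadfun_def)
  have "\<alpha> * t^2 + l x * t + quadfun n A b c x \<ge> 0" for x t
    using Suc.prems[of "x(n := t)"] unfolding expand upd by simp
  note disc = nonneg_quadratic_discrim[OF this]
  show ?case
  proof (cases "\<alpha> = 0")
    case True
    have l0: "l x = 0" for x using disc(3)[of x] True by simp
    obtain m :: nat and L d where *: "\<forall>x. quadfun n A b c x = (\<Sum>j<m. ((\<Sum>i<n. L j i * x i) + d j) ^ 2)"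
      using Suc.IH[OF disc(2)] by (elim exE)
    show ?thesis
      by (intro exI[of _ m] exI[of _ "\<lambda>j i. if i < n then L j i else 0"] exI[of _ d])
        (use * in \<open>simp add: expand True l0\<close>)
  next
    case False
    with disc(1) have \<alpha>: "\<alpha> > 0" by auto
    \<comment> \<open>\<open>A'\<close>, \<open>b'\<close>, \<open>c'\<close> represent the
      quadratic in the first n variables minus l^2 / (4 \<alpha>), the Schur complement of the last
      variable. The form plus a negative multiple matches \<open>quadfun_scale\<close> and
      \<open>quadfun_add\<close>.\<close>
    define A' where "A' i k = A i k + (- 1 / (4 * \<alpha>)) * (\<beta> i * \<beta> k)" for i k
    define b' where "b' i = b i + (- 1 / (4 * \<alpha>)) * (2 * b n * \<beta> i)" for i
    define c' where "c' = c + (- 1 / (4 * \<alpha>)) * (b n)^2"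
    have l2: "(l x)^2 = quadfun n (\<lambda>i k. \<beta> i * \<beta> k) (\<lambda>i. 2 * b n * \<beta> i) ((b n)^2) x" for x
    proof -
      have "(\<Sum>i<n. \<beta> i * x i)^2 = (\<Sum>i<n. \<Sum>k<n. (\<beta> i * \<beta> k) * (x i * x k))"
        by (simp add: power2_eq_square sum_product mult_ac)
      then show ?thesis
        by (simp add: l_def quadfun_def power2_sum sum_distrib_left mult_ac)
    qed
    have Q': "quadfun n A' b' c' x = quadfun n A b c x + (- 1 / (4 * \<alpha>)) * (l x)^2" for x
      unfolding l2 quadfun_scale quadfun_add A'_def b'_def c'_def ..
    have "quadfun n A' b' c' x \<ge> 0" for x
      using disc(3)[of x] \<alpha> by (simp add: Q' divide_le_eq mult_ac)
    from Suc.IH[OF this] obtain m :: nat and L d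
      where *: "\<forall>x. quadfun n A' b' c' x = (\<Sum>j<m. ((\<Sum>i<n. L j i * x i) + d j) ^ 2)"
      by (elim exE)
    define s where "s = sqrt \<alpha>"
    have s: "s^2 = \<alpha>" "s > 0" using \<alpha> by (auto simp: s_def)
    define L' where "L' j i = (if j < m then if i < n then L j i else 0 else if i < n then \<beta> i / (2 * s) else s)" for j i
    define d' where "d' j = (if j < m then d j else b n / (2 * s))" for j
    have "quadfun (Suc n) A b c x = (\<Sum>j<Suc m. ((\<Sum>i<Suc n. L' j i * x i) + d' j) ^ 2)" for x
    proof -
      have "(\<Sum>i<n. \<beta> i / (2 * s) * x i) + s * x n + b n / (2 * s) = s * x n + l x / (2 * s)"
        by (simp add: l_def add_divide_distrib sum_divide_distrib)
      then have "(\<Sum>i<Suc n. L' m i * x i) + d' m = s * x n + l x / (2 * s)"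
        by (simp add: L'_def d'_def)
      then have "((\<Sum>i<Suc n. L' m i * x i) + d' m) ^ 2 = (s * x n + l x / (2 * s))^2"
        by (rule arg_cong)
      also have "\<dots> = s^2 * (x n)^2 + l x * x n + (1 / (4 * s^2)) * (l x)^2"
        using s(2) by (simp add: power2_eq_square field_simps)
      finally show ?thesis
        using *[rule_format, of x] Q'[of x] unfolding expand s(1) sum.lessThan_Suc[of _ m]
        by (simp add: L'_def d'_def)
    qed
    then show ?thesis by (intro exI allI)
  qed
qed

lemma sos_if_nonneg_quadratic:
  assumes p: "p \<in> polys_in n" "total_degree p \<le> 2" and nonneg: "nonneg_mpoly p"
  shows "sos n p"
proof -
  obtain A b c where eq: "\<forall>x. eval_mpoly p x = quadfun n A b c x"
    using eval_mpoly_quadfun[OF p] by metis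
  have "quadfun n A b c x \<ge> 0" for x
    using eq nonneg by (simp add: nonneg_mpoly_def)
  from nonneg_quadfun_sum_of_squares[OF this] obtain m :: nat and L d
    where *: "\<forall>x. quadfun n A b c x = (\<Sum>j<m. ((\<Sum>i<n. L j i * x i) + d j) ^ 2)"
    by (elim exE)
  show ?thesis
  proof (rule sos_polyfunI)
    show "eval_mpoly p x = (\<Sum>j<m. ((\<Sum>i<n. L j i * x i) + d j) ^ 2)" for x
      using eq * by simp
  qed (intro polyfun_in_intros, simp)
qed

section \<open>Bivariate quartics by homogenisation\<close>

lemma is_quartic_monomial:
  assumes "i + j + k = 4"
  shows "is_quartic (\<lambda>x y z. c * (x^i * y^j * z^k))"
proof -
  have "(i, j) \<in> {(4,0),(3,1),(3,0),(2,2),(2,1),(2,0),(1,3),(1,2),(1,1),(1,0),(0,4),(0,3),(0,2),(0,1),(0,0)}"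
    and k: "k = 4 - i - j"
  proof -
    have "i = 0 \<or> i = 1 \<or> i = 2 \<or> i = 3 \<or> i = 4" "j = 0 \<or> j = 1 \<or> j = 2 \<or> j = 3 \<or> j = 4"
      using assms by presburger+
    then show "(i, j) \<in> {(4,0),(3,1),(3,0),(2,2),(2,1),(2,0),(1,3),(1,2),(1,1),(1,0),(0,4),(0,3),(0,2),(0,1),(0,0)}"
      using assms by (elim disjE) simp_all
    show "k = 4 - i - j"
      using assms by simp
  qed
  then show ?thesis
    by (intro is_quarticI[where ?a1.0 = "if (i,j)=(4,0) then c else 0" and ?a2.0 = "if (i,j)=(3,1) then c else 0"
      and ?a3.0 = "if (i,j)=(3,0) then c else 0" and ?a4.0 = "if (i,j)=(2,2) then c else 0"
      and ?a5.0 = "if (i,j)=(2,1) then c else 0" and ?a6.0 = "if (i,j)=(2,0) then c else 0"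
      and ?a7.0 = "if (i,j)=(1,3) then c else 0" and ?a8.0 = "if (i,j)=(1,2) then c else 0"
      and ?a9.0 = "if (i,j)=(1,1) then c else 0" and ?a10.0 = "if (i,j)=(1,0) then c else 0"
      and ?a11.0 = "if (i,j)=(0,4) then c else 0" and ?a12.0 = "if (i,j)=(0,3) then c else 0"
      and ?a13.0 = "if (i,j)=(0,2) then c else 0" and ?a14.0 = "if (i,j)=(0,1) then c else 0"
      and ?a15.0 = "if (i,j)=(0,0) then c else 0"]) auto
qed

lemma is_quartic_sum:
  assumes "finite I" "\<And>i. i \<in> I \<Longrightarrow> is_quartic (f i)"
  shows "is_quartic (\<lambda>x y z. \<Sum>i\<in>I. f i x y z)"
  using assms
proof (induction I)
  case empty
  then show ?case
    using is_quarticI[of "\<lambda>x y z. 0" 0 0 0 0 0 0 0 0 0 0 0 0 0 0 0] by simp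
next
  case (insert i I)
  then show ?case by (simp add: is_quartic_add)
qed

lemma is_quartic_homogeneous:
  assumes "is_quartic F" shows "F (t * x) (t * y) (t * z) = t^4 * F x y z"
  using assms
proof (rule is_quarticE)
  fix a1 a2 a3 a4 a5 a6 a7 a8 a9 a10 a11 a12 a13 a14 a15
  assume F: "\<And>x y z. F x y z = a1 * x^4 + a2 * x^3 * y + a3 * x^3 * z + a4 * x^2 * y^2 + a5 * x^2 * y * z + a6 * x^2 * z^2
     + a7 * x * y^3 + a8 * x * y^2 * z + a9 * x * y * z^2 + a10 * x * z^3
     + a11 * y^4 + a12 * y^3 * z + a13 * y^2 * z^2 + a14 * y * z^3 + a15 * z^4"
  show ?thesis unfolding F by algebra
qed

lemma is_quartic_isCont:
  assumes "is_quartic F" shows "isCont (\<lambda>t. F x y t) a"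
  using assms unfolding is_quartic_def quartic_form_def
  by (auto simp: case_prod_unfold intro!: continuous_intros)

text \<open>The homogenisation F is nonnegative for z nonzero by scaling and on z = 0 by continuity.
  The quadratic forms obtained for F are specialised at z = 1.\<close>

lemma sos_if_nonneg_bivariate_quartic:
  assumes p: "p \<in> polys_in 2" "total_degree p \<le> 4" and nonneg: "nonneg_mpoly p"
  shows "sos 2 p"
proof -
  define F where "F x y z = (\<Sum>m\<in>Poly_Mapping.keys p. Poly_Mapping.lookup p m *
    (x ^ Poly_Mapping.lookup m 0 * y ^ Poly_Mapping.lookup m 1 * z ^ (4 - Poly_Mapping.lookup m 0 - Poly_Mapping.lookup m 1)))" for x y z
  have keys: "Poly_Mapping.keys m \<subseteq> {..<2}" if "m \<in> Poly_Mapping.keys p" for m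
    using that p by (auto simp: polys_in_def)
  have two: "{..<2} = {0, 1::nat}" by auto
  have deg: "Poly_Mapping.lookup m 0 + Poly_Mapping.lookup m 1 \<le> 4" if "m \<in> Poly_Mapping.keys p" for m
    using p(2) that monom_degree_eq_sum[of "{..<2}" m] keys[OF that] by (auto simp: total_degree_le_iff two)
  have qF: "is_quartic F"
    unfolding F_def using deg by (intro is_quartic_sum is_quartic_monomial) auto
  have F1: "F (x 0) (x 1) 1 = eval_mpoly p x" for x
    unfolding F_def eval_mpoly_superset[OF finite_keys order.refl]
    by (intro sum.cong refl arg_cong2[where f = "(*)"]) (use keys in \<open>simp add: pp_eval_superset[of "{..<2}"] two\<close>)
  have F1': "F x y 1 = eval_mpoly p (\<lambda>i. if i = 0 then x else y)" for x y
    using F1[of "\<lambda>i. if i = 0 then x else y"] by simp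
  have off: "F x y z \<ge> 0" if "z \<noteq> 0" for x y z
  proof -
    have "F x y z = z^4 * F (x / z) (y / z) 1"
      using is_quartic_homogeneous[OF qF, of z "x / z" "y / z" 1] that by simp
    then show ?thesis
      using nonneg by (simp add: F1' nonneg_mpoly_def)
  qed
  have "F x y z \<ge> 0" for x y z
    using off nonneg_at_0_of_nonneg_off_0[OF is_quartic_isCont[OF qF], of x y] by (cases "z = 0") auto
  from psd_quartic_sum_of_squares[OF this qF] obtain m :: nat and q
    where q: "\<forall>j<m. is_quad (q j)" "F = (\<lambda>x y z. \<Sum>j<m. q j x y z ^ 2)"
    unfolding sum_of_quad_squares_def by (elim exE conjE)
  show ?thesis
  proof (rule sos_polyfunI)
    show "eval_mpoly p x = (\<Sum>j<m. q j (x 0) (x 1) 1 ^ 2)" for x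
      using F1[of x] q(2) by simp
  next
    fix j assume "j < m"
    then have "is_quad (q j)" using q(1) by simp
    then show "polyfun_in 2 (\<lambda>x. q j (x 0) (x 1) 1)"
    proof (rule is_quadE)
      fix a b c d e f
      assume "\<And>x y z. q j x y z = a * x^2 + b * y^2 + c * z^2 + d * x * y + e * x * z + f * y * z"
      then show ?thesis
        by (simp only:) (intro polyfun_in_intros; simp)
    qed
  qed
qed

section \<open>A counterexample in three variables of degree four\<close>

definition univ_mpoly :: "nat \<Rightarrow> real poly \<Rightarrow> rmpoly" where
  "univ_mpoly i q = (\<Sum>k\<le>degree q. Poly_Mapping.single (Poly_Mapping.single i k) (coeff q k))"

lemma eval_univ_mpoly [simp]: "eval_mpoly (univ_mpoly i q) x = poly q (x i)"
  by (simp add: univ_mpoly_def poly_altdef)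

lemma keys_univ_mpoly:
  "Poly_Mapping.keys (univ_mpoly i q) \<subseteq> Poly_Mapping.single i ` {..degree q}"
proof
  fix m assume "m \<in> Poly_Mapping.keys (univ_mpoly i q)"
  then have "(\<Sum>k\<le>degree q. Poly_Mapping.lookup (Poly_Mapping.single (Poly_Mapping.single i k) (coeff q k)) m) \<noteq> 0"
    by (simp add: univ_mpoly_def in_keys_iff lookup_sum)
  then obtain k where "k \<le> degree q"
      "Poly_Mapping.lookup (Poly_Mapping.single (Poly_Mapping.single i k) (coeff q k)) m \<noteq> 0"
    by (rule sum.not_neutral_contains_not_neutral) simp
  then show "m \<in> Poly_Mapping.single i ` {..degree q}"
    by (auto simp: lookup_single when_def split: if_splits)
qed

lemma univ_mpoly_in_polys_in: "i < n \<Longrightarrow> univ_mpoly i q \<in> polys_in n"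
  unfolding univ_mpoly_def by (intro polys_in_sum polys_in_single) (auto split: if_splits)

lemma keys_sum_rmpoly:
  fixes f :: "'a \<Rightarrow> rmpoly"
  shows "Poly_Mapping.keys (sum f I) \<subseteq> (\<Union>i\<in>I. Poly_Mapping.keys (f i))"
proof
  fix m assume "m \<in> Poly_Mapping.keys (sum f I)"
  then have "(\<Sum>i\<in>I. Poly_Mapping.lookup (f i) m) \<noteq> 0"
    by (simp add: in_keys_iff lookup_sum)
  then obtain i where "i \<in> I" "Poly_Mapping.lookup (f i) m \<noteq> 0"
    by (rule sum.not_neutral_contains_not_neutral)
  then show "m \<in> (\<Union>i\<in>I. Poly_Mapping.keys (f i))"
    by (auto simp: in_keys_iff)
qed

lemma single_nat_eq_iff:
  "Poly_Mapping.single i (a :: nat) = Poly_Mapping.single j b \<longleftrightarrow> a = 0 \<and> b = 0 \<or> i = j \<and> a = b"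
proof
  assume *: "Poly_Mapping.single i a = Poly_Mapping.single j b"
  then have "Poly_Mapping.lookup (Poly_Mapping.single i a) i = Poly_Mapping.lookup (Poly_Mapping.single j b) i"
    "Poly_Mapping.lookup (Poly_Mapping.single i a) j = Poly_Mapping.lookup (Poly_Mapping.single j b) j"
    by simp_all
  then show "a = 0 \<and> b = 0 \<or> i = j \<and> a = b"
    by (auto simp: lookup_single when_def split: if_splits)
qed auto

lemma lookup_univ_mpoly:
  assumes "k > 0"
  shows "Poly_Mapping.lookup (univ_mpoly i q) (Poly_Mapping.single j k) = (if i = j then coeff q k else 0)"
proof (cases "i = j")
  case True
  have "Poly_Mapping.lookup (univ_mpoly i q) (Poly_Mapping.single j k) = (\<Sum>l\<le>degree q. if l = k then coeff q l else 0)"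
    using assms True by (simp add: univ_mpoly_def lookup_sum lookup_single when_def single_nat_eq_iff)
  then show ?thesis using True by (simp add: coeff_eq_0 not_le)
next
  case False
  then show ?thesis
    using assms by (simp add: univ_mpoly_def lookup_sum lookup_single when_def single_nat_eq_iff)
qed

lemma monom_degree_single [simp]: "monom_degree (Poly_Mapping.single i k) = k"
  by (cases "k = 0") (simp_all add: monom_degree_def)

lemma spq_separable_plus_quadratic:
  assumes q: "q \<in> polys_in n" "total_degree q \<le> 2"
    and p: "p = (\<Sum>i<n. univ_mpoly i (s i)) + q"
  shows "spq n p"
  unfolding spq_def
  by (intro conjI exI[of _ s] exI[of _ q]) (use q in \<open>auto simp: p intro!: univ_mpoly_in_polys_in\<close>)

lemma total_degree_separable_plus_quadratic:
  assumes q: "total_degree q \<le> 2" and p: "p = (\<Sum>i<n. univ_mpoly i (s i)) + q"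
    and deg: "\<And>i. i < n \<Longrightarrow> degree (s i) \<le> d" "coeff (s 0) d \<noteq> 0" "0 < n" "2 < d"
  shows "total_degree p = d"
proof (rule antisym)
  show "total_degree p \<le> d"
    unfolding total_degree_le_iff
  proof
    fix m assume "m \<in> Poly_Mapping.keys p"
    then have "m \<in> (\<Union>i<n. Poly_Mapping.keys (univ_mpoly i (s i))) \<union> Poly_Mapping.keys q"
      using keys_add[of "\<Sum>i<n. univ_mpoly i (s i)" q] keys_sum_rmpoly[of "\<lambda>i. univ_mpoly i (s i)" "{..<n}"]
      unfolding p by blast
    then show "monom_degree m \<le> d"
    proof
      assume "m \<in> Poly_Mapping.keys q"
      then show ?thesis using q deg(4) by (force simp: total_degree_le_iff)
    next
      assume "m \<in> (\<Union>i<n. Poly_Mapping.keys (univ_mpoly i (s i)))"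
      then obtain i k where "i < n" "k \<le> degree (s i)" "m = Poly_Mapping.single i k"
        using keys_univ_mpoly by force
      then show ?thesis using deg(1)[of i] by simp
    qed
  qed
  have "Poly_Mapping.lookup q (Poly_Mapping.single 0 d) = 0"
    using q deg(4) by (force simp: total_degree_le_iff in_keys_iff)
  then have "Poly_Mapping.lookup p (Poly_Mapping.single 0 d) = coeff (s 0) d"
    using deg(3,4) by (simp add: p lookup_add lookup_sum lookup_univ_mpoly)
  then have "Poly_Mapping.single 0 d \<in> Poly_Mapping.keys p"
    using deg(2) by (simp add: in_keys_iff)
  then have "monom_degree (Poly_Mapping.single 0 d) \<le> total_degree p"
    using total_degree_le_iff[of p "total_degree p"] by blast
  then show "d \<le> total_degree p" by simp
qed

lemma spq_mono:
  assumes "spq k p" "k \<le> n"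
  shows "spq n p"
proof -
  obtain s q where *: "p \<in> polys_in k" "q \<in> polys_in k" "total_degree q \<le> 2"
    "\<And>x. eval_mpoly p x = (\<Sum>i<k. poly (s i) (x i)) + eval_mpoly q x"
    using assms(1) unfolding spq_def by metis
  define s' where "s' i = (if i < k then s i else 0)" for i
  have "(\<Sum>i<n. poly (s' i) (x i)) = (\<Sum>i<k. poly (s i) (x i))" for x
    by (rule sum.mono_neutral_cong_right) (use assms(2) in \<open>auto simp: s'_def\<close>)
  then show ?thesis
    unfolding spq_def using * polys_in_mono[OF assms(2)]
    by (intro conjI exI[of _ s'] exI[of _ q]) auto
qed

lemma quartic_coeffs_zero:
  fixes e0 e1 e2 e3 e4 :: real
  assumes "\<And>t. e0 + e1 * t + e2 * t^2 + e3 * t^3 + e4 * t^4 = 0"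
  shows "e0 = 0" "e1 = 0" "e2 = 0" "e3 = 0" "e4 = 0"
  using assms[of 0] assms[of 1] assms[of "-1"] assms[of 2] assms[of "-2"] by simp_all

text \<open>Given the leading form and equal coefficients for the squares and for the products, a
  vanishing gradient at (2, 2, -3) forces -2 and 24, and a vanishing value there forces 113. The
  constant is split evenly over the three univariate parts.\<close>

definition quartic3 :: rmpoly where
  "quartic3 = (\<Sum>i<3. univ_mpoly i [:113/3, 0, -2, 0, 1:]) +
    (Poly_Mapping.single (Poly_Mapping.single 0 1 + Poly_Mapping.single 1 1) 24 +
     Poly_Mapping.single (Poly_Mapping.single 0 1 + Poly_Mapping.single 2 1) 24 +
     Poly_Mapping.single (Poly_Mapping.single 1 1 + Poly_Mapping.single 2 1) 24)"

lemma lessThan_3: "{..<3} = {0, 1, 2::nat}"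
  by auto

lemma eval_quartic3:
  "eval_mpoly quartic3 x = x 0 ^ 4 + x 1 ^ 4 + x 2 ^ 4 - 2 * (x 0 ^ 2 + x 1 ^ 2 + x 2 ^ 2)
     + 24 * (x 0 * x 1 + x 0 * x 2 + x 1 * x 2) + 113"
  by (simp add: quartic3_def lessThan_3 pp_eval_add algebra_simps power2_eq_square power4_eq_xxxx)

lemma total_degree_single_le:
  "monom_degree m \<le> k \<Longrightarrow> total_degree (Poly_Mapping.single m c) \<le> k"
  by (simp add: total_degree_le_iff)

lemma total_degree_add_le:
  "total_degree p \<le> k \<Longrightarrow> total_degree q \<le> k \<Longrightarrow> total_degree (p + q) \<le> k"
  using keys_add[of p q] unfolding total_degree_le_iff by blast

lemma monom_degree_add [simp]: "monom_degree (m + m') = monom_degree m + monom_degree m'"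
proof -
  let ?S = "Poly_Mapping.keys m \<union> Poly_Mapping.keys m'"
  show ?thesis
    by (simp add: monom_degree_eq_sum[of ?S] keys_add_nat lookup_add sum.distrib)
qed

lemma quartic3_N_SPQ:
  assumes "n \<ge> 3"
  shows "quartic3 \<in> N_SPQ n 4"
proof -
  have q: "total_degree (Poly_Mapping.single (Poly_Mapping.single 0 1 + Poly_Mapping.single 1 1) 24 +
     Poly_Mapping.single (Poly_Mapping.single 0 1 + Poly_Mapping.single 2 1) 24 +
     Poly_Mapping.single (Poly_Mapping.single 1 1 + Poly_Mapping.single 2 1) (24::real)) \<le> 2"
    by (intro total_degree_add_le total_degree_single_le) simp_all
  have "spq 3 quartic3"
    by (rule spq_separable_plus_quadratic[OF _ q quartic3_def])
      (intro polys_in_add polys_in_single; simp add: keys_add_nat)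
  then have "spq n quartic3"
    by (rule spq_mono) fact
  moreover have "total_degree quartic3 = 4"
    by (rule total_degree_separable_plus_quadratic[OF q quartic3_def]) (simp_all add: numeral_eq_Suc)
  moreover have "nonneg_mpoly quartic3"
    unfolding nonneg_mpoly_def
  proof
    fix x :: "nat \<Rightarrow> real"
    \<comment> \<open>Two of any three reals have a nonnegative product; they are named a and b. The
      polynomial is then (3 (a + b) + 4 c)^2 + (c^2 - 9)^2 plus a polynomial in N and m. All three
      summands vanish at a = b = 2, c = -3, where N = 8 and m = 4.\<close>
    have main: "a^4 + b^4 + c^4 - 2 * (a^2 + b^2 + c^2) + 24 * (a * b + a * c + b * c) + 113 \<ge> 0"
      if ab: "a * b \<ge> 0" for a b c :: real
    proof -
      define N m where "N = a^2 + b^2" and "m = a * b"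
      have N: "N - 2 * m \<ge> 0"
        using zero_le_power2[of "a - b"] by (simp add: N_def m_def power2_diff)
      \<comment> \<open>Since N - 2 m = (a - b)^2, the first case is a sum of nonnegative terms. In
        the second case 4 m <= N + 2 m < 6, so m lies between 0 and 3.\<close>
      have nn: "N^2 - 2 * m^2 - 11 * N + 6 * m + 32 \<ge> 0"
      proof (cases "N + 2 * m \<ge> 6")
        case True
        then have "(N - 2 * m) * (N + 2 * m - 6) \<ge> 0" using N by simp
        moreover have eq: "2 * (N^2 - 2 * m^2 - 11 * N + 6 * m + 32) = (N - 8)^2 + (N - 2 * m) * (N + 2 * m - 6)"
          by algebra
        ultimately have "0 \<le> 2 * (N^2 - 2 * m^2 - 11 * N + 6 * m + 32)"
          unfolding eq by (intro add_nonneg_nonneg) simp_all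
        then show ?thesis
          by (simp only: zero_le_mult_iff) simp
      next
        case False
        then have "m * (3 - m) \<ge> 0" using N ab by (simp add: m_def)
        moreover have "N^2 - 11 * N + 32 \<ge> 0"
          using zero_le_power2[of "N - 11/2"] by (simp add: power2_eq_square algebra_simps)
        ultimately show ?thesis by (simp add: power2_eq_square algebra_simps)
      qed
      have eq: "a^4 + b^4 + c^4 - 2 * (a^2 + b^2 + c^2) + 24 * (a * b + a * c + b * c) + 113
        = (3 * (a + b) + 4 * c)^2 + (c^2 - 9)^2 + (N^2 - 2 * m^2 - 11 * N + 6 * m + 32)"
        unfolding N_def m_def by algebra
      show ?thesis
        unfolding eq by (intro add_nonneg_nonneg zero_le_power2 nn)
    qed
    have "x 0 * x 1 \<ge> 0 \<or> x 0 * x 2 \<ge> 0 \<or> x 1 * x 2 \<ge> 0"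
      by (auto simp: zero_le_mult_iff)
    then show "eval_mpoly quartic3 x \<ge> 0"
      using main[of "x 0" "x 1" "x 2"] main[of "x 0" "x 2" "x 1"] main[of "x 1" "x 2" "x 0"]
      by (auto simp: eval_quartic3 algebra_simps)
  qed
  ultimately show ?thesis by (simp add: N_SPQ_def)
qed

text \<open>By \<open>eq\<close> each form is \<tau> (x^2 + y^2 + z^2) + d (x y - 2 z^2) + e (x z -
  2 y^2) + f (y z - 2 x^2). Comparing coefficients determines the Gram matrix of the vectors \<tau>,
  d, e, f completely: T = 13/5, D = E = F = 6/5, Td = Te = Tf = 8/5, de = df = ef = 4/5. It is not
  positive semidefinite.\<close>

lemma quartic3_gram_infeasible:
  fixes a b c d e f :: "nat \<Rightarrow> real"
  assumes lead: "\<And>x y z. (\<Sum>j<m. (a j * x^2 + b j * y^2 + c j * z^2 + d j * (x * y) + e j * (x * z) + f j * (y * z))^2)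
      = x^4 + y^4 + z^4"
    and eq: "\<And>j. j < m \<Longrightarrow> b j = a j + 2 * f j - 2 * e j" "\<And>j. j < m \<Longrightarrow> c j = a j + 2 * f j - 2 * d j"
  shows False
proof -
  define \<tau> where "\<tau> j = a j + 2 * f j" for j
  define T where "T = (\<Sum>j<m. \<tau> j ^ 2)"
  define Td where "Td = (\<Sum>j<m. \<tau> j * d j)"
  define Te where "Te = (\<Sum>j<m. \<tau> j * e j)"
  define Tf where "Tf = (\<Sum>j<m. \<tau> j * f j)"
  define D where "D = (\<Sum>j<m. d j ^ 2)"
  define E where "E = (\<Sum>j<m. e j ^ 2)"
  define F where "F = (\<Sum>j<m. f j ^ 2)"
  define de where "de = (\<Sum>j<m. d j * e j)"
  define df where "df = (\<Sum>j<m. d j * f j)"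
  define ef where "ef = (\<Sum>j<m. e j * f j)"
  have expand: "(\<Sum>j<m. (s * \<tau> j + u * d j + v * e j + w * f j)^2) =
     s^2 * T + u^2 * D + v^2 * E + w^2 * F + 2 * s * u * Td + 2 * s * v * Te + 2 * s * w * Tf
     + 2 * u * v * de + 2 * u * w * df + 2 * v * w * ef" for s u v w
  proof -
    have "(s * \<tau> j + u * d j + v * e j + w * f j)^2 =
     s^2 * \<tau> j ^ 2 + u^2 * d j ^ 2 + v^2 * e j ^ 2 + w^2 * f j ^ 2 + 2 * s * u * (\<tau> j * d j) + 2 * s * v * (\<tau> j * e j)
     + 2 * s * w * (\<tau> j * f j) + 2 * u * v * (d j * e j) + 2 * u * w * (d j * f j) + 2 * v * w * (e j * f j)" for j
      by algebra
    then show ?thesis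
      by (simp add: T_def Td_def Te_def Tf_def D_def E_def F_def de_def df_def ef_def sum.distrib sum_distrib_left)
  qed
  have G: "(x^2 + y^2 + z^2)^2 * T + (x * y - 2 * z^2)^2 * D + (x * z - 2 * y^2)^2 * E + (y * z - 2 * x^2)^2 * F
     + 2 * (x^2 + y^2 + z^2) * (x * y - 2 * z^2) * Td + 2 * (x^2 + y^2 + z^2) * (x * z - 2 * y^2) * Te
     + 2 * (x^2 + y^2 + z^2) * (y * z - 2 * x^2) * Tf
     + 2 * (x * y - 2 * z^2) * (x * z - 2 * y^2) * de + 2 * (x * y - 2 * z^2) * (y * z - 2 * x^2) * df
     + 2 * (x * z - 2 * y^2) * (y * z - 2 * x^2) * ef = x^4 + y^4 + z^4" for x y z
    unfolding lead[of x y z, symmetric] expand[symmetric]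
  proof (rule sum.cong)
    fix j assume "j \<in> {..<m}"
    then have "b j = a j + 2 * f j - 2 * e j" "c j = a j + 2 * f j - 2 * d j"
      using eq by auto
    then show "((x^2 + y^2 + z^2) * \<tau> j + (x * y - 2 * z^2) * d j + (x * z - 2 * y^2) * e j + (y * z - 2 * x^2) * f j)^2
      = (a j * x^2 + b j * y^2 + c j * z^2 + d j * (x * y) + e j * (x * z) + f j * (y * z))^2"
      unfolding \<tau>_def by algebra
  qed simp
  \<comment> \<open>The forced Gram matrix takes the value -3/5 at the vector (3, -2, -2, -2). The
    instances of \<open>G\<close> below supply the coefficient comparison.\<close>
  have "0 \<le> (\<Sum>j<m. (3 * \<tau> j + (-2) * d j + (-2) * e j + (-2) * f j)^2)"
    by (intro sum_nonneg) simp
  then have "0 \<le> 9 * T + 4 * D + 4 * E + 4 * F - 12 * Td - 12 * Te - 12 * Tf + 8 * de + 8 * df + 8 * ef"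
    unfolding expand by simp
  then show False
    using G[of 1 0 0, simplified]
      G[of 0 1 0, simplified]
      G[of 0 0 1, simplified]
      G[of 1 1 0, simplified]
      G[of 1 "-1" 0, simplified]
      G[of 1 0 1, simplified]
      G[of 1 0 "-1", simplified]
      G[of 0 1 1, simplified]
      G[of 0 1 "-1", simplified]
      G[of 2 1 0, simplified]
      G[of 2 0 1, simplified]
      G[of 0 2 1, simplified]
      G[of 1 1 1, simplified]
      G[of 1 1 "-1", simplified]
      G[of 1 "-1" 1, simplified]
      G[of "-1" 1 1, simplified]
    by linarith
qed

lemma quartic3_not_sos: "\<not> sos n quartic3"
proof
  assume *: "sos n quartic3"
  have in3: "quartic3 \<in> polys_in 3" and deg: "total_degree quartic3 = 4"
    using quartic3_N_SPQ[of 3] by (simp_all add: N_SPQ_def spq_def)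
  have "sos 3 quartic3"
    using * in3 by (rule sos_fewer_vars)
  then obtain m :: nat and q where q: "\<And>j. j < m \<Longrightarrow> q j \<in> polys_in 3" "quartic3 = (\<Sum>j<m. q j ^ 2)"
    "\<And>x. eval_mpoly quartic3 x = (\<Sum>j<m. eval_mpoly (q j) x ^ 2)"
    by (rule sosE) metis
  have "total_degree (q j) \<le> 2" if "j < m" for j
    unfolding total_degree_le_iff wt_const_1[symmetric]
    using wt_le_of_sum_squares[OF q(2) _ that, of "\<lambda>_. 1" 2] deg total_degree_le_iff[of quartic3 4]
    by (simp add: wt_const_1[unfolded One_nat_def])
  then have "\<forall>j. \<exists>A b c. j < m \<longrightarrow> (\<forall>x. eval_mpoly (q j) x = quadfun 3 A b c x)"
    using eval_mpoly_quadfun[OF q(1)] by metis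
  then obtain A b c where Abc: "\<And>j x. j < m \<Longrightarrow> eval_mpoly (q j) x = quadfun 3 (A j) (b j) (c j) x"
    by metis
  define v :: "real \<Rightarrow> real \<Rightarrow> real \<Rightarrow> nat \<Rightarrow> real" where
    "v x y z i = (if i = 0 then x else if i = 1 then y else z)" for x y z i
  define h where "h j x y z = A j 0 0 * x^2 + A j 1 1 * y^2 + A j 2 2 * z^2 + (A j 0 1 + A j 1 0) * (x * y)
    + (A j 0 2 + A j 2 0) * (x * z) + (A j 1 2 + A j 2 1) * (y * z)" for j x y z
  define l where "l j x y z = b j 0 * x + b j 1 * y + b j 2 * z" for j x y z
  have qv: "eval_mpoly (q j) (v x y z) = h j x y z + l j x y z + c j" if "j < m" for j x y z
    using that by (simp add: Abc quadfun_def lessThan_3 v_def h_def l_def power2_eq_square algebra_simps)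
  have pv: "(\<Sum>j<m. (h j x y z + l j x y z + c j)^2) = x^4 + y^4 + z^4 - 2 * (x^2 + y^2 + z^2) + 24 * (x*y + x*z + y*z) + 113" for x y z
  proof -
    have "(\<Sum>j<m. (h j x y z + l j x y z + c j)^2) = eval_mpoly quartic3 (v x y z)"
      unfolding q(3) by (intro sum.cong refl) (simp add: qv)
    then show ?thesis by (simp add: eval_quartic3 v_def)
  qed
  \<comment> \<open>The polynomial is even, so each root of a square vanishes at a zero and at its
    negative; adding the two equations removes the linear part.\<close>
  have zero: "h j x y z + c j = 0" if "j < m"
    and 0: "x^4 + y^4 + z^4 - 2 * (x^2 + y^2 + z^2) + 24 * (x*y + x*z + y*z) + 113 = 0" for j x y z
  proof -
    have "(\<Sum>j<m. (h j x y z + l j x y z + c j)^2) = 0"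
      using pv[of x y z] 0 by simp
    then have 1: "h j x y z + l j x y z + c j = 0"
      using that(1) by (simp add: sum_nonneg_eq_0_iff)
    have "(\<Sum>j<m. (h j (-x) (-y) (-z) + l j (-x) (-y) (-z) + c j)^2) = 0"
      using pv[of "-x" "-y" "-z"] 0 by simp
    then have 2: "h j (-x) (-y) (-z) + l j (-x) (-y) (-z) + c j = 0"
      using that(1) by (simp add: sum_nonneg_eq_0_iff)
    from 1 2 show ?thesis by (simp add: h_def l_def)
  qed
  have lead: "(\<Sum>j<m. h j x y z ^ 2) = x^4 + y^4 + z^4" for x y z
  proof -
    define S where "S = (\<Sum>j<m. h j x y z ^ 2)"
    define S3 where "S3 = (\<Sum>j<m. 2 * h j x y z * l j x y z)"
    define S2 where "S2 = (\<Sum>j<m. 2 * h j x y z * c j + l j x y z ^ 2)"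
    define S1 where "S1 = (\<Sum>j<m. 2 * l j x y z * c j)"
    define S0 where "S0 = (\<Sum>j<m. c j ^ 2)"
    have "(S0 - 113) + S1 * t + (S2 + 2 * (x^2 + y^2 + z^2) - 24 * (x*y + x*z + y*z)) * t^2 + S3 * t^3
        + (S - (x^4 + y^4 + z^4)) * t^4 = 0" for t
    proof -
      have scale: "h j (t*x) (t*y) (t*z) = t^2 * h j x y z" "l j (t*x) (t*y) (t*z) = t * l j x y z" for j
        by (simp_all add: h_def l_def power2_eq_square algebra_simps)
      have "(h j (t*x) (t*y) (t*z) + l j (t*x) (t*y) (t*z) + c j)^2 = h j x y z ^ 2 * t^4 + (2 * h j x y z * l j x y z) * t^3
        + (2 * h j x y z * c j + l j x y z ^ 2) * t^2 + (2 * l j x y z * c j) * t + c j ^ 2" for j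
        unfolding scale by algebra
      then have "(\<Sum>j<m. (h j (t*x) (t*y) (t*z) + l j (t*x) (t*y) (t*z) + c j)^2) = S * t^4 + S3 * t^3 + S2 * t^2 + S1 * t + S0"
        by (simp add: sum.distrib S_def S3_def S2_def S1_def S0_def sum_distrib_right distrib_right)
      with pv[of "t*x" "t*y" "t*z"] have "S * t^4 + S3 * t^3 + S2 * t^2 + S1 * t + S0 = (t*x)^4 + (t*y)^4 + (t*z)^4
         - 2 * ((t*x)^2 + (t*y)^2 + (t*z)^2) + 24 * ((t*x)*(t*y) + (t*x)*(t*z) + (t*y)*(t*z)) + 113"
        by simp
      then show ?thesis by algebra
    qed
    from quartic_coeffs_zero(5)[OF this] show ?thesis by (simp add: S_def)
  qed
  show False
  proof (rule quartic3_gram_infeasible[of "\<lambda>j. A j 0 0" "\<lambda>j. A j 1 1" "\<lambda>j. A j 2 2" "\<lambda>j. A j 0 1 + A j 1 0"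
      "\<lambda>j. A j 0 2 + A j 2 0" "\<lambda>j. A j 1 2 + A j 2 1" m])
    show "(\<Sum>j<m. (A j 0 0 * x^2 + A j 1 1 * y^2 + A j 2 2 * z^2 + (A j 0 1 + A j 1 0) * (x * y)
      + (A j 0 2 + A j 2 0) * (x * z) + (A j 1 2 + A j 2 1) * (y * z))^2) = x^4 + y^4 + z^4" for x y z
      using lead[of x y z] by (simp only: h_def)
    fix j assume j: "j < m"
    \<comment> \<open>Differences of these three equations eliminate \<open>c j\<close> and leave
      two linear relations between the coefficients of \<open>h j\<close>.\<close>
    have "h j 2 2 (-3) + c j = 0" "h j 2 (-3) 2 + c j = 0" "h j (-3) 2 2 + c j = 0"
      by (rule zero[OF j]; simp)+
    then show "A j 1 1 = A j 0 0 + 2 * (A j 1 2 + A j 2 1) - 2 * (A j 0 2 + A j 2 0)"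
      "A j 2 2 = A j 0 0 + 2 * (A j 1 2 + A j 2 1) - 2 * (A j 0 1 + A j 1 0)"
      by (simp_all add: h_def)
  qed
qed

section \<open>Counterexamples in two variables\<close>

text \<open>With \<open>x = u\<^sup>3 + u\<close> the minimum of \<open>y\<^sup>4 + 2 y\<^sup>2 - 4 x y\<close> over \<open>y\<close> is \<open>- (3 u\<^sup>4 + 2 u\<^sup>2)\<close>, attained at \<open>y = u\<close>. The first
  summand is the Hermite interpolant of \<open>3 u\<^sup>4 + 2 u\<^sup>2\<close>, as a function of \<open>x\<close>, at \<open>u = 0, 1, 2\<close>; the factor 64 only has to be
  large enough.\<close>

definition contact_poly :: "real poly" where
  "contact_poly = smult (1/128000) [:0, 0, 243240, -52116, 5686, -219:] + smult 64 (([:0, 1:] * [:-2, 1:] * [:-10, 1:]) ^ 2)"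

lemma poly_contact_poly:
  "poly contact_poly x = (243240 * x^2 - 52116 * x^3 + 5686 * x^4 - 219 * x^5) / 128000 + 64 * (x * (x - 2) * (x - 10))^2"
  by (simp add: contact_poly_def power2_eq_square eval_nat_numeral field_simps)

lemma degree_contact_poly: "degree contact_poly = 6"
  by (simp add: contact_poly_def power2_eq_square)

text \<open>For x = u^3 + u, the product x (x - 2) (x - 10) equals u (u - 1) (u - 2) P. The Hermite
  interpolant differs from 3 u^4 + 2 u^2 by a multiple of (u (u - 1) (u - 2))^2 with cofactor -K /
  128000. So 64 * 128000 * P^2 >= K suffices, which follows from P >= (1 + u^2)^3 / 4 and the bound
  on K.\<close>

lemma contact_poly_ge: "3 * u^4 + 2 * u^2 \<le> poly contact_poly (u^3 + u)"
proof -
  define K where "K = 3190 + 22599 * u + 30388 * u^2 + 61644 * u^3 + 52776 * u^4 + 37278 * u^5 + 16652 * u^6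
    + 6132 * u^7 + 1314 * u^8 + 219 * u^9"
  define P where "P = (u^2 + 1) * (u^2 + u + 2) * (u^2 + 2 * u + 5)"
  have K: "K \<le> 512000 * (1 + u^2) ^ 6"
  proof -
    \<comment> \<open>K has odd powers of u of either sign; each is absorbed by its two even
      neighbours.\<close>
    have odd: "u ^ (2 * i + 1) \<le> u ^ (2 * i) + u ^ (2 * i + 2)" for i
    proof -
      have "1 - u + u^2 \<ge> 0"
        using zero_le_power2[of "u - 1/2"] by (simp add: power2_eq_square algebra_simps)
      then have "u ^ (2 * i) * (1 - u + u^2) \<ge> 0" by simp
      then show ?thesis by (simp add: algebra_simps power2_eq_square)
    qed
    have "u \<le> 1 + u^2"
      using odd[of 0] by (simp add: power2_eq_square)
    moreover have "u^3 \<le> u^2 + u^4" "u^5 \<le> u^4 + u^6" "u^7 \<le> u^6 + u^8" "u^9 \<le> u^8 + u^10"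
      using odd[of 1] odd[of 2] odd[of 3] odd[of 4] by simp_all
    moreover have "0 \<le> u^2" "0 \<le> u^4" "0 \<le> u^6" "0 \<le> u^8" "0 \<le> u^10" "0 \<le> u^12"
      by simp_all
    moreover have "(1 + u^2) ^ 6 = 1 + 6 * u^2 + 15 * u^4 + 20 * u^6 + 15 * u^8 + 6 * u^10 + u^12"
      by algebra
    ultimately show ?thesis
      unfolding K_def by linarith
  qed
  have "((1 + u^2) * ((1 + u^2) / 2) * ((1 + u^2) / 2)) \<le> P"
    unfolding P_def
  proof (intro mult_mono)
    show "(1 + u^2) / 2 \<le> u^2 + u + 2"
      using zero_le_power2[of "u + 1"] by (simp add: power2_eq_square algebra_simps)
    show "(1 + u^2) / 2 \<le> u^2 + 2 * u + 5"
      using zero_le_power2[of "u + 2"] by (simp add: power2_eq_square algebra_simps)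
    show "0 \<le> (u\<^sup>2 + 1) * (u\<^sup>2 + u + 2)"
      using zero_le_power2[of "u + 1/2"] by (intro mult_nonneg_nonneg) (simp_all add: power2_eq_square algebra_simps)
  qed auto
  then have "((1 + u^2) * ((1 + u^2) / 2) * ((1 + u^2) / 2))^2 \<le> P^2"
    by (intro power_mono) auto
  moreover have "((1 + u^2) * ((1 + u^2) / 2) * ((1 + u^2) / 2))^2 = (1 + u^2)^6 / 16"
    by (simp add: power_mult_distrib power_divide flip: power_mult power_add)
  ultimately have "K \<le> 8192000 * P^2"
    using K by simp
  then have "0 \<le> (u * (u - 1) * (u - 2))^2 * (8192000 * P^2 - K)"
    by simp
  also have "\<dots> = (243240 * (u^3 + u)^2 - 52116 * (u^3 + u)^3 + 5686 * (u^3 + u)^4 - 219 * (u^3 + u)^5)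
      + 8192000 * ((u^3 + u) * ((u^3 + u) - 2) * ((u^3 + u) - 10))^2 - 128000 * (3 * u^4 + 2 * u^2)"
    unfolding K_def P_def by algebra
  finally show ?thesis
    by (simp add: poly_contact_poly field_simps)
qed

lemma contact_bivariate_nonneg:
  "0 \<le> poly contact_poly x + y^4 + 2 * y^2 - 4 * x * y"
proof -
  have "\<exists>u. - \<bar>x\<bar> \<le> u \<and> u \<le> \<bar>x\<bar> \<and> u^3 + u = x"
    by (rule IVT) (auto intro!: continuous_intros, (smt (verit) zero_le_power abs_ge_zero power_minus_odd odd_numeral odd_one)+)
  then obtain u where u: "x = u^3 + u" by metis
  \<comment> \<open>The excess of y^4 + 2 y^2 - 4 x y over its value at y = u has the double root u;
    the other factor is positive.\<close>
  have "0 \<le> (y - u)^2 * ((y + u)^2 + 2 * u^2 + 2)"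
    by simp
  also have "\<dots> = 3 * u^4 + 2 * u^2 + y^4 + 2 * y^2 - 4 * (u^3 + u) * y"
    by algebra
  finally show ?thesis
    using contact_poly_ge[of u] by (simp add: u)
qed

definition perturbed :: "nat \<Rightarrow> real \<Rightarrow> rmpoly" where
  "perturbed d \<delta> = (\<Sum>i<2. univ_mpoly i (if i = 0 then contact_poly + monom \<delta> d else [:0, 0, 2, 0, 1:])) +
     Poly_Mapping.single (Poly_Mapping.single 0 1 + Poly_Mapping.single 1 1) (-4)"

lemma lessThan_2: "{..<2} = {0, 1::nat}"
  by auto

lemma eval_perturbed:
  "eval_mpoly (perturbed d \<delta>) x =
     poly contact_poly (x 0) + x 1 ^ 4 + 2 * x 1 ^ 2 - 4 * x 0 * x 1 + \<delta> * x 0 ^ d"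
  by (simp add: perturbed_def lessThan_2 pp_eval_add poly_monom algebra_simps power2_eq_square power4_eq_xxxx)

lemma perturbed_N_SPQ:
  assumes "n \<ge> 2" "d \<ge> 6" "even d" "\<delta> > 0"
  shows "perturbed d \<delta> \<in> N_SPQ n d"
proof -
  have q: "total_degree (Poly_Mapping.single (Poly_Mapping.single 0 1 + Poly_Mapping.single 1 1) (-4::real)) \<le> 2"
    by (intro total_degree_single_le) simp_all
  have "spq 2 (perturbed d \<delta>)"
    by (rule spq_separable_plus_quadratic[OF _ q perturbed_def]) (intro polys_in_single; simp add: keys_add_nat)
  then have "spq n (perturbed d \<delta>)"
    by (rule spq_mono) fact
  moreover have "total_degree (perturbed d \<delta>) = d"
  proof (rule total_degree_separable_plus_quadratic[OF q perturbed_def])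
    have "degree (contact_poly + monom \<delta> d) \<le> d"
      using assms(2) degree_monom_le[of \<delta> d] by (intro degree_add_le) (simp_all add: degree_contact_poly)
    then show "degree (if i = 0 then contact_poly + monom \<delta> d else [:0, 0, 2, 0, 1:]) \<le> d" for i :: nat
      using assms(2) by simp
    \<comment> \<open>For d = 6 the added monomial meets the leading coefficient 64 of
      \<open>contact_poly\<close>, so its sign decides that the sum is nonzero.\<close>
    have "coeff contact_poly d \<ge> 0"
    proof (cases "d = 6")
      case True
      then show ?thesis
        by (simp add: contact_poly_def power2_eq_square eval_nat_numeral)
    next
      case False
      then show ?thesis using assms(2) by (simp add: coeff_eq_0 degree_contact_poly)
    qed
    then show "coeff (if (0::nat) = 0 then contact_poly + monom \<delta> d else [:0, 0, 2, 0, 1:]) d \<noteq> 0"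
      using assms(4) by simp
  qed (use assms in auto)
  moreover have "nonneg_mpoly (perturbed d \<delta>)"
    unfolding nonneg_mpoly_def
  proof
    fix x :: "nat \<Rightarrow> real"
    have "0 \<le> \<delta> * x 0 ^ d"
      using assms(3,4) by (simp add: zero_le_even_power)
    then show "0 \<le> eval_mpoly (perturbed d \<delta>) x"
      using contact_bivariate_nonneg[of "x 0" "x 1"] by (simp add: eval_perturbed)
  qed
  ultimately show ?thesis by (simp add: N_SPQ_def)
qed

text \<open>If \<open>p = y\<^sup>4 + 2 y\<^sup>2 - 4 x y + \<dots>\<close> is a sum of squares of \<open>\<alpha>\<^sub>j y\<^sup>2 + A\<^sub>j y + B\<^sub>j\<close>, the
  inequality is Cauchy-Schwarz for the inner product with \<open>\<alpha>\<close>, and \<open>a = \<Sum> A\<^sub>j\<^sup>2\<close>.\<close>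

lemma perturbed_sos_imp:
  assumes "sos n (perturbed d \<delta>)"
  obtains a where "\<And>x. poly a x \<ge> 0"
    "\<And>x y. (2 * y^2 + 2 - poly a x)^2 \<le> 4 * (poly contact_poly x + y^4 + 2 * y^2 - 4 * x * y + \<delta> * x^d)"
proof -
  let ?p = "perturbed d \<delta>"
  have in2: "?p \<in> polys_in 2"
    unfolding perturbed_def
    by (intro polys_in_add polys_in_sum univ_mpoly_in_polys_in polys_in_single) (auto simp: keys_add_nat)
  \<comment> \<open>This weight counts only the exponent of y. The polynomial has degree 4 in y, so
    each root of a square has degree at most 2 in y, whatever d is.\<close>
  define w :: "nat \<Rightarrow> nat" where "w i = (if i = 1 then 1 else 0)" for i
  have w: "wt w m = Poly_Mapping.lookup m 1" if "Poly_Mapping.keys m \<subseteq> {..<2}" for m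
    using wt_superset[of "{..<2}" m w] that by (simp add: lessThan_2 w_def)
  have "sos 2 ?p"
    using assms in2 by (rule sos_fewer_vars)
  then obtain m :: nat and q where q: "\<And>j. j < m \<Longrightarrow> q j \<in> polys_in 2" "?p = (\<Sum>j<m. q j ^ 2)"
    "\<And>x. eval_mpoly ?p x = (\<Sum>j<m. eval_mpoly (q j) x ^ 2)"
    by (rule sosE) metis
  have wt4: "\<forall>m \<in> Poly_Mapping.keys ?p. wt w m \<le> 2 * 2"
  proof
    fix m assume m: "m \<in> Poly_Mapping.keys ?p"
    let ?s = "\<lambda>i::nat. if i = 0 then contact_poly + monom \<delta> d else [:0, 0, 2, 0, 1:]"
    let ?q = "Poly_Mapping.single (Poly_Mapping.single 0 1 + Poly_Mapping.single 1 1) (-4 :: real)"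
    have "Poly_Mapping.keys ?p \<subseteq> Poly_Mapping.keys (\<Sum>i<2. univ_mpoly i (?s i)) \<union> Poly_Mapping.keys ?q"
      unfolding perturbed_def by (rule keys_add)
    moreover have "Poly_Mapping.keys (\<Sum>i<2. univ_mpoly i (?s i)) \<subseteq> (\<Union>i<2. Poly_Mapping.keys (univ_mpoly i (?s i)))"
      by (rule keys_sum_rmpoly)
    ultimately have "m \<in> (\<Union>i<2. Poly_Mapping.keys (univ_mpoly i (?s i))) \<union> Poly_Mapping.keys ?q"
      using m by (meson Un_iff subsetD)
    then have "m \<in> Poly_Mapping.keys (univ_mpoly 0 (?s 0)) \<or> m \<in> Poly_Mapping.keys (univ_mpoly 1 (?s 1))
        \<or> m \<in> Poly_Mapping.keys ?q"
      by (auto simp: lessThan_2)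
    then consider k where "m = Poly_Mapping.single 0 k" | k where "m = Poly_Mapping.single 1 k" "k \<le> 4"
      | "m = Poly_Mapping.single 0 1 + Poly_Mapping.single 1 1"
    proof (elim disjE)
      assume "m \<in> Poly_Mapping.keys (univ_mpoly 0 (?s 0))"
      from subsetD[OF keys_univ_mpoly this] show thesis using that(1) by blast
    next
      assume "m \<in> Poly_Mapping.keys (univ_mpoly 1 (?s 1))"
      from subsetD[OF keys_univ_mpoly this] show thesis using that(2) by auto
    next
      assume "m \<in> Poly_Mapping.keys ?q"
      then show thesis using that(3) by simp
    qed
    then have "Poly_Mapping.lookup m 1 \<le> 4"
      by cases (auto simp: lookup_single lookup_add when_def)
    moreover have "Poly_Mapping.keys m \<subseteq> {..<2}"
      using m in2 by (auto simp: polys_in_def)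
    ultimately show "wt w m \<le> 2 * 2" by (simp add: w)
  qed
  \<comment> \<open>The coefficient of y^e in \<open>q j\<close>, as a polynomial in x.\<close>
  define cf where "cf j e = (\<Sum>a \<in> {a \<in> Poly_Mapping.keys (q j). Poly_Mapping.lookup a 1 = e}.
      monom (Poly_Mapping.lookup (q j) a) (Poly_Mapping.lookup a 0))" for j e
  have eval_q: "eval_mpoly (q j) x = poly (cf j 0) (x 0) + poly (cf j 1) (x 0) * x 1 + poly (cf j 2) (x 0) * x 1 ^ 2"
    if j: "j < m" for j x
  proof -
    have keys: "Poly_Mapping.keys a \<subseteq> {..<2}" "Poly_Mapping.lookup a 1 \<le> 2" if "a \<in> Poly_Mapping.keys (q j)" for a
    proof -
      show *: "Poly_Mapping.keys a \<subseteq> {..<2}"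
        using that q(1)[OF j] by (auto simp: polys_in_def)
      show "Poly_Mapping.lookup a 1 \<le> 2"
        using wt_le_of_sum_squares[OF q(2) wt4 j that] w[OF *] by simp
    qed
    have "eval_mpoly (q j) x = (\<Sum>a\<in>Poly_Mapping.keys (q j).
        Poly_Mapping.lookup (q j) a * (x 0 ^ Poly_Mapping.lookup a 0 * x 1 ^ Poly_Mapping.lookup a 1))"
      unfolding eval_mpoly_superset[OF finite_keys order.refl]
      by (intro sum.cong refl arg_cong2[where f = "(*)"]) (use keys(1) in \<open>simp add: pp_eval_superset[of "{..<2}"] lessThan_2\<close>)
    also have "\<dots> = (\<Sum>e\<in>{0,1,2}. \<Sum>a\<in>{a \<in> Poly_Mapping.keys (q j). Poly_Mapping.lookup a 1 = e}.
        Poly_Mapping.lookup (q j) a * (x 0 ^ Poly_Mapping.lookup a 0 * x 1 ^ Poly_Mapping.lookup a 1))"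
      by (rule sum.group[symmetric]) (use keys(2) in \<open>force simp: le_Suc_eq numeral_2_eq_2\<close>)+
    also have "\<dots> = (\<Sum>e\<in>{0,1,2}. poly (cf j e) (x 0) * x 1 ^ e)"
      by (intro sum.cong refl) (auto simp: cf_def poly_sum poly_monom sum_distrib_right sum_distrib_left mult_ac intro!: sum.cong)
    finally show ?thesis by simp
  qed
  define a where "a = (\<Sum>j<m. cf j 1 ^ 2)"
  have "poly a x \<ge> 0" for x
    by (simp add: a_def poly_sum sum_nonneg)
  moreover have "(2 * y^2 + 2 - poly a x)^2 \<le> 4 * (poly contact_poly x + y^4 + 2 * y^2 - 4 * x * y + \<delta> * x^d)" for x y
  proof -
    define \<alpha> where "\<alpha> j = poly (cf j 2) x" for j
    define A where "A j = poly (cf j 1) x" for j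
    define B where "B j = poly (cf j 0) x" for j
    have p: "(\<Sum>j<m. (\<alpha> j * t^2 + A j * t + B j)^2) = poly contact_poly x + t^4 + 2 * t^2 - 4 * x * t + \<delta> * x^d" for t
    proof -
      have "(\<Sum>j<m. (\<alpha> j * t^2 + A j * t + B j)^2) = eval_mpoly ?p (\<lambda>i. if i = 0 then x else t)"
        unfolding q(3) by (intro sum.cong refl) (simp add: eval_q \<alpha>_def A_def B_def add_ac)
      then show ?thesis by (simp add: eval_perturbed)
    qed
    define S4 where "S4 = (\<Sum>j<m. \<alpha> j ^ 2)"
    define S3 where "S3 = (\<Sum>j<m. \<alpha> j * A j)"
    define SA where "SA = (\<Sum>j<m. A j ^ 2)"
    define SB where "SB = (\<Sum>j<m. \<alpha> j * B j)"
    define S1 where "S1 = (\<Sum>j<m. A j * B j)"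
    define S0 where "S0 = (\<Sum>j<m. B j ^ 2)"
    \<comment> \<open>For fixed x this compares coefficients in the second variable. The outcome
      needed is S4 = 1, S3 = 0 and SA + 2 SB = 2.\<close>
    have "(S0 - poly contact_poly x - \<delta> * x^d) + (2 * S1 + 4 * x) * t + (SA + 2 * SB - 2) * t^2 + (2 * S3) * t^3 + (S4 - 1) * t^4 = 0" for t
    proof -
      have "(\<alpha> j * t^2 + A j * t + B j)^2 = \<alpha> j ^ 2 * t^4 + (\<alpha> j * A j) * (2 * t^3) + A j ^ 2 * t^2 + (\<alpha> j * B j) * (2 * t^2)
          + (A j * B j) * (2 * t) + B j ^ 2" for j
        by algebra
      then have "(\<Sum>j<m. (\<alpha> j * t^2 + A j * t + B j)^2) = S4 * t^4 + S3 * (2 * t^3) + SA * t^2 + SB * (2 * t^2) + S1 * (2 * t) + S0"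
        by (simp only: sum.distrib S4_def S3_def SA_def SB_def S1_def S0_def sum_distrib_right)
      then show ?thesis
        unfolding p by (simp add: algebra_simps)
    qed
    note coeffs = quartic_coeffs_zero[OF this]
    \<comment> \<open>Pairing with the vector \<alpha>, of norm 1, leaves y^2 + SB, and SB = 1 - SA
      / 2 brings in the polynomial a.\<close>
    have "\<alpha> j * (\<alpha> j * y^2 + A j * y + B j) = \<alpha> j ^ 2 * y^2 + (\<alpha> j * A j) * y + \<alpha> j * B j" for j
      by algebra
    then have "(\<Sum>j<m. \<alpha> j * (\<alpha> j * y^2 + A j * y + B j)) = S4 * y^2 + S3 * y + SB"
      by (simp only: sum.distrib S4_def S3_def SB_def sum_distrib_right)
    also have "\<dots> = (2 * y^2 + 2 - SA) / 2"
      using coeffs by simp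
    finally have "((2 * y^2 + 2 - SA) / 2)^2 = (\<Sum>j<m. \<alpha> j * (\<alpha> j * y^2 + A j * y + B j))^2"
      by (simp only:)
    also have "\<dots> \<le> (\<Sum>j<m. \<alpha> j ^ 2) * (\<Sum>j<m. (\<alpha> j * y^2 + A j * y + B j)^2)"
      by (rule Cauchy_Schwarz_ineq_sum)
    also have "(\<Sum>j<m. \<alpha> j ^ 2) = 1"
      using coeffs(5) by (simp add: S4_def)
    finally have "(2 * y^2 + 2 - SA)^2 \<le> 4 * (poly contact_poly x + y^4 + 2 * y^2 - 4 * x * y + \<delta> * x^d)"
      unfolding p by (simp add: power_divide)
    moreover have "SA = poly a x"
      by (simp add: SA_def a_def A_def poly_sum)
    ultimately show ?thesis by simp
  qed
  ultimately show ?thesis using that by blast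
qed

text \<open>The difference g - f^2 is nonnegative, hence a sum of squares, so f is one of the terms
  in a representation of g as a sum of squares, where degrees cannot cancel.\<close>

lemma degree_le_of_square_le:
  fixes f g :: "real poly"
  assumes le: "\<And>x. poly f x ^ 2 \<le> poly g x" and deg: "degree g \<le> 2 * k + 1"
  shows "degree f \<le> k"
proof -
  have "poly (g - f ^ 2) x \<ge> 0" for x
    using le[of x] by simp
  then obtain m :: nat and q where q: "g - f ^ 2 = (\<Sum>j<m. q j ^ 2)"
    using nonneg_poly_sum_of_squares by metis
  define r where "r j = (if j < m then q j else f)" for j
  have "(\<Sum>j<Suc m. r j ^ 2) = (\<Sum>j<m. q j ^ 2) + f ^ 2"
    by (simp add: r_def)
  also have "\<dots> = g"
    by (simp flip: q)
  finally have "degree (r m) \<le> k"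
    using deg by (intro degree_le_of_sum_squares[of "{..<Suc m}" r]) auto
  then show ?thesis by (simp add: r_def)
qed

text \<open>The polynomial \<open>a\<close> interpolates \<open>2, 4, 10\<close> at \<open>0, 2, 10\<close>, but it is a nonnegative quadratic, hence convex.\<close>

lemma contact_pins_infeasible:
  assumes nonneg: "\<And>x. poly a x \<ge> 0"
    and bound: "\<And>x y. (2 * y^2 + 2 - poly a x)^2 \<le> 4 * (poly contact_poly x + y^4 + 2 * y^2 - 4 * x * y)"
  shows False
proof -
  \<comment> \<open>At y = 0 the bound compares (2 - a)^2 with a polynomial of degree 6. In
    \<open>bound[of ...]\<close> the value of y precedes that of x.\<close>
  have "poly ([:2:] - a) x ^ 2 \<le> poly (smult 4 contact_poly) x" for x
    using bound[of 0 x] by simp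
  then have "degree ([:2:] - a) \<le> 3"
    by (rule degree_le_of_square_le) (simp add: degree_contact_poly)
  then have "degree ([:2:] - ([:2:] - a)) \<le> 3"
    by (rule degree_diff_le[rotated]) simp
  moreover have "[:2:] - ([:2:] - a) = a"
    by (rule diff_diff_eq2[THEN trans]) simp
  ultimately have a3: "degree a \<le> 3"
    by (simp only:)
  \<comment> \<open>A nonnegative polynomial has even degree: as a sum of squares of degree at most
    3, a has only linear roots and hence degree at most 2.\<close>
  obtain m :: nat and q where q: "a = (\<Sum>j<m. q j ^ 2)"
    using nonneg_poly_sum_of_squares[OF nonneg] by metis
  have "degree (q j) \<le> 1" if "j < m" for j
    by (rule degree_le_of_sum_squares[of "{..<m}" q]) (use a3 q that in auto)
  then have "degree a \<le> 2"
    unfolding q by (intro degree_sum_le) (auto intro!: order.trans[OF degree_power_le] mult_le_mono)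
  then have "poly a x = (\<Sum>i\<le>2. coeff a i * x ^ i)" for x
    unfolding poly_altdef by (intro sum.mono_neutral_left) (auto simp: coeff_eq_0 not_le)
  then have a: "poly a x = coeff a 2 * x^2 + coeff a 1 * x + coeff a 0" for x
    by (simp add: numeral_2_eq_2)
  \<comment> \<open>The right-hand side of \<open>bound\<close> vanishes at the three contact
    points, so a must equal 2 y^2 + 2 there.\<close>
  have "poly a 0 = 2" "poly a 2 = 4" "poly a 10 = 10"
    using bound[of 0 0] bound[of 1 2] bound[of 2 10] by (simp_all add: poly_contact_poly)
  moreover have "coeff a 2 \<ge> 0"
    using nonneg_quadratic_discrim(1)[of "coeff a 2" "coeff a 1" "coeff a 0"] nonneg by (simp add: a)
  ultimately show False by (simp add: a)
qed

text \<open>Lagrange interpolation at 0, ..., D. The value at x is a fixed linear combination of D +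
  1 samples, so polynomials of bounded degree that converge at the nodes converge everywhere, to a
  polynomial.\<close>

lemma lagrange_basis:
  obtains l :: "nat \<Rightarrow> real poly" where "\<And>p x. degree p \<le> D \<Longrightarrow> poly p x = (\<Sum>i\<le>D. poly p (real i) * poly (l i) x)"
proof -
  define l :: "nat \<Rightarrow> real poly" where "l i = (\<Prod>j\<in>{..D} - {i}. smult (1 / (real i - real j)) [:- real j, 1:])" for i
  have l: "poly (l i) (real k) = (if k = i then 1 else 0)" if "i \<le> D" "k \<le> D" for i k
  proof (cases "k = i")
    case True
    then show ?thesis
      by (auto simp: l_def poly_prod simp flip: diff_divide_distrib intro!: prod.neutral)
  next
    case False
    then show ?thesis using that by (auto simp: l_def poly_prod intro!: prod_zero)
  qed
  have deg: "degree (l i) \<le> D" if "i \<le> D" for i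
  proof -
    have "degree (l i) \<le> (\<Sum>j\<in>{..D} - {i}. degree (smult (1 / (real i - real j)) [:- real j, 1:]))"
      unfolding l_def by (rule order.trans[OF degree_prod_sum_le]) (simp_all add: o_def)
    also have "\<dots> \<le> (\<Sum>j\<in>{..D} - {i}. 1)"
      by (intro sum_mono) simp
    also have "\<dots> = D" using that by simp
    finally show ?thesis .
  qed
  have "poly p x = (\<Sum>i\<le>D. poly p (real i) * poly (l i) x)" if "degree p \<le> D" for p x
  proof -
    have "p = (\<Sum>i\<le>D. smult (poly p (real i)) (l i))"
    proof (rule poly_eqI_degree)
      fix x assume "x \<in> real ` {..D}"
      then obtain k where k: "x = real k" "k \<le> D" by auto
      then show "poly p x = poly (\<Sum>i\<le>D. smult (poly p (real i)) (l i)) x"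
        by (simp add: poly_sum l if_distrib cong: if_cong)
    next
      show "degree p < card (real ` {..D})"
        using that by (simp add: card_image inj_on_def)
      have "degree (\<Sum>i\<le>D. smult (poly p (real i)) (l i)) \<le> D"
        using deg by (intro degree_sum_le) (auto intro: order.trans[OF degree_smult_le])
      then show "degree (\<Sum>i\<le>D. smult (poly p (real i)) (l i)) < card (real ` {..D})"
        by (simp add: card_image inj_on_def)
    qed
    then show ?thesis
      by (metis (no_types, lifting) poly_smult poly_sum sum.cong)
  qed
  then show ?thesis using that by blast
qed

lemma convergent_subsequence_finite:
  fixes v :: "nat \<Rightarrow> nat \<Rightarrow> real"
  assumes "\<And>i k. i < D \<Longrightarrow> \<bar>v k i\<bar> \<le> C i"
  obtains r where "strict_mono r" "\<And>i. i < D \<Longrightarrow> convergent (\<lambda>k. v (r k) i)"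
proof -
  have "\<exists>r. strict_mono (r :: nat \<Rightarrow> nat) \<and> (\<forall>i<D. convergent (\<lambda>k. v (r k) i))"
    using assms
  proof (induction D)
    case 0
    show ?case by (rule exI[of _ id]) (simp add: strict_mono_def)
  next
    case (Suc D)
    then obtain r :: "nat \<Rightarrow> nat" where r: "strict_mono r" "\<And>i. i < D \<Longrightarrow> convergent (\<lambda>k. v (r k) i)"
      by (meson less_SucI)
    have "bounded (range (\<lambda>k. v (r k) D))"
      unfolding bounded_iff using Suc.prems[of D] by auto
    then obtain l s where s: "strict_mono s" "((\<lambda>k. v (r k) D) \<circ> s) \<longlonglongrightarrow> l"
      using bounded_imp_convergent_subsequence by metis
    have "convergent (\<lambda>k. v ((r \<circ> s) k) i)" if "i < Suc D" for i
    proof (cases "i = D")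
      case True
      then show ?thesis using s(2) by (auto simp: convergent_def o_def)
    next
      case False
      then have "convergent ((\<lambda>k. v (r k) i) \<circ> s)"
        using r(2)[of i] that s(1) by (intro convergent_subseq_convergent) auto
      then show ?thesis by (simp add: o_def)
    qed
    then show ?case
      using strict_mono_o[OF r(1) s(1)] by blast
  qed
  then show ?thesis using that by blast
qed

text \<open>For a fixed degree the certificates \<open>a\<close> for \<open>\<delta> = 1, 1/2, 1/3, \<dots>\<close> stay bounded, so a limit would be
  a certificate for \<open>\<delta> = 0\<close>.\<close>

lemma perturbed_not_sos:
  assumes "d \<ge> 6" "even d"
  shows "\<exists>\<delta>>0. \<not> sos n (perturbed d \<delta>)"
proof (rule ccontr)
  assume "\<not> ?thesis"
  then have sos: "sos n (perturbed d (1 / real (Suc k)))" for k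
    by simp
  have "\<exists>a. (\<forall>x. poly a x \<ge> 0) \<and> (\<forall>x y. (2 * y^2 + 2 - poly a x)^2
      \<le> 4 * (poly contact_poly x + y^4 + 2 * y^2 - 4 * x * y + 1 / real (Suc k) * x^d))" for k
    using perturbed_sos_imp[OF sos[of k]] by metis
  then obtain a where a: "\<And>k x. poly (a k) x \<ge> 0"
    "\<And>k x y. (2 * y^2 + 2 - poly (a k) x)^2 \<le> 4 * (poly contact_poly x + y^4 + 2 * y^2 - 4 * x * y + 1 / real (Suc k) * x^d)"
    by metis
  \<comment> \<open>The bound d is crude, but it does not depend on k, so d + 1 sample points
    control all certificates at once.\<close>
  have deg: "degree (a k) \<le> d" for k
  proof -
    have "poly ([:2:] - a k) x ^ 2 \<le> poly (smult 4 (contact_poly + monom (1 / real (Suc k)) d)) x" for x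
      using a(2)[of 0 k x] by (simp add: poly_monom)
    moreover have "degree (smult 4 (contact_poly + monom (1 / real (Suc k)) d)) \<le> 2 * d + 1"
    proof -
      have "degree (contact_poly + monom (1 / real (Suc k)) d) \<le> d"
        using assms(1) degree_monom_le[of _ d] by (intro degree_add_le) (simp_all add: degree_contact_poly)
      then show ?thesis by simp
    qed
    ultimately have "degree ([:2:] - a k) \<le> d"
      by (rule degree_le_of_square_le)
    then have "degree ([:2:] - ([:2:] - a k)) \<le> d"
      by (rule degree_diff_le[rotated]) simp
    moreover have "[:2:] - ([:2:] - a k) = a k"
      by (rule diff_diff_eq2[THEN trans]) simp
    ultimately show ?thesis
      by (simp only:)
  qed
  \<comment> \<open>The bound for y = 0 at the node i, with 1 / Suc k replaced by 1. The inner 1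
    comes from z <= 1 + z^2, the 2 from the triangle inequality.\<close>
  define C where "C i = 2 + (1 + 4 * (poly contact_poly (real i) + real i ^ d))" for i
  have bnd: "\<bar>poly (a k) (real i)\<bar> \<le> C i" for k i
  proof -
    define X where "X = 4 * (poly contact_poly (real i) + real i ^ d)"
    have "(2 - poly (a k) (real i))^2 \<le> 4 * (poly contact_poly (real i) + 1 / real (Suc k) * real i ^ d)"
      using a(2)[of 0 k "real i"] by simp
    also have "\<dots> \<le> X"
      unfolding X_def by (simp add: mult_left_le_one_le divide_le_eq mult_le_cancel_left1)
    finally have X: "(2 - poly (a k) (real i))^2 \<le> X" .
    have "z \<le> 1 + z^2" for z :: real
      using zero_le_power2[of "z - 1/2"] by (simp add: power2_eq_square algebra_simps)
    from this[of "\<bar>2 - poly (a k) (real i)\<bar>"]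
    have "\<bar>2 - poly (a k) (real i)\<bar> \<le> 1 + (2 - poly (a k) (real i))^2"
      by simp
    with X show ?thesis unfolding C_def X_def[symmetric] by linarith
  qed
  obtain l where l: "\<And>p x. degree p \<le> d \<Longrightarrow> poly p x = (\<Sum>i\<le>d. poly p (real i) * poly (l i) x)"
    using lagrange_basis[of d] by metis
  obtain r where r: "strict_mono r" "\<And>i. i < Suc d \<Longrightarrow> convergent (\<lambda>k. poly (a (r k)) (real i))"
    using convergent_subsequence_finite[of "Suc d" "\<lambda>k i. poly (a k) (real i)" C] bnd by metis
  define v where "v i = lim (\<lambda>k. poly (a (r k)) (real i))" for i
  define b where "b = (\<Sum>i\<le>d. smult (v i) (l i))"
  have lim: "(\<lambda>k. poly (a (r k)) x) \<longlonglongrightarrow> poly b x" for x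
  proof -
    have "(\<lambda>k. \<Sum>i\<le>d. poly (a (r k)) (real i) * poly (l i) x) \<longlonglongrightarrow> (\<Sum>i\<le>d. v i * poly (l i) x)"
      unfolding v_def using r(2)
      by (intro tendsto_sum tendsto_mult_right) (simp add: convergent_LIMSEQ_iff)
    moreover have "poly (a (r k)) x = (\<Sum>i\<le>d. poly (a (r k)) (real i) * poly (l i) x)" for k
      by (rule l[OF deg])
    ultimately show ?thesis by (simp add: b_def poly_sum)
  qed
  show False
  proof (rule contact_pins_infeasible)
    show "poly b x \<ge> 0" for x
      using lim[of x] a(1) by (intro LIMSEQ_le_const) auto
    show "(2 * y^2 + 2 - poly b x)^2 \<le> 4 * (poly contact_poly x + y^4 + 2 * y^2 - 4 * x * y)" for x y
    proof (rule LIMSEQ_le)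
      show "(\<lambda>k. (2 * y^2 + 2 - poly (a (r k)) x)^2) \<longlonglongrightarrow> (2 * y^2 + 2 - poly b x)^2"
        by (intro tendsto_intros lim)
      have "(\<lambda>k. 1 / real (Suc k)) \<longlonglongrightarrow> 0"
        by (rule LIMSEQ_Suc[OF lim_1_over_n])
      from LIMSEQ_subseq_LIMSEQ[OF this r(1)] have "(\<lambda>k. 1 / real (Suc (r k))) \<longlonglongrightarrow> 0"
        by (simp add: o_def)
      then have "(\<lambda>k. 4 * (poly contact_poly x + y^4 + 2 * y^2 - 4 * x * y + 1 / real (Suc (r k)) * x^d))
          \<longlonglongrightarrow> 4 * (poly contact_poly x + y^4 + 2 * y^2 - 4 * x * y + 0 * x^d)"
        by (intro tendsto_intros)
      then show "(\<lambda>k. 4 * (poly contact_poly x + y^4 + 2 * y^2 - 4 * x * y + 1 / real (Suc (r k)) * x^d))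
          \<longlonglongrightarrow> 4 * (poly contact_poly x + y^4 + 2 * y^2 - 4 * x * y)"
        by simp
    qed (use a(2) in auto)
  qed
qed

theorem theorem3p1:
  fixes n d :: nat
  assumes "n \<ge> 1" and "d \<ge> 2" and "even d"
  shows "Sigma_SPQ n d = N_SPQ n d \<longleftrightarrow> n = 1 \<or> d = 2 \<or> (n, d) = (2, 4)"
proof
  assume "n = 1 \<or> d = 2 \<or> (n, d) = (2, 4)"
  then have "sos n p" if "p \<in> N_SPQ n d" for p
    using that sos_if_nonneg_univariate[of p] sos_if_nonneg_quadratic[of p n] sos_if_nonneg_bivariate_quartic[of p]
    by (auto simp: N_SPQ_def spq_def)
  then show "Sigma_SPQ n d = N_SPQ n d"
    using sos_imp_nonneg by (auto simp: Sigma_SPQ_def N_SPQ_def)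
next
  assume eq: "Sigma_SPQ n d = N_SPQ n d"
  show "n = 1 \<or> d = 2 \<or> (n, d) = (2, 4)"
  proof (rule ccontr)
    assume *: "\<not> ?thesis"
    then have "n \<ge> 2" "d \<noteq> 3" "d \<noteq> 5"
      using assms by auto
    \<comment> \<open>Evenness has excluded 3 and 5, so outside the three exceptional cases either d
      = 4 with n >= 3 or d >= 6 remains.\<close>
    with * assms(2) consider "n \<ge> 3" "d = 4" | "d \<ge> 6" by fastforce
    then show False
    proof cases
      case 1
      then have "sos n quartic3"
        using quartic3_N_SPQ[of n] eq by (auto simp: Sigma_SPQ_def)
      then show ?thesis using quartic3_not_sos by blast
    next
      case 2
      obtain \<delta> where \<delta>: "\<delta> > 0" "\<not> sos n (perturbed d \<delta>)"
        using perturbed_not_sos[OF 2 assms(3)] by metis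
      have "perturbed d \<delta> \<in> Sigma_SPQ n d"
        using perturbed_N_SPQ[OF \<open>n \<ge> 2\<close> 2 assms(3) \<delta>(1)] eq by simp
      then show ?thesis using \<delta>(2) by (simp add: Sigma_SPQ_def)
    qed
  qed
qed

end
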